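(* Let $\mu\in\mathcal{M}$ and let $d\nu(x)=x\,d\mu(x)$. (i) For $f\in L^2(\mathbb{R}_+)$, denote $$F(t)=-\int_0^\infty h_\nu(t+s)f(s)\,ds,\quad t>0.$$ Then $f\in\operatorname{Dom}\Gamma_\mu$ if and only if $F$ is the distributional derivative (on $\mathbb{R}_+$) of a function in $L^2(\mathbb{R}_+)$. Moreover, in this case $\Gamma_\mu f$ is uniquely defined by $(\Gamma_\mu f)'(t)=F(t)$, $t>0$. (ii) We have $C^\infty_{\mathrm{comp},0}(\mathbb{R}_+)\subset\operatorname{Dom}\Gamma_\mu$, and $C^\infty_{\mathrm{comp},0}(\mathbb{R}_+)$ is dense in $\operatorname{Dom}\Gamma_\mu$ in the graph norm of $\Gamma_\mu$. Equivalently, the restriction $\Gamma_\mu|_{C^\infty_{\mathrm{comp},0}(\mathbb{R}_+)}$ is essentially self-adjoint.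
   Context: $\mathbb{R}_+=(0,\infty)$. $\mathcal{M}$ is the class of positive Borel measures $\mu$ on $\mathbb{R}$ with $\operatorname{supp}\mu\subset[0,\infty)$, $\mu(\{0\})=0$ and $\int_0^\infty e^{-tx}\,d\mu(x)<\infty$ for all $t>0$. For $\mu\in\mathcal{M}$, $h_\mu(t)=\int_0^\infty e^{-tx}\,d\mu(x)$, $t>0$. If $\mu\in\mathcal{M}$ and $d\nu(x)=x\,d\mu(x)$, then $\nu\in\mathcal{M}$, $h_\nu=-h_\mu'$, and $h_\nu(t)=O(1/t)$ as $t\to\infty$ (so the integral defining $F$ converges absolutely for every $f\in L^2(\mathbb{R}_+)$). For $f\in L^2(\mathbb{R}_+)$, $\mathcal{L}f(x)=\int_0^\infty e^{-tx}f(t)\,dt$, $x>0$. The quadratic form $Q_\mu[f]=\int_0^\infty|\mathcal{L}f(x)|^2\,d\mu(x)$ with domain $\{f\in L^2(\mathbb{R}_+): Q_\mu[f]<\infty\}$ is densely defined, non-negative and closed, and the Hankel operator $\Gamma_\mu$ is by definition the (positive semi-definite) self-adjoint operator on $L^2(\mathbb{R}_+)$ corresponding to the form $Q_\mu$. $C^\infty_{\mathrm{comp}}(\mathbb{R}_+)$ is the set of infinitely smooth functions with compact support in $(0,\infty)$, and $C^\infty_{\mathrm{comp},0}(\mathbb{R}_+)=\{f\in C^\infty_{\mathrm{comp}}(\mathbb{R}_+): \int_0^\infty f(t)\,dt=0\}=\{g': g\in C^\infty_{\mathrm{comp}}(\mathbb{R}_+)\}$. The graph norm of an operator $A$ is $(\|f\|^2+\|Af\|^2)^{1/2}$.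 *)

theory Defs
  imports "HOL-Analysis.Analysis"
begin

section \<open>The space $L^2$ of the half-line\<close>

text \<open>
  Elements of the complex space $L^2(0,\infty)$ are represented by Borel measurable
  square-integrable functions. Values outside the open half-line play no role, and two
  functions represent the same element iff they agree almost everywhere on it.
\<close>

abbreviation halfline :: "real measure" where
  "halfline \<equiv> restrict_space lborel {0<..}"

definition L2 :: "(real \<Rightarrow> complex) set" where
  "L2 = {f. f \<in> borel_measurable halfline \<and> integrable halfline (\<lambda>t. (norm (f t))\<^sup>2)}"

definition L2_inner :: "(real \<Rightarrow> complex) \<Rightarrow> (real \<Rightarrow> complex) \<Rightarrow> complex" where
  "L2_inner f g = (LINT t|halfline. f t * cnj (g t))"

definition L2_norm :: "(real \<Rightarrow> complex) \<Rightarrow> real" where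
  "L2_norm f = sqrt (LINT t|halfline. (norm (f t))\<^sup>2)"

section \<open>Unbounded operators\<close>

text \<open>
  An operator is represented by its graph, a set of pairs of representatives; its domain is
  \<^const>\<open>Domain\<close> of the graph. The adjoint is formed as that of a linear relation; for a
  densely defined operator it is single-valued up to almost everywhere equality.
\<close>

type_synonym L2_operator = "((real \<Rightarrow> complex) \<times> (real \<Rightarrow> complex)) set"

definition densely_defined :: "L2_operator \<Rightarrow> bool" where
  "densely_defined A \<longleftrightarrow>
     (\<forall>g\<in>L2. \<forall>\<epsilon>>0. \<exists>f\<in>Domain A. L2_norm (\<lambda>t. g t - f t) < \<epsilon>)"

definition adjoint_op :: "L2_operator \<Rightarrow> L2_operator" where
  "adjoint_op A = {(g, v). g \<in> L2 \<and> v \<in> L2 \<and>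
     (\<forall>(f, w)\<in>A. L2_inner w g = L2_inner f v)}"

definition self_adjoint :: "L2_operator \<Rightarrow> bool" where
  "self_adjoint A \<longleftrightarrow> densely_defined A \<and> adjoint_op A = A"

definition symmetric_op :: "L2_operator \<Rightarrow> bool" where
  "symmetric_op A \<longleftrightarrow> densely_defined A \<and> A \<subseteq> adjoint_op A"

definition graph_norm :: "(real \<Rightarrow> complex) \<Rightarrow> (real \<Rightarrow> complex) \<Rightarrow> real" where
  "graph_norm f w = sqrt ((L2_norm f)\<^sup>2 + (L2_norm w)\<^sup>2)"

definition closure_op :: "L2_operator \<Rightarrow> L2_operator" where
  "closure_op A = {(f, w). f \<in> L2 \<and> w \<in> L2 \<and>
     (\<forall>\<epsilon>>0. \<exists>(f', w')\<in>A. graph_norm (\<lambda>t. f t - f' t) (\<lambda>t. w t - w' t) < \<epsilon>)}"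

definition essentially_self_adjoint :: "L2_operator \<Rightarrow> bool" where
  "essentially_self_adjoint A \<longleftrightarrow> symmetric_op A \<and> self_adjoint (closure_op A)"

definition restrict_op :: "L2_operator \<Rightarrow> (real \<Rightarrow> complex) set \<Rightarrow> L2_operator" where
  "restrict_op A D = {(f, w) \<in> A. f \<in> D}"

text \<open>
  The operator associated with a sesquilinear form \<open>q\<close> on the domain \<open>D\<close>: \<open>f\<close> is in its
  domain iff there is \<open>w\<close> in $L^2$ representing the functional \<open>q f\<close> on \<open>D\<close>, and \<open>w\<close> is then
  the image of \<open>f\<close>. For a densely defined, non-negative, closed form this is the self-adjoint
  operator of the (first) representation theorem.
\<close>

definition form_operator ::
  "(real \<Rightarrow> complex) set \<Rightarrow> ((real \<Rightarrow> complex) \<Rightarrow> (real \<Rightarrow> complex) \<Rightarrow> complex) \<Rightarrow> L2_operator"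
where
  "form_operator D q = {(f, w). f \<in> D \<and> w \<in> L2 \<and> (\<forall>g\<in>D. q f g = L2_inner w g)}"

section \<open>The measures and the Hankel operator\<close>

definition measure_support :: "real measure \<Rightarrow> real set" where
  "measure_support \<mu> = {x. \<forall>U. open U \<and> x \<in> U \<longrightarrow> emeasure \<mu> U > 0}"

text \<open>
  As there is no mass at \<open>0\<close>, all integrals with respect to \<open>\<mu>\<close> over $[0,\infty)$ are written
  as integrals over the open half-line.
\<close>

definition class_M :: "real measure set" where
  "class_M = {\<mu>. sets \<mu> = sets borel \<and> measure_support \<mu> \<subseteq> {0..} \<and> emeasure \<mu> {0} = 0 \<and>
     (\<forall>t>0. (\<integral>\<^sup>+ x\<in>{0<..}. ennreal (exp (- (t * x))) \<partial>\<mu>) < \<infinity>)}"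

definition h :: "real measure \<Rightarrow> real \<Rightarrow> real" where
  "h \<mu> t = (LINT x:{0<..}|\<mu>. exp (- (t * x)))"

definition laplace :: "(real \<Rightarrow> complex) \<Rightarrow> real \<Rightarrow> complex" where
  "laplace f x = (LINT t|halfline. exp (- (t * x)) *\<^sub>R f t)"

definition Q :: "real measure \<Rightarrow> (real \<Rightarrow> complex) \<Rightarrow> ennreal" where
  "Q \<mu> f = (\<integral>\<^sup>+ x\<in>{0<..}. ennreal ((norm (laplace f x))\<^sup>2) \<partial>\<mu>)"

definition Q_dom :: "real measure \<Rightarrow> (real \<Rightarrow> complex) set" where
  "Q_dom \<mu> = {f \<in> L2. Q \<mu> f < \<infinity>}"

text \<open>The sesquilinear form obtained from \<^const>\<open>Q\<close> by polarization.\<close>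

definition Q_form :: "real measure \<Rightarrow> (real \<Rightarrow> complex) \<Rightarrow> (real \<Rightarrow> complex) \<Rightarrow> complex" where
  "Q_form \<mu> f g = (LINT x:{0<..}|\<mu>. laplace f x * cnj (laplace g x))"

definition hankel :: "real measure \<Rightarrow> L2_operator" where
  "hankel \<mu> = form_operator (Q_dom \<mu>) (Q_form \<mu>)"

section \<open>Test functions and distributional derivatives\<close>

text \<open>Test functions on the half-line are extended by zero to the whole line.\<close>

definition smooth :: "(real \<Rightarrow> complex) \<Rightarrow> bool" where
  "smooth \<phi> \<longleftrightarrow> (\<exists>D :: nat \<Rightarrow> real \<Rightarrow> complex. D 0 = \<phi> \<and>
     (\<forall>n t. (D n has_vector_derivative D (Suc n) t) (at t)))"

definition C_comp :: "(real \<Rightarrow> complex) set" where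
  "C_comp = {\<phi>. smooth \<phi> \<and> compact (closure (support_on UNIV \<phi>)) \<and>
     closure (support_on UNIV \<phi>) \<subseteq> {0<..}}"

definition C_comp0 :: "(real \<Rightarrow> complex) set" where
  "C_comp0 = {\<phi> \<in> C_comp. (LINT t|halfline. \<phi> t) = 0}"

definition locally_integrable :: "(real \<Rightarrow> complex) \<Rightarrow> bool" where
  "locally_integrable f \<longleftrightarrow> (\<forall>a b. 0 < a \<longrightarrow> set_integrable lborel {a..b} f)"

definition has_distributional_derivative ::
  "(real \<Rightarrow> complex) \<Rightarrow> (real \<Rightarrow> complex) \<Rightarrow> bool"
where
  "has_distributional_derivative G F \<longleftrightarrow>
     locally_integrable G \<and> locally_integrable F \<and>
     (\<forall>\<phi>\<in>C_comp. (LINT t|halfline. G t * vector_derivative \<phi> (at t)) =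
                - (LINT t|halfline. F t * \<phi> t))"

end

theory Submission
  imports Defs
begin

text \<open>
  Write \<open>L\<close> for the Laplace transform, \<open>\<kappa>\<close> for the restriction of \<open>\<mu>\<close> to the open half-line and
  \<open>\<Gamma>\<close> for the Hankel operator. Fubini gives \<open>F(t) = - \<integral> x e\<^sup>-\<^sup>t\<^sup>x Lf(x) d\<kappa>(x)\<close>, and \<open>L(\<psi>') = x L\<psi>\<close> for
  a test function \<open>\<psi>\<close>. Hence \<open>G' = F\<close> in the sense of distributions means
  \<open>\<integral> G \<psi>' dt = \<integral> Lf L(\<psi>') d\<kappa>\<close> for all test functions \<open>\<psi>\<close>; this relation between \<open>f\<close> and \<open>G\<close> is
  called \<open>weak_image\<close> below. The right-hand side makes sense for every \<open>f\<close> in \<open>L\<^sup>2\<close>: one has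
  \<open>|Lf(x)| \<le> \<parallel>f\<parallel> / \<surd>x\<close>, the factor \<open>x\<close> repairs the singularity at \<open>0\<close>, and \<open>L\<psi>\<close> decays
  exponentially because \<open>\<psi>\<close> vanishes near \<open>0\<close>.

  If \<open>\<Gamma>f = G\<close>, the relation holds because \<open>\<psi>'\<close> lies in the form domain. The converse is the heart
  of the matter: nothing is assumed about \<open>Q[f]\<close>, and only functions of mean zero may be used as
  tests. Test functions of the form \<open>\<psi>(t) = \<Phi>(t) - \<Phi>(t - \<delta>)\<close>, where \<open>\<Phi>' = \<phi>\<close> has arbitrary mean,
  turn the weak relation into the pointwise identity (\<open>weak_image_difference\<close>)
  \<open>G(t) - G(t + \<delta>) = \<integral> e\<^sup>-\<^sup>t\<^sup>x (1 - e\<^sup>-\<^sup>\<delta>\<^sup>x) Lf(x) d\<kappa>(x)\<close> for almost every \<open>t\<close>.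
  Moving \<open>t\<close> by \<open>\<epsilon>\<close> and pairing with any \<open>g\<close> in \<open>L\<^sup>2\<close> yields (\<open>weak_image_shifted_pairing\<close>)
  \<open>\<integral> (G(t + \<epsilon>) - G(t + \<epsilon> + \<delta>)) g(t) dt = \<integral> e\<^sup>-\<^sup>\<epsilon>\<^sup>x (1 - e\<^sup>-\<^sup>\<delta>\<^sup>x) Lf Lg d\<kappa>\<close>.
  The multiplier on the right is non-negative and tends to \<open>1\<close> as \<open>\<epsilon> \<rightarrow> 0\<close>, \<open>\<delta> \<rightarrow> \<infinity>\<close>. For \<open>g\<close> the complex
  conjugate of \<open>f\<close> the left-hand side is at most \<open>2 \<parallel>G\<parallel> \<parallel>f\<parallel>\<close>, so Fatou's lemma gives
  \<open>Q[f] < \<infinity>\<close> (\<open>weak_image_in_form_domain\<close>). With that, dominated convergence for general \<open>g\<close> in the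
  form domain shows that \<open>G\<close> represents the form at \<open>f\<close> (\<open>weak_image_represents_form\<close>), that is
  \<open>\<Gamma>f = G\<close>. Uniqueness is the case \<open>f = 0\<close>: then \<open>G(t) = G(t + \<delta>)\<close> for all \<open>\<delta>\<close>, and an
  \<open>L\<^sup>2\<close> function with this property vanishes.

  For the second part let \<open>A\<close> be the restriction of \<open>\<Gamma>\<close> to test functions of mean zero. If
  \<open>\<phi> = \<psi>'\<close> then \<open>\<integral> e\<^sup>-\<^sup>t\<^sup>x L\<phi>(x) d\<kappa>(x) = O(1 / (t + a))\<close> for some \<open>a > 0\<close>, so this function is square
  integrable and \<open>\<phi>\<close> is in the domain (\<open>test_function_image\<close>). The relation \<open>weak_image\<close> says exactly
  that \<open>(f, G)\<close> is in the graph of the adjoint of \<open>A\<close>, so \<open>A\<close> has the symmetric adjoint \<open>\<Gamma>\<close>; and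
  an operator whose adjoint is symmetric is essentially self-adjoint (\<open>closure_op_eq_adjoint_op\<close>).
  The last step uses orthogonal projections in the space of pairs of \<open>L\<^sup>2\<close> functions, and therefore the
  completeness of \<open>L\<^sup>2\<close>.
\<close>

section \<open>Smooth functions\<close>

text \<open>
  The recursive notion of being differentiable \<open>n\<close> times, for all \<open>n\<close>, is easier to propagate through
  products and affine substitutions than a sequence of derivatives: one induction per operation
  replaces a Leibniz formula.
\<close>

primrec times_differentiable :: "nat \<Rightarrow> (real \<Rightarrow> complex) \<Rightarrow> bool" where
  "times_differentiable 0 f \<longleftrightarrow> True"
| "times_differentiable (Suc n) f \<longleftrightarrow>
     (\<exists>g. (\<forall>t. (f has_vector_derivative g t) (at t)) \<and> times_differentiable n g)"

lemma smooth_iff_times_differentiable: "smooth \<phi> \<longleftrightarrow> (\<forall>n. times_differentiable n \<phi>)"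
proof
  assume "smooth \<phi>"
  then obtain D where D0: "D 0 = \<phi>"
    and D: "\<And>n t. (D n has_vector_derivative D (Suc n) t) (at t)"
    unfolding smooth_def by blast
  have "times_differentiable n (D k)" for n k
    by (induction n arbitrary: k) (use D in auto)
  then show "\<forall>n. times_differentiable n \<phi>"
    using D0 by metis
next
  assume *: "\<forall>n. times_differentiable n \<phi>"
  define D where "D n = ((\<lambda>f t. vector_derivative f (at t)) ^^ n) \<phi>" for n
  have step: "(f has_vector_derivative vector_derivative f (at t)) (at t) \<and>
      (\<forall>n. times_differentiable n (\<lambda>t. vector_derivative f (at t)))"
    if f: "\<forall>n. times_differentiable n f" for f :: "real \<Rightarrow> complex" and t
  proof
    obtain g where "\<forall>t. (f has_vector_derivative g t) (at t)"
      using f[rule_format, of 1] by auto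
    then show "(f has_vector_derivative vector_derivative f (at t)) (at t)"
      by (metis vector_derivative_at)
    show "\<forall>n. times_differentiable n (\<lambda>t. vector_derivative f (at t))"
    proof
      fix n
      obtain g where g: "\<And>t. (f has_vector_derivative g t) (at t)" "times_differentiable n g"
        using f[rule_format, of "Suc n"] by auto
      have "(\<lambda>t. vector_derivative f (at t)) = g"
        using g(1) by (auto simp: fun_eq_iff intro!: vector_derivative_at)
      with g(2) show "times_differentiable n (\<lambda>t. vector_derivative f (at t))" by simp
    qed
  qed
  have all: "\<forall>m. times_differentiable m (D n)" for n
    by (induction n) (use * step in \<open>auto simp: D_def\<close>)
  have "(D n has_vector_derivative D (Suc n) t) (at t)" for n t
    using step[OF all, of n t] by (simp add: D_def)
  then show "smooth \<phi>"
    unfolding smooth_def by (intro exI[of _ D]) (auto simp: D_def)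
qed

lemma times_differentiable_SucD: "times_differentiable (Suc n) f \<Longrightarrow> times_differentiable n f"
  by (induction n arbitrary: f) auto

lemma times_differentiable_add:
  "times_differentiable n f \<Longrightarrow> times_differentiable n g \<Longrightarrow> times_differentiable n (\<lambda>t. f t + g t)"
proof (induction n arbitrary: f g)
  case (Suc n)
  then obtain f' g' where "\<And>t. (f has_vector_derivative f' t) (at t)" "times_differentiable n f'"
    "\<And>t. (g has_vector_derivative g' t) (at t)" "times_differentiable n g'" by auto
  with Suc.IH show ?case
    by (auto intro!: exI[of _ "\<lambda>t. f' t + g' t"] derivative_intros)
qed simp

lemma times_differentiable_mult:
  "times_differentiable n f \<Longrightarrow> times_differentiable n g \<Longrightarrow> times_differentiable n (\<lambda>t. f t * g t)"
proof (induction n arbitrary: f g)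
  case (Suc n)
  then obtain f' g' where "\<And>t. (f has_vector_derivative f' t) (at t)" "times_differentiable n f'"
    "\<And>t. (g has_vector_derivative g' t) (at t)" "times_differentiable n g'" by auto
  moreover have "times_differentiable n f" "times_differentiable n g"
    using Suc.prems times_differentiable_SucD by blast+
  ultimately show ?case
    using Suc.IH times_differentiable_add
    by (auto intro!: exI[of _ "\<lambda>t. f t * g' t + f' t * g t"] has_vector_derivative_mult)
qed simp

lemma times_differentiable_const: "times_differentiable n (\<lambda>t. c)"
proof -
  have "times_differentiable n (\<lambda>t. 0)" for n
    by (induction n) (auto intro!: exI[of _ "\<lambda>t. 0"] derivative_eq_intros)
  then show ?thesis
    by (cases n) (auto intro!: exI[of _ "\<lambda>t. 0"] derivative_eq_intros)
qed

lemma times_differentiable_affine: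
  "times_differentiable n f \<Longrightarrow> times_differentiable n (\<lambda>t. f (c * t + d))"
proof (induction n arbitrary: f)
  case (Suc n)
  then obtain f' where f': "\<And>t. (f has_vector_derivative f' t) (at t)" "times_differentiable n f'"
    by auto
  have "((\<lambda>t. f (c * t + d)) has_vector_derivative of_real c * f' (c * t + d)) (at t)" for t
  proof -
    have "((\<lambda>t. c * t + d) has_vector_derivative c) (at t)"
      by (auto intro!: derivative_eq_intros)
    from vector_diff_chain_at[OF this f'(1)] show ?thesis
      by (simp add: o_def scaleR_conv_of_real)
  qed
  moreover have "times_differentiable n (\<lambda>t. of_real c * f' (c * t + d))"
    using Suc.IH f'(2) by (intro times_differentiable_mult times_differentiable_const) auto
  ultimately show ?case
    unfolding times_differentiable.simps by (intro exI[of _ "\<lambda>t. of_real c * f' (c * t + d)"]) simp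
qed simp

lemma times_differentiable_cnj: "times_differentiable n f \<Longrightarrow> times_differentiable n (\<lambda>t. cnj (f t))"
proof (induction n arbitrary: f)
  case (Suc n)
  then obtain f' where "\<And>t. (f has_vector_derivative f' t) (at t)" "times_differentiable n f'" by auto
  with Suc.IH show ?case
    by (auto intro!: exI[of _ "\<lambda>t. cnj (f' t)"] has_vector_derivative_cnj)
qed simp

lemma smooth_mult: "smooth f \<Longrightarrow> smooth g \<Longrightarrow> smooth (\<lambda>t. f t * g t)"
  and smooth_add: "smooth f \<Longrightarrow> smooth g \<Longrightarrow> smooth (\<lambda>t. f t + g t)"
  and smooth_const: "smooth (\<lambda>t. k)"
  and smooth_cnj: "smooth f \<Longrightarrow> smooth (\<lambda>t. cnj (f t))"
  and smooth_affine: "smooth f \<Longrightarrow> smooth (\<lambda>t. f (c * t + d))"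
  by (simp_all add: smooth_iff_times_differentiable times_differentiable_mult times_differentiable_add
      times_differentiable_const times_differentiable_cnj times_differentiable_affine)

lemma smooth_antiderivative:
  assumes "\<And>t. (\<Phi> has_vector_derivative \<phi> t) (at t)" "smooth \<phi>"
  shows "smooth \<Phi>"
  unfolding smooth_iff_times_differentiable
proof
  fix n show "times_differentiable n \<Phi>"
    using assms by (cases n) (auto simp: smooth_iff_times_differentiable)
qed

lemma smooth_derivative:
  assumes "smooth \<phi>"
  shows "(\<phi> has_vector_derivative vector_derivative \<phi> (at t)) (at t)"
    and "smooth (\<lambda>t. vector_derivative \<phi> (at t))"
proof -
  obtain D where D: "D 0 = \<phi>" "\<And>n t. (D n has_vector_derivative D (Suc n) t) (at t)"
    using assms unfolding smooth_def by blast
  have eq: "vector_derivative \<phi> (at t) = D 1 t" for t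
    using D(2)[of 0 t] D(1) by (auto intro: vector_derivative_at)
  show "(\<phi> has_vector_derivative vector_derivative \<phi> (at t)) (at t)"
    using D(2)[of 0 t] D(1) eq by simp
  show "smooth (\<lambda>t. vector_derivative \<phi> (at t))"
    unfolding smooth_def eq using D(2) by (intro exI[of _ "\<lambda>n. D (Suc n)"]) auto
qed

lemma smooth_continuous: "smooth \<phi> \<Longrightarrow> continuous_on S \<phi>"
  by (meson smooth_derivative(1) continuous_at_imp_continuous_on has_vector_derivative_continuous)

text \<open>
  The functions $t^{-k} e^{-1/t}$, extended by zero to $t \le 0$, form a family whose span is
  closed under differentiation; hence $e^{-1/t}$ is smooth across the origin.
\<close>

definition flat :: "nat \<Rightarrow> real \<Rightarrow> complex" where
  "flat k t = (if t \<le> 0 then 0 else of_real (exp (- inverse t) * inverse t ^ k))"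

lemma power_times_exp_tendsto_0: "((\<lambda>t. inverse t ^ k * exp (- inverse t)) \<longlongrightarrow> 0) (at_right (0::real))"
proof -
  have "((\<lambda>x. x ^ k / exp x) \<longlongrightarrow> (0::real)) at_top"
    by (rule tendsto_power_div_exp_0)
  from filterlim_compose[OF this filterlim_inverse_at_top_right]
  show ?thesis by (simp add: exp_minus field_simps)
qed

lemma flat_has_vector_derivative:
  "(flat k has_vector_derivative flat (k + 2) t - of_nat k * flat (k + 1) t) (at t)"
proof (cases "t = 0")
  case True
  have L: "((\<lambda>h. norm (flat k h) / \<bar>h\<bar>) \<longlongrightarrow> 0) (at_left 0)"
    by (rule tendsto_eventually) (auto simp: flat_def eventually_at_filter)
  have R: "((\<lambda>h. norm (flat k h) / \<bar>h\<bar>) \<longlongrightarrow> 0) (at_right 0)"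
  proof (rule Lim_transform_eventually[OF power_times_exp_tendsto_0[of "Suc k"]])
    show "\<forall>\<^sub>F h in at_right 0. inverse h ^ Suc k * exp (- inverse h) = norm (flat k h) / \<bar>h\<bar>"
      by (rule eventually_at_right_less[THEN eventually_mono])
         (simp add: flat_def norm_mult norm_divide norm_power field_simps)
  qed
  have "((\<lambda>h. norm (flat k h) / \<bar>h\<bar>) \<longlongrightarrow> 0) (at 0)"
    using L R by (simp add: filterlim_split_at)
  then have "(flat k has_vector_derivative 0) (at 0)"
    by (simp add: has_vector_derivative_def has_derivative_at flat_def bounded_linear_zero)
  with True show ?thesis by (simp add: flat_def)
next
  case False
  show ?thesis
  proof (cases "t < 0")
    case True
    have "(flat k has_vector_derivative 0) (at t)"
      by (rule has_vector_derivative_transform_within_open[of "\<lambda>_. 0" _ _ "{..<0}"])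
         (use True in \<open>auto simp: flat_def\<close>)
    with True show ?thesis by (simp add: flat_def)
  next
    case f: False
    with False have t: "t > 0" by simp
    let ?r = "\<lambda>t::real. exp (- inverse t) * inverse t ^ k"
    have "(?r has_real_derivative
        exp (- inverse t) * inverse t ^ (k + 2) - of_nat k * (exp (- inverse t) * inverse t ^ (k + 1))) (at t)"
    proof -
      have k: "of_nat k * (inverse t ^ (k - 1) * inverse t ^ 2) = of_nat k * inverse t ^ (k + 1)"
        by (cases k) (auto simp: power2_eq_square)
      have "(?r has_real_derivative exp (- inverse t) * inverse t ^ 2 * inverse t ^ k
          - exp (- inverse t) * (of_nat k * (inverse t ^ (k - 1) * inverse t ^ 2))) (at t)"
        using t by (auto intro!: derivative_eq_intros simp: power2_eq_square)
      then show ?thesis unfolding k by (simp add: power_add power2_eq_square mult_ac)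
    qed
    then have "((\<lambda>t. of_real (?r t) :: complex) has_vector_derivative of_real
        (exp (- inverse t) * inverse t ^ (k + 2) - of_nat k * (exp (- inverse t) * inverse t ^ (k + 1)))) (at t)"
      by (intro has_vector_derivative_of_real) (simp add: has_real_derivative_iff_has_vector_derivative)
    then have "(flat k has_vector_derivative of_real
        (exp (- inverse t) * inverse t ^ (k + 2) - of_nat k * (exp (- inverse t) * inverse t ^ (k + 1)))) (at t)"
      by (rule has_vector_derivative_transform_within_open[of _ _ _ "{0<..}"])
         (use t in \<open>auto simp: flat_def\<close>)
    with t show ?thesis by (simp add: flat_def)
  qed
qed

lemma smooth_flat: "smooth (flat k)"
proof -
  have "times_differentiable n (flat k)" for n
  proof (induction n arbitrary: k)
    case (Suc n)
    have "times_differentiable n (\<lambda>t. flat (k + 2) t + (- of_nat k) * flat (k + 1) t)"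
      by (intro times_differentiable_add times_differentiable_mult times_differentiable_const Suc)
    then show ?case
      using flat_has_vector_derivative by (auto intro!: exI[of _ "\<lambda>t. flat (k + 2) t + (- of_nat k) * flat (k + 1) t"])
  qed simp
  then show ?thesis by (simp add: smooth_iff_times_differentiable)
qed

section \<open>Test functions\<close>

lemma C_comp_iff:
  "\<phi> \<in> C_comp \<longleftrightarrow> smooth \<phi> \<and> (\<exists>a b. 0 < a \<and> a < b \<and> (\<forall>t. t < a \<or> b < t \<longrightarrow> \<phi> t = 0))"
    (is "_ \<longleftrightarrow> _ \<and> ?B")
proof (intro iffI conjI)
  assume c: "\<phi> \<in> C_comp"
  then show "smooth \<phi>" by (simp add: C_comp_def)
  let ?K = "closure (support_on UNIV \<phi>)"
  have K: "compact ?K" "?K \<subseteq> {0<..}" using c by (auto simp: C_comp_def)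
  have z: "\<phi> t = 0" if "t \<notin> ?K" for t
    using that closure_subset by (force simp: support_on_def)
  show ?B
  proof (cases "?K = {}")
    case True
    then show ?thesis using z by (intro exI[of _ 1] exI[of _ 2]) auto
  next
    case False
    obtain a where a: "a \<in> ?K" "\<And>t. t \<in> ?K \<Longrightarrow> a \<le> t"
      using compact_attains_inf[OF K(1) False] by blast
    obtain b where b: "b \<in> ?K" "\<And>t. t \<in> ?K \<Longrightarrow> t \<le> b"
      using compact_attains_sup[OF K(1) False] by blast
    show ?thesis
    proof (rule exI[of _ a], rule exI[of _ "b + 1"], intro conjI allI impI)
      show "0 < a" using a K by auto
      show "a < b + 1" using a(2)[OF b(1)] by simp
      fix t assume "t < a \<or> b + 1 < t"
      then have "t \<notin> ?K" using a(2) b(2) by force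
      then show "\<phi> t = 0" by (rule z)
    qed
  qed
next
  assume "smooth \<phi> \<and> ?B"
  then obtain a b where ab: "smooth \<phi>" "0 < a" "\<And>t. t < a \<or> b < t \<Longrightarrow> \<phi> t = 0" by blast
  have "support_on UNIV \<phi> \<subseteq> {a..b}"
    using ab(3) by (force simp: support_on_def not_less[symmetric])
  then have s: "closure (support_on UNIV \<phi>) \<subseteq> {a..b}"
    by (simp add: closure_minimal)
  moreover have "compact (closure (support_on UNIV \<phi>))"
    using s by (meson bounded_closed_interval bounded_subset closed_closure compact_eq_bounded_closed)
  ultimately show "\<phi> \<in> C_comp"
    using ab(1,2) by (auto simp: C_comp_def)
qed

lemma C_compE:
  assumes "\<phi> \<in> C_comp"
  obtains a b where "0 < a" "a < b" "\<And>t. t < a \<Longrightarrow> \<phi> t = 0" "\<And>t. b < t \<Longrightarrow> \<phi> t = 0" "smooth \<phi>"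
  using assms unfolding C_comp_iff by blast

lemma C_compI:
  assumes "smooth \<phi>" "0 < a" "a < b" "\<And>t. t < a \<or> b < t \<Longrightarrow> \<phi> t = 0"
  shows "\<phi> \<in> C_comp"
  unfolding C_comp_iff using assms by blast

lemma C_comp_scale: "f \<in> C_comp \<Longrightarrow> (\<lambda>t. c * f t) \<in> C_comp"
  unfolding C_comp_iff using smooth_mult[OF smooth_const] by (metis mult_zero_right)

lemma C_comp_cnj: "f \<in> C_comp \<Longrightarrow> (\<lambda>t. cnj (f t)) \<in> C_comp"
  unfolding C_comp_iff using smooth_cnj by (metis complex_cnj_zero)

lemma C_comp_add:
  assumes "f \<in> C_comp" "g \<in> C_comp"
  shows "(\<lambda>t. f t + g t) \<in> C_comp"
proof -
  obtain a b where f: "0 < a" "a < b" "\<And>t. t < a \<or> b < t \<Longrightarrow> f t = 0" "smooth f"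
    using assms unfolding C_comp_iff by blast
  obtain c d where g: "0 < c" "c < d" "\<And>t. t < c \<or> d < t \<Longrightarrow> g t = 0" "smooth g"
    using assms unfolding C_comp_iff by blast
  show ?thesis
    unfolding C_comp_iff
  proof (rule conjI[OF smooth_add[OF f(4) g(4)]], rule exI[of _ "min a c"], rule exI[of _ "max b d"],
      intro conjI allI impI)
    show "f t + g t = 0" if "t < min a c \<or> max b d < t" for t
      using that f(3)[of t] g(3)[of t] by auto
  qed (use f g in auto)
qed

lemma C_comp_derivative:
  assumes "\<psi> \<in> C_comp"
  shows "(\<lambda>t. vector_derivative \<psi> (at t)) \<in> C_comp"
    and "(\<psi> has_vector_derivative vector_derivative \<psi> (at t)) (at t)"
proof -
  obtain a b where ab: "0 < a" "a < b" "\<And>t. t < a \<Longrightarrow> \<psi> t = 0" "\<And>t. b < t \<Longrightarrow> \<psi> t = 0" "smooth \<psi>"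
    using assms by (rule C_compE) blast
  show "(\<psi> has_vector_derivative vector_derivative \<psi> (at t)) (at t)"
    by (rule smooth_derivative(1)[OF ab(5)])
  have "vector_derivative \<psi> (at t) = 0" if "t < a \<or> b < t" for t
  proof (rule vector_derivative_at)
    show "(\<psi> has_vector_derivative 0) (at t)"
      using that
    proof
      assume "t < a"
      then show ?thesis
        using has_vector_derivative_transform_within_open[of "\<lambda>_. 0" 0 t "{..<a}" \<psi>] ab(3) by simp
    next
      assume "b < t"
      then show ?thesis
        using has_vector_derivative_transform_within_open[of "\<lambda>_. 0" 0 t "{b<..}" \<psi>] ab(4) by simp
    qed
  qed
  then show "(\<lambda>t. vector_derivative \<psi> (at t)) \<in> C_comp"
    unfolding C_comp_iff using smooth_derivative(2)[OF ab(5)] ab(1,2) by blast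
qed

lemma space_halfline [simp]: "space halfline = {0<..}"
  by (simp add: space_restrict_space)

lemma halfline_integral_eq_lborel:
  fixes f :: "real \<Rightarrow> 'a :: {banach, second_countable_topology}"
  assumes "\<And>t. t \<le> 0 \<Longrightarrow> f t = 0"
  shows "(LINT t|halfline. f t) = (LINT t|lborel. f t)"
  using assms by (subst integral_restrict_space)
    (auto intro!: Bochner_Integration.integral_cong split: split_indicator simp: not_less)

lemma AE_halfline_iff: "(AE t in halfline. P t) \<longleftrightarrow> (AE t in lborel. t > 0 \<longrightarrow> P t)"
  by (subst AE_restrict_space_iff) auto

lemma continuous_compact_support_integrable:
  fixes \<phi> :: "real \<Rightarrow> complex"
  assumes "continuous_on UNIV \<phi>" "\<And>t. t < a \<or> b < t \<Longrightarrow> \<phi> t = 0"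
  shows "integrable lborel \<phi>"
proof -
  have "integrable lborel (\<lambda>t. indicator {a..b} t *\<^sub>R \<phi> t)"
    using assms(1) by (intro borel_integrable_compact) (auto intro: continuous_on_subset)
  also have "(\<lambda>t. indicator {a..b} t *\<^sub>R \<phi> t) = \<phi>"
    using assms(2) by (auto simp: fun_eq_iff indicator_def not_le)
  finally show ?thesis .
qed

lemma vector_derivative_zero_outside:
  assumes "\<And>t. (k has_vector_derivative k' t) (at t)" "\<And>t. t < a \<or> b < t \<Longrightarrow> k t = (0::complex)"
    and "t < a \<or> b < t"
  shows "k' t = 0"
proof -
  have "(k has_vector_derivative 0) (at t)"
    using assms(3)
      has_vector_derivative_transform_within_open[of "\<lambda>_. 0" 0 t "{..<a}" k]
      has_vector_derivative_transform_within_open[of "\<lambda>_. 0" 0 t "{b<..}" k] assms(2) by auto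
  with assms(1) show ?thesis by (metis vector_derivative_at)
qed

lemma integral_derivative_compact_support:
  assumes k: "\<And>t. (k has_vector_derivative k' t) (at t)" "continuous_on UNIV k'"
    and ab: "0 < a" "a < b" "\<And>t. t < a \<or> b < t \<Longrightarrow> k t = (0::complex)"
  shows "(LINT t|halfline. k' t) = 0"
proof -
  have z: "k' t = 0" if "t < a \<or> b < t" for t
    by (rule vector_derivative_zero_outside[OF k(1) ab(3) that])
  have "(LINT t|halfline. k' t) = (LINT t|lborel. k' t)"
    using z ab by (intro halfline_integral_eq_lborel) auto
  also have "\<dots> = (LINT t|lborel. indicator {0..b+1} t *\<^sub>R k' t)"
    using z ab by (intro Bochner_Integration.integral_cong) (auto simp: indicator_def not_le)
  also have "\<dots> = k (b + 1) - k 0"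
    using k ab by (intro integral_FTC_Icc) (auto intro: has_vector_derivative_at_within continuous_on_subset)
  also have "\<dots> = 0" using ab by simp
  finally show ?thesis .
qed

text \<open>
  The antiderivative that starts at zero is constant to the right of the support, with the mean value
  of \<open>\<phi>\<close> there. Hence it is itself a test function when the mean is zero, and the difference of
  two translates of it is one in any case.
\<close>

lemma antiderivative_of_test_function:
  assumes \<phi>: "smooth \<phi>" and ab: "0 < a" "a < b" "\<And>t. t < a \<or> b < t \<Longrightarrow> \<phi> t = 0"
  obtains \<Phi> where "smooth \<Phi>" "\<And>t. (\<Phi> has_vector_derivative \<phi> t) (at t)"
    "\<And>t. t < a \<Longrightarrow> \<Phi> t = 0" "\<And>t. b < t \<Longrightarrow> \<Phi> t = (LINT s|halfline. \<phi> s)"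
proof
  let ?\<Phi> = "\<lambda>t. integral {0..t} \<phi>"
  have cont: "continuous_on S \<phi>" for S using smooth_continuous[OF \<phi>] .
  show z: "?\<Phi> t = 0" if "t < a" for t
  proof -
    have "?\<Phi> t = integral {0..t} (\<lambda>_. 0)"
      using that ab(3) by (intro Henstock_Kurzweil_Integration.integral_cong) auto
    then show ?thesis by simp
  qed
  show d: "(?\<Phi> has_vector_derivative \<phi> t) (at t)" for t
  proof (cases "t < a")
    case True
    then show ?thesis
      using has_vector_derivative_transform_within_open[of "\<lambda>_. 0" 0 t "{..<a}" ?\<Phi>] z ab by simp
  next
    case False
    then have t: "t \<in> {0<..<t+1}" using ab by auto
    have "(?\<Phi> has_vector_derivative \<phi> t) (at t within {0..t+1})"
      using t by (intro integral_has_vector_derivative cont) auto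
    then have "(?\<Phi> has_vector_derivative \<phi> t) (at t within {0<..<t+1})"
      by (rule has_vector_derivative_within_subset) auto
    then show ?thesis
      by (subst (asm) has_vector_derivative_within_open) (use t in auto)
  qed
  show "smooth ?\<Phi>" by (rule smooth_antiderivative[OF d \<phi>])
  show "?\<Phi> t = (LINT s|halfline. \<phi> s)" if "b < t" for t
  proof -
    have "(LINT s|halfline. \<phi> s) = (LINT s|lborel. \<phi> s)"
      using ab by (intro halfline_integral_eq_lborel) auto
    also have "\<dots> = (LINT s|lborel. indicator {0..t} s *\<^sub>R \<phi> s)"
      using ab that by (intro Bochner_Integration.integral_cong) (auto simp: indicator_def not_le)
    also have "\<dots> = ?\<Phi> t - ?\<Phi> 0"
      using ab that d cont by (intro integral_FTC_Icc) (auto intro: has_vector_derivative_at_within)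
    finally show ?thesis by simp
  qed
qed

lemma C_comp0_iff_derivative:
  "\<phi> \<in> C_comp0 \<longleftrightarrow> (\<exists>\<psi>\<in>C_comp. \<forall>t. (\<psi> has_vector_derivative \<phi> t) (at t))"
proof
  assume *: "\<phi> \<in> C_comp0"
  then have "\<phi> \<in> C_comp" and mean: "(LINT s|halfline. \<phi> s) = 0" by (auto simp: C_comp0_def)
  then obtain a b where ab: "0 < a" "a < b" "\<And>t. t < a \<or> b < t \<Longrightarrow> \<phi> t = 0" and s: "smooth \<phi>"
    unfolding C_comp_iff by blast
  obtain \<Phi> where \<Phi>: "smooth \<Phi>" "\<And>t. (\<Phi> has_vector_derivative \<phi> t) (at t)"
    "\<And>t. t < a \<Longrightarrow> \<Phi> t = 0" "\<And>t. b < t \<Longrightarrow> \<Phi> t = (LINT s|halfline. \<phi> s)"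
    using antiderivative_of_test_function[OF s ab] by metis
  have "\<Phi> \<in> C_comp"
    unfolding C_comp_iff using \<Phi> ab mean by metis
  with \<Phi>(2) show "\<exists>\<psi>\<in>C_comp. \<forall>t. (\<psi> has_vector_derivative \<phi> t) (at t)" by blast
next
  assume "\<exists>\<psi>\<in>C_comp. \<forall>t. (\<psi> has_vector_derivative \<phi> t) (at t)"
  then obtain \<psi> where \<psi>: "\<psi> \<in> C_comp" "\<And>t. (\<psi> has_vector_derivative \<phi> t) (at t)" by blast
  have eq: "\<phi> = (\<lambda>t. vector_derivative \<psi> (at t))"
    using vector_derivative_at[OF \<psi>(2)] by simp
  have C: "\<phi> \<in> C_comp" unfolding eq by (rule C_comp_derivative(1)[OF \<psi>(1)])
  then have "continuous_on UNIV \<phi>" by (auto simp: C_comp_iff intro: smooth_continuous)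
  moreover obtain a b where "0 < a" "a < b" "\<And>t. t < a \<or> b < t \<Longrightarrow> \<psi> t = 0"
    using \<psi>(1) unfolding C_comp_iff by blast
  ultimately have "(LINT t|halfline. \<phi> t) = 0"
    using \<psi>(2) integral_derivative_compact_support by blast
  with C show "\<phi> \<in> C_comp0" by (simp add: C_comp0_def)
qed

text \<open>
  Since \<open>e\<^sup>-\<^sup>1\<^sup>/\<^sup>t\<close>, extended by zero, tends to \<open>1\<close> at infinity, the product of \<open>e\<^sup>-\<^sup>1\<^sup>/\<^sup>t\<close> taken at \<open>n (t - a)\<close> and at
  \<open>n (b - t)\<close> is smooth, supported in \<open>[a, b]\<close> for every \<open>n\<close>, and tends to \<open>1\<close> inside.
\<close>

lemma bump_approximates_indicator:
  assumes "0 < a" "a < (b::real)"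
  obtains \<phi> :: "nat \<Rightarrow> real \<Rightarrow> complex" where "\<And>n. \<phi> n \<in> C_comp" "\<And>n t. norm (\<phi> n t) \<le> 1"
    "\<And>n t. t \<le> a \<or> b \<le> t \<Longrightarrow> \<phi> n t = 0" "\<And>t. (\<lambda>n. \<phi> n t) \<longlonglongrightarrow> indicator {a<..<b} t"
proof
  let ?\<phi> = "\<lambda>n t. flat 0 (real (Suc n) * t + - real (Suc n) * a) * flat 0 (- real (Suc n) * t + real (Suc n) * b)"
  show z: "?\<phi> n t = 0" if "t \<le> a \<or> b \<le> t" for n t
    using that by (auto simp: flat_def mult_left_mono simp del: of_nat_Suc)
  have "smooth (?\<phi> n)" for n
    by (intro smooth_mult smooth_affine smooth_flat)
  then show "?\<phi> n \<in> C_comp" for n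
    unfolding C_comp_iff using assms z by (intro conjI exI[of _ a] exI[of _ b]) auto
  have b: "norm (flat 0 t) \<le> 1" for t
    by (simp add: flat_def)
  show "norm (?\<phi> n t) \<le> 1" for n t
    unfolding norm_mult by (intro mult_le_one b) auto
  have lim: "(\<lambda>n. flat 0 (real (Suc n) * c)) \<longlonglongrightarrow> 1" if "c > 0" for c
  proof -
    have "(\<lambda>n. of_real (exp (- (inverse (real (Suc n)) * inverse c)))) \<longlonglongrightarrow> (of_real (exp (- (0 * inverse c))) :: complex)"
      by (intro tendsto_intros LIMSEQ_inverse_real_of_nat)
    moreover have "flat 0 (real (Suc n) * c) = of_real (exp (- (inverse (real (Suc n)) * inverse c)))" for n
      using that by (simp add: flat_def not_le[symmetric] mult_le_0_iff del: of_nat_Suc)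
    ultimately show ?thesis by simp
  qed
  show "(\<lambda>n. ?\<phi> n t) \<longlonglongrightarrow> indicator {a<..<b} t" for t
  proof (cases "a < t \<and> t < b")
    case True
    have "(\<lambda>n. flat 0 (real (Suc n) * (t - a)) * flat 0 (real (Suc n) * (b - t))) \<longlonglongrightarrow> 1 * 1"
      using True by (intro tendsto_mult lim) auto
    moreover have "?\<phi> n t = flat 0 (real (Suc n) * (t - a)) * flat 0 (real (Suc n) * (b - t))" for n
      by (simp add: algebra_simps)
    ultimately show ?thesis using True by simp
  next
    case False
    then have "t \<le> a \<or> b \<le> t" by auto
    with False show ?thesis by (simp only: z) simp
  qed
qed

text \<open>
  The rays \<open>{..x}\<close> are an intersection-stable generator of the Borel sets, so the integral
  vanishes over every Borel set.
\<close>

lemma AE_zero_if_integrals_zero: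
  fixes v :: "real \<Rightarrow> complex"
  assumes v: "integrable lborel v" and 0: "\<And>x. set_lebesgue_integral lborel {..x} v = 0"
  shows "AE t in lborel. v t = 0"
proof (rule sigma_finite_measure.density_zero[OF lborel.sigma_finite_measure_axioms v])
  have si: "set_integrable lborel A v" if "A \<in> sets borel" for A
    unfolding set_integrable_def using v that by (intro integrable_mult_indicator) auto
  have total: "set_lebesgue_integral lborel UNIV v = 0"
  proof -
    have "(\<lambda>n. LINT t|lborel. indicator {..real n} t *\<^sub>R v t) \<longlonglongrightarrow> (LINT t|lborel. v t)"
    proof (rule integral_dominated_convergence[where w="\<lambda>t. norm (v t)"])
      show "AE t in lborel. (\<lambda>n. indicator {..real n} t *\<^sub>R v t) \<longlonglongrightarrow> v t"
      proof (rule AE_I2, rule tendsto_eventually)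
        fix t
        show "\<forall>\<^sub>F n in sequentially. indicator {..real n} t *\<^sub>R v t = v t"
          using eventually_ge_at_top[of "nat \<lceil>t\<rceil>"] by eventually_elim (simp add: indicator_def; linarith)
      qed
    qed (use v in \<open>auto simp: indicator_def\<close>)
    then have "(\<lambda>n. 0) \<longlonglongrightarrow> (LINT t|lborel. v t)"
      using 0 by (simp add: set_lebesgue_integral_def)
    then have "(LINT t|lborel. v t) = 0" by (simp add: LIMSEQ_const_iff)
    then show ?thesis by (simp add: set_lebesgue_integral_def)
  qed
  fix A :: "real set" assume "A \<in> sets lborel"
  then have A: "A \<in> sigma_sets UNIV (range (\<lambda>a. {..a::real}))"
    by (metis borel_eq_atMost sets_lborel sets_measure_of top_greatest Pow_UNIV)
  have "Int_stable (range (\<lambda>a. {..a::real}))"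
    by (auto simp: Int_stable_def)
  moreover have "range (\<lambda>a. {..a::real}) \<subseteq> Pow UNIV" by simp
  ultimately show "set_lebesgue_integral lborel A v = 0"
    using A
  proof (induction A rule: sigma_sets_induct_disjoint)
    case (compl A)
    then have A: "A \<in> sets borel"
      by (metis borel_eq_atMost sets_measure_of top_greatest Pow_UNIV)
    have "set_lebesgue_integral lborel (A \<union> (UNIV - A)) v
      = set_lebesgue_integral lborel A v + set_lebesgue_integral lborel (UNIV - A) v"
      using A by (intro set_integral_Un si) auto
    with compl total show ?case by simp
  next
    case (union A)
    have "A i \<in> sets borel" for i
      using union(2) by (metis borel_eq_atMost sets_measure_of top_greatest Pow_UNIV range_subsetD)
    then have "set_lebesgue_integral lborel (\<Union>i. A i) v = (\<Sum>i. set_lebesgue_integral lborel (A i) v)"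
      using union(1) by (intro lebesgue_integral_countable_add si) (auto simp: disjoint_family_on_def)
    with union show ?case by simp
  qed (use 0 in \<open>auto simp: set_lebesgue_integral_def\<close>)
qed

text \<open>
  The fundamental lemma of the calculus of variations. Bump functions converge boundedly to
  the indicator of \<open>(a, b)\<close>, so the integral of \<open>u\<close> over it vanishes whenever \<open>a > 0\<close>.
\<close>

lemma fundamental_lemma:
  assumes u: "locally_integrable u" and 0: "\<And>\<phi>. \<phi> \<in> C_comp \<Longrightarrow> (LINT t|halfline. u t * \<phi> t) = 0"
  shows "AE t in halfline. u t = 0"
proof -
  have interval: "(LINT t|lborel. indicator {a<..<b} t *\<^sub>R u t) = 0" if ab: "0 < a" "a < b" for a b
  proof -
    obtain \<phi> where \<phi>: "\<And>n. \<phi> n \<in> C_comp" "\<And>n t. norm (\<phi> n t) \<le> 1"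
      "\<And>n t. t \<le> a \<or> b \<le> t \<Longrightarrow> \<phi> n t = 0" "\<And>t. (\<lambda>n. \<phi> n t) \<longlonglongrightarrow> indicator {a<..<b} t"
      using bump_approximates_indicator[OF ab] by blast
    define v where "v t = indicator {a..b} t *\<^sub>R u t" for t
    have v: "integrable lborel v"
      using u ab by (simp add: locally_integrable_def set_integrable_def v_def[abs_def])
    note [measurable] = borel_measurable_integrable[OF v, unfolded measurable_lborel1]
    have [measurable]: "\<phi> n \<in> borel_measurable borel" for n
      using \<phi>(1)[of n] by (intro borel_measurable_continuous_onI smooth_continuous) (auto simp: C_comp_iff)
    have "(\<lambda>n. LINT t|lborel. v t * \<phi> n t) \<longlonglongrightarrow> (LINT t|lborel. v t * indicator {a<..<b} t)"
    proof (rule integral_dominated_convergence[where w="\<lambda>t. norm (v t)"])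
      show "AE t in lborel. (\<lambda>n. v t * \<phi> n t) \<longlonglongrightarrow> v t * indicator {a<..<b} t"
        using \<phi>(4) by (intro AE_I2 tendsto_mult) auto
      show "AE t in lborel. norm (v t * \<phi> n t) \<le> norm (v t)" for n
        using \<phi>(2) by (intro AE_I2) (auto simp: norm_mult mult_left_le)
    qed (use v in auto)
    moreover have "(LINT t|lborel. v t * \<phi> n t) = 0" for n
    proof -
      have "(LINT t|lborel. v t * \<phi> n t) = (LINT t|lborel. u t * \<phi> n t)"
        using \<phi>(3) by (intro Bochner_Integration.integral_cong) (auto simp: v_def indicator_def)
      also have "\<dots> = (LINT t|halfline. u t * \<phi> n t)"
        using \<phi>(3) ab by (intro halfline_integral_eq_lborel[symmetric]) auto
      finally show ?thesis using 0 \<phi>(1) by simp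
    qed
    ultimately have "(LINT t|lborel. v t * indicator {a<..<b} t) = 0"
      by (simp add: LIMSEQ_const_iff)
    moreover have "v t * indicator {a<..<b} t = indicator {a<..<b} t *\<^sub>R u t" for t
      by (auto simp: v_def indicator_def)
    ultimately show ?thesis by simp
  qed
  have "AE t in lborel. indicator {inverse (Suc n)..real n + 2} t *\<^sub>R u t = 0" for n
  proof (rule AE_zero_if_integrals_zero)
    let ?a = "inverse (Suc n) :: real"
    have a: "?a > 0" by simp
    show "integrable lborel (\<lambda>t. indicator {?a..real n + 2} t *\<^sub>R u t)"
      using u a unfolding locally_integrable_def set_integrable_def by blast
    then have [measurable]: "(\<lambda>t. indicator {?a..real n + 2} t *\<^sub>R u t) \<in> borel_measurable borel"
      using borel_measurable_integrable by fastforce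
    fix x
    let ?b = "min x (real n + 2)"
    have "set_lebesgue_integral lborel {..x} (\<lambda>t. indicator {?a..real n + 2} t *\<^sub>R u t)
        = (LINT t|lborel. indicator {?a<..<?b} t *\<^sub>R (indicator {?a..real n + 2} t *\<^sub>R u t))"
      unfolding set_lebesgue_integral_def
    proof (rule integral_cong_AE)
      show "AE t in lborel. indicator {..x} t *\<^sub>R (indicator {?a..real n + 2} t *\<^sub>R u t)
        = indicator {?a<..<?b} t *\<^sub>R (indicator {?a..real n + 2} t *\<^sub>R u t)"
        using AE_lborel_singleton[of ?a] AE_lborel_singleton[of ?b]
        by eventually_elim (auto simp: indicator_def min_def split: if_splits)
    qed measurable
    also have "\<dots> = (LINT t|lborel. indicator {?a<..<?b} t *\<^sub>R u t)"
      by (intro Bochner_Integration.integral_cong) (auto simp: indicator_def)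
    also have "\<dots> = 0"
      using interval[of ?a ?b] a by (cases "?a < ?b") auto
    finally show "set_lebesgue_integral lborel {..x} (\<lambda>t. indicator {?a..real n + 2} t *\<^sub>R u t) = 0" .
  qed
  then have "AE t in lborel. \<forall>n. indicator {inverse (Suc n)..real n + 2} t *\<^sub>R u t = 0"
    by (subst AE_all_countable) blast
  then show ?thesis
    unfolding AE_halfline_iff
  proof eventually_elim
    fix t :: real
    assume *: "\<forall>n. indicator {inverse (Suc n)..real n + 2} t *\<^sub>R u t = 0"
    show "0 < t \<longrightarrow> u t = 0"
    proof
      assume "0 < t"
      then obtain n where n: "inverse (Suc n) < t" using reals_Archimedean by blast
      obtain m where m: "t < real m" using reals_Archimedean2 by blast
      have "inverse (Suc (max n m)) \<le> (inverse (Suc n) :: real)"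
        by (intro le_imp_inverse_le) auto
      also note n
      finally have "t \<in> {inverse (Suc (max n m))..real (max n m) + 2}"
        using m less_le_trans[OF m, of "real (max n m) + 2"] by (auto simp del: of_nat_Suc)
      with *[rule_format, of "max n m"] show "u t = 0" by (simp add: indicator_def del: max_def)
    qed
  qed
qed

section \<open>The Hilbert space structure\<close>

lemma L2_measurable: "f \<in> L2 \<Longrightarrow> f \<in> borel_measurable halfline"
  and L2_integrable_sq: "f \<in> L2 \<Longrightarrow> integrable halfline (\<lambda>t. (norm (f t))\<^sup>2)"
  by (simp_all add: L2_def)

lemma L2_norm_nonneg [simp]: "0 \<le> L2_norm f"
  by (simp add: L2_norm_def integral_nonneg_AE)

lemma L2_norm_sq: "(L2_norm f)\<^sup>2 = (LINT t|halfline. (norm (f t))\<^sup>2)"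
  by (simp add: L2_norm_def integral_nonneg_AE)

lemma L2_bounded:
  assumes [measurable]: "f \<in> borel_measurable halfline" and g: "integrable halfline g"
    and le: "\<And>t. 0 < t \<Longrightarrow> (norm (f t))\<^sup>2 \<le> g t"
  shows "f \<in> L2"
proof -
  have "integrable halfline (\<lambda>t. (norm (f t))\<^sup>2)"
  proof (rule Bochner_Integration.integrable_bound[OF g])
    show "AE t in halfline. norm ((norm (f t))\<^sup>2) \<le> norm (g t)"
      using le by (intro AE_I2) (auto intro: order_trans[OF _ abs_ge_self])
  qed measurable
  then show ?thesis by (simp add: L2_def)
qed

lemma norm_add_sq_le: "(norm (a + b :: complex))\<^sup>2 \<le> 2 * (norm a)\<^sup>2 + 2 * (norm b)\<^sup>2"
proof -
  have "(norm (a + b))\<^sup>2 \<le> (norm a + norm b)\<^sup>2"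
    by (intro power_mono norm_triangle_ineq) auto
  also have "\<dots> \<le> 2 * (norm a)\<^sup>2 + 2 * (norm b)\<^sup>2"
    using sum_squares_bound[of "norm a" "norm b"] by (simp add: power2_sum)
  finally show ?thesis .
qed

lemma norm_mult_le_sum_squares: "norm (a * b :: complex) \<le> (norm a)\<^sup>2 + (norm b)\<^sup>2"
  using sum_squares_bound[of "norm a" "norm b"] mult_nonneg_nonneg[OF norm_ge_zero norm_ge_zero, of a b]
  unfolding norm_mult by linarith

lemma L2_add: "f \<in> L2 \<Longrightarrow> g \<in> L2 \<Longrightarrow> (\<lambda>t. f t + g t) \<in> L2"
  by (rule L2_bounded[where g="\<lambda>t. 2 * (norm (f t))\<^sup>2 + 2 * (norm (g t))\<^sup>2"])
     (auto simp: L2_def norm_add_sq_le)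

lemma L2_scale: "f \<in> L2 \<Longrightarrow> (\<lambda>t. c * f t) \<in> L2"
  by (rule L2_bounded[where g="\<lambda>t. (norm c)\<^sup>2 * (norm (f t))\<^sup>2"])
     (auto simp: L2_def norm_mult power_mult_distrib)

lemma L2_uminus: "f \<in> L2 \<Longrightarrow> (\<lambda>t. - f t) \<in> L2"
  using L2_scale[of f "-1"] by simp

lemma L2_diff: "f \<in> L2 \<Longrightarrow> g \<in> L2 \<Longrightarrow> (\<lambda>t. f t - g t) \<in> L2"
  using L2_add[OF _ L2_uminus, of f g] by simp

lemma L2_zero: "(\<lambda>t. 0) \<in> L2"
  by (simp add: L2_def)

lemma indicator_L2: "(\<lambda>t. indicator {a..b} t :: complex) \<in> L2"
proof (rule L2_bounded)
  show "(\<lambda>t. indicator {a..b} t :: complex) \<in> borel_measurable halfline"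
    by (intro measurable_restrict_space1) simp
  have "integrable lborel (\<lambda>t. indicator {0<..} t *\<^sub>R (indicator {a..b} t *\<^sub>R (1::real)))"
    by (intro integrable_mult_indicator borel_integrable_compact) auto
  then show "integrable halfline (\<lambda>t. indicator {a..b} t *\<^sub>R (1::real))"
    by (subst integrable_restrict_space) auto
qed (auto simp: indicator_def)

lemma L2_cnj: "f \<in> L2 \<Longrightarrow> (\<lambda>t. cnj (f t)) \<in> L2"
  by (rule L2_bounded[where g="\<lambda>t. (norm (f t))\<^sup>2"])
     (auto simp: L2_def intro: measurable_compose[OF _ borel_measurable_continuous_onI] continuous_intros)

lemma L2_norm_cnj: "L2_norm (\<lambda>t. cnj (f t)) = L2_norm f"
  by (simp add: L2_norm_def)

lemma L2_norm_uminus: "L2_norm (\<lambda>t. - f t) = L2_norm f"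
  by (simp add: L2_norm_def)

lemma L2_norm_scale: "L2_norm (\<lambda>t. c * f t) = norm c * L2_norm f"
  by (simp add: L2_norm_def norm_mult power_mult_distrib real_sqrt_mult)

lemma L2_norm_minus_commute: "L2_norm (\<lambda>t. f t - g t) = L2_norm (\<lambda>t. g t - f t)"
  by (simp add: L2_norm_def norm_minus_commute)

lemma L2_product_integrable:
  assumes "f \<in> L2" "g \<in> L2"
  shows "integrable halfline (\<lambda>t. f t * g t)"
proof (rule Bochner_Integration.integrable_bound)
  show "(\<lambda>t. f t * g t) \<in> borel_measurable halfline"
    using assms by (intro borel_measurable_times L2_measurable)
  show "integrable halfline (\<lambda>t. (norm (f t))\<^sup>2 + (norm (g t))\<^sup>2)"
    using assms by (intro Bochner_Integration.integrable_add L2_integrable_sq)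
  show "AE t in halfline. norm (f t * g t) \<le> norm ((norm (f t))\<^sup>2 + (norm (g t))\<^sup>2)"
    using norm_mult_le_sum_squares[of "f t" "g t" for t] by (intro AE_I2) (auto intro: order_trans)
qed

lemma L2_Cauchy_Schwarz:
  assumes f: "f \<in> L2" and g: "g \<in> L2"
  shows "(LINT t|halfline. norm (f t) * norm (g t)) \<le> L2_norm f * L2_norm g"
proof -
  note [measurable] = L2_measurable[OF f] L2_measurable[OF g]
  have sq: "(\<integral>\<^sup>+ t. (ennreal (norm (k t)))\<^sup>2 \<partial>halfline) = ennreal ((L2_norm k)\<^sup>2)" if "k \<in> L2" for k
    using that unfolding L2_norm_sq
    by (subst nn_integral_eq_integral[symmetric]) (auto simp: ennreal_power L2_integrable_sq)
  have "integrable halfline (\<lambda>t. norm (f t) * norm (g t))"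
    using integrable_norm[OF L2_product_integrable[OF f g]] by (simp add: norm_mult)
  then have "ennreal (LINT t|halfline. norm (f t) * norm (g t))
      = (\<integral>\<^sup>+ t. ennreal (norm (f t)) * ennreal (norm (g t)) \<partial>halfline)"
    by (subst nn_integral_eq_integral[symmetric]) (auto simp: ennreal_mult)
  then have "(ennreal (LINT t|halfline. norm (f t) * norm (g t)))\<^sup>2 \<le> ennreal ((L2_norm f)\<^sup>2) * ennreal ((L2_norm g)\<^sup>2)"
    using Cauchy_Schwarz_nn_integral[of "\<lambda>t. ennreal (norm (f t))" halfline "\<lambda>t. ennreal (norm (g t))"]
    by (simp add: sq f g)
  then have "ennreal ((LINT t|halfline. norm (f t) * norm (g t))\<^sup>2) \<le> ennreal ((L2_norm f * L2_norm g)\<^sup>2)"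
    by (simp add: ennreal_power integral_nonneg_AE ennreal_mult[symmetric] power_mult_distrib)
  then have "(LINT t|halfline. norm (f t) * norm (g t))\<^sup>2 \<le> (L2_norm f * L2_norm g)\<^sup>2"
    by (simp add: ennreal_le_iff)
  then show ?thesis
    by (rule power2_le_imp_le) simp
qed

lemma L2_product_bound:
  assumes "f \<in> L2" "g \<in> L2"
  shows "norm (LINT t|halfline. f t * g t) \<le> L2_norm f * L2_norm g"
  using integral_norm_bound[of halfline "\<lambda>t. f t * g t"] L2_Cauchy_Schwarz[OF assms]
  by (simp add: norm_mult)

lemma L2_inner_bound: "f \<in> L2 \<Longrightarrow> g \<in> L2 \<Longrightarrow> norm (L2_inner f g) \<le> L2_norm f * L2_norm g"
  using L2_product_bound[of f "\<lambda>t. cnj (g t)"] by (simp add: L2_inner_def L2_cnj L2_norm_cnj)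

lemma L2_inner_cnj: "cnj (L2_inner f g) = L2_inner g f"
  unfolding L2_inner_def by (subst Bochner_Integration.integral_cnj[symmetric]) (simp add: mult.commute)

lemma L2_inner_add_left:
  "f \<in> L2 \<Longrightarrow> g \<in> L2 \<Longrightarrow> k \<in> L2 \<Longrightarrow> L2_inner (\<lambda>t. f t + g t) k = L2_inner f k + L2_inner g k"
  unfolding L2_inner_def distrib_right
  by (intro Bochner_Integration.integral_add L2_product_integrable L2_cnj)

lemma L2_inner_scale_left: "L2_inner (\<lambda>t. c * f t) k = c * L2_inner f k"
  unfolding L2_inner_def mult.assoc by (rule integral_mult_right_zero)

lemma L2_inner_diff_left:
  "f \<in> L2 \<Longrightarrow> g \<in> L2 \<Longrightarrow> k \<in> L2 \<Longrightarrow> L2_inner (\<lambda>t. f t - g t) k = L2_inner f k - L2_inner g k"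
  unfolding L2_inner_def left_diff_distrib
  by (intro Bochner_Integration.integral_diff L2_product_integrable L2_cnj)

lemma L2_inner_add_right:
  assumes "f \<in> L2" "g \<in> L2" "k \<in> L2"
  shows "L2_inner k (\<lambda>t. f t + g t) = L2_inner k f + L2_inner k g"
  using arg_cong[OF L2_inner_add_left[OF assms], of cnj] by (simp add: L2_inner_cnj)

lemma L2_inner_diff_right:
  assumes "f \<in> L2" "g \<in> L2" "k \<in> L2"
  shows "L2_inner k (\<lambda>t. f t - g t) = L2_inner k f - L2_inner k g"
  using arg_cong[OF L2_inner_diff_left[OF assms], of cnj] by (simp add: L2_inner_cnj)

lemma L2_inner_scale_right: "L2_inner k (\<lambda>t. c * f t) = cnj c * L2_inner k f"
  using arg_cong[OF L2_inner_scale_left[of c f k], of cnj] by (simp add: L2_inner_cnj)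

lemma L2_inner_self: "L2_inner f f = of_real ((L2_norm f)\<^sup>2)"
  unfolding L2_inner_def L2_norm_sq integral_complex_of_real[symmetric]
  by (simp add: complex_norm_square[symmetric])

lemma L2_norm_diff_scale_sq:
  assumes f: "f \<in> L2" and g: "g \<in> L2"
  shows "(L2_norm (\<lambda>t. f t - c * g t))\<^sup>2
    = (L2_norm f)\<^sup>2 - 2 * Re (cnj c * L2_inner f g) + (norm c)\<^sup>2 * (L2_norm g)\<^sup>2"
proof -
  let ?d = "\<lambda>t. f t - c * g t"
  have m: "?d \<in> L2" "(\<lambda>t. c * g t) \<in> L2" using f g by (auto intro: L2_diff L2_scale)
  have "complex_of_real ((L2_norm ?d)\<^sup>2) = L2_inner f ?d - c * L2_inner g ?d"
    unfolding L2_inner_self[symmetric] using m f by (simp add: L2_inner_diff_left L2_inner_scale_left)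
  also have "\<dots> = L2_inner f f - cnj c * L2_inner f g - c * cnj (L2_inner f g) + c * cnj c * L2_inner g g"
    using m f g by (simp add: L2_inner_diff_right L2_inner_scale_right L2_inner_cnj algebra_simps)
  finally have "(L2_norm ?d)\<^sup>2 = Re (of_real ((L2_norm f)\<^sup>2) - cnj c * L2_inner f g - cnj (cnj c * L2_inner f g)
      + of_real ((norm c)\<^sup>2) * of_real ((L2_norm g)\<^sup>2))"
    unfolding L2_inner_self complex_norm_square[symmetric] by (metis Re_complex_of_real complex_cnj_mult complex_cnj_cnj)
  then show ?thesis by simp
qed

lemma L2_triangle:
  assumes f: "f \<in> L2" and g: "g \<in> L2"
  shows "L2_norm (\<lambda>t. f t + g t) \<le> L2_norm f + L2_norm g"
proof (rule power2_le_imp_le)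
  have "(L2_norm (\<lambda>t. f t + g t))\<^sup>2 = (L2_norm f)\<^sup>2 + 2 * Re (L2_inner f g) + (L2_norm g)\<^sup>2"
    using L2_norm_diff_scale_sq[OF f g, of "-1"] by simp
  also have "Re (L2_inner f g) \<le> L2_norm f * L2_norm g"
    using L2_inner_bound[OF f g] complex_Re_le_cmod order_trans by blast
  finally show "(L2_norm (\<lambda>t. f t + g t))\<^sup>2 \<le> (L2_norm f + L2_norm g)\<^sup>2"
    by (simp add: power2_sum)
qed simp

lemma L2_triangle_diff:
  assumes "f \<in> L2" "g \<in> L2" "k \<in> L2"
  shows "L2_norm (\<lambda>t. f t - k t) \<le> L2_norm (\<lambda>t. f t - g t) + L2_norm (\<lambda>t. g t - k t)"
  using L2_triangle[of "\<lambda>t. f t - g t" "\<lambda>t. g t - k t"] assms by (simp add: L2_diff)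

lemma L2_parallelogram:
  assumes f: "f \<in> L2" and g: "g \<in> L2"
  shows "(L2_norm (\<lambda>t. f t + g t))\<^sup>2 + (L2_norm (\<lambda>t. f t - g t))\<^sup>2 = 2 * (L2_norm f)\<^sup>2 + 2 * (L2_norm g)\<^sup>2"
  using L2_norm_diff_scale_sq[OF f g, of "-1"] L2_norm_diff_scale_sq[OF f g, of 1] by simp

lemma L2_norm_eq_0_iff: "f \<in> L2 \<Longrightarrow> L2_norm f = 0 \<longleftrightarrow> (AE t in halfline. f t = 0)"
  unfolding L2_norm_def using integral_nonneg_eq_0_iff_AE[OF L2_integrable_sq[of f]] by simp

lemma L2_norm_tendsto:
  assumes "\<And>n. g n \<in> L2" "f \<in> L2" "(\<lambda>n. L2_norm (\<lambda>t. g n t - f t)) \<longlonglongrightarrow> 0"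
  shows "(\<lambda>n. L2_norm (g n)) \<longlonglongrightarrow> L2_norm f"
proof (rule LIM_zero_cancel, rule Lim_null_comparison[OF _ assms(3)], rule always_eventually, rule allI)
  fix n
  have "L2_norm (g n) \<le> L2_norm (\<lambda>t. g n t - f t) + L2_norm f"
    using L2_triangle_diff[of "g n" f "\<lambda>_. 0"] assms L2_zero by simp
  moreover have "L2_norm f \<le> L2_norm (\<lambda>t. g n t - f t) + L2_norm (g n)"
    using L2_triangle_diff[of f "g n" "\<lambda>_. 0"] assms L2_zero by (simp add: L2_norm_minus_commute[of f])
  ultimately show "norm (L2_norm (g n) - L2_norm f) \<le> L2_norm (\<lambda>t. g n t - f t)"
    by simp
qed

text \<open>
  Fatou's lemma in the form in which completeness uses it: a norm bound passes to almost everywhere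
  limits.
\<close>

lemma L2_Fatou:
  assumes g: "\<And>n. g n \<in> L2" and f[measurable]: "f \<in> borel_measurable halfline"
    and lim: "AE t in halfline. (\<lambda>n. g n t) \<longlonglongrightarrow> f t"
    and bound: "\<forall>\<^sub>F n in sequentially. L2_norm (g n) \<le> B"
  shows "f \<in> L2" "L2_norm f \<le> B"
proof -
  note [measurable] = L2_measurable[OF g]
  obtain n where "L2_norm (g n) \<le> B"
    using bound eventually_happens by fastforce
  then have B: "0 \<le> B" using L2_norm_nonneg order_trans by blast
  have "(\<integral>\<^sup>+ t. ennreal ((norm (f t))\<^sup>2) \<partial>halfline)
      \<le> (\<integral>\<^sup>+ t. liminf (\<lambda>n. ennreal ((norm (g n t))\<^sup>2)) \<partial>halfline)"
  proof (rule nn_integral_mono_AE)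
    show "AE t in halfline. ennreal ((norm (f t))\<^sup>2) \<le> liminf (\<lambda>n. ennreal ((norm (g n t))\<^sup>2))"
      using lim
    proof eventually_elim
      fix t assume "(\<lambda>n. g n t) \<longlonglongrightarrow> f t"
      then have "(\<lambda>n. ennreal ((norm (g n t))\<^sup>2)) \<longlonglongrightarrow> ennreal ((norm (f t))\<^sup>2)"
        by (intro tendsto_ennrealI tendsto_intros)
      then show "ennreal ((norm (f t))\<^sup>2) \<le> liminf (\<lambda>n. ennreal ((norm (g n t))\<^sup>2))"
        by (subst lim_imp_Liminf[OF sequentially_bot]) auto
    qed
  qed
  also have "\<dots> \<le> liminf (\<lambda>n. \<integral>\<^sup>+ t. ennreal ((norm (g n t))\<^sup>2) \<partial>halfline)"
    by (rule nn_integral_liminf) measurable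
  also have "\<dots> \<le> ennreal (B\<^sup>2)"
  proof (rule Liminf_le)
    show "\<forall>\<^sub>F n in sequentially. (\<integral>\<^sup>+ t. ennreal ((norm (g n t))\<^sup>2) \<partial>halfline) \<le> ennreal (B\<^sup>2)"
      using bound
    proof eventually_elim
      fix n assume "L2_norm (g n) \<le> B"
      then have "(L2_norm (g n))\<^sup>2 \<le> B\<^sup>2" by (intro power_mono) auto
      then show "(\<integral>\<^sup>+ t. ennreal ((norm (g n t))\<^sup>2) \<partial>halfline) \<le> ennreal (B\<^sup>2)"
        by (subst nn_integral_eq_integral) (auto simp: L2_norm_sq L2_integrable_sq g)
    qed
  qed simp
  finally have le: "(\<integral>\<^sup>+ t. ennreal ((norm (f t))\<^sup>2) \<partial>halfline) \<le> ennreal (B\<^sup>2)" .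
  then have i: "integrable halfline (\<lambda>t. (norm (f t))\<^sup>2)"
    by (intro integrableI_bounded) (auto simp: le_less_trans)
  then show "f \<in> L2" by (simp add: L2_def)
  from le i have "(L2_norm f)\<^sup>2 \<le> B\<^sup>2"
    by (subst (asm) nn_integral_eq_integral) (auto simp: L2_norm_sq)
  then show "L2_norm f \<le> B" using B by (rule power2_le_imp_le)
qed

text \<open>
  The Riesz--Fischer theorem. Along a subsequence with increments below \<open>4\<^sup>-\<^sup>k\<close> in norm, the series of
  \<open>4\<^sup>k |f\<^sub>k\<^sub>+\<^sub>1 - f\<^sub>k|\<^sup>2\<close> has finite integral; where its sum is finite the increments are \<open>O(2\<^sup>-\<^sup>k)\<close>, so
  the subsequence converges there. Fatou's lemma shows that the whole sequence converges in norm.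
\<close>

lemma L2_complete:
  assumes f: "\<And>n::nat. f n \<in> L2"
    and Cauchy: "\<And>\<epsilon>. \<epsilon> > 0 \<Longrightarrow> \<exists>N. \<forall>m\<ge>N. \<forall>n\<ge>N. L2_norm (\<lambda>t. f m t - f n t) < \<epsilon>"
  obtains g where "g \<in> L2" "(\<lambda>n. L2_norm (\<lambda>t. f n t - g t)) \<longlonglongrightarrow> 0"
proof -
  note [measurable] = L2_measurable[OF f]
  have "\<exists>N. \<forall>k. \<forall>m\<ge>N k. \<forall>n\<ge>N k. L2_norm (\<lambda>t. f m t - f n t) < (1 / 4) ^ k"
    using Cauchy[of "(1 / 4) ^ k" for k] by (intro choice) auto
  then obtain N where N: "\<And>k m n. N k \<le> m \<Longrightarrow> N k \<le> n \<Longrightarrow> L2_norm (\<lambda>t. f m t - f n t) < (1 / 4) ^ k"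
    by metis
  define r where "r k = (\<Sum>j\<le>k. N j) + k" for k
  have "N k \<le> r m" if "k \<le> m" for k m
    unfolding r_def using that by (intro trans_le_add1 member_le_sum) auto
  moreover have "k \<le> r k" for k
    by (simp add: r_def)
  ultimately have r: "N k \<le> r k" "N k \<le> r (Suc k)" "k \<le> r k" for k
    by simp_all
  define d where "d k t = 4 ^ k * (norm (f (r (Suc k)) t - f (r k) t))\<^sup>2" for k t
  have [measurable]: "d k \<in> borel_measurable halfline" for k
    unfolding d_def[abs_def] by measurable
  have "(\<integral>\<^sup>+ t. (\<Sum>k. ennreal (d k t)) \<partial>halfline) = (\<Sum>k. \<integral>\<^sup>+ t. ennreal (d k t) \<partial>halfline)"
    by (rule nn_integral_suminf) measurable
  also have "\<dots> \<le> (\<Sum>k. ennreal ((1 / 4) ^ k))"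
  proof (intro suminf_le allI)
    fix k
    let ?e = "\<lambda>t. f (r (Suc k)) t - f (r k) t"
    have e: "?e \<in> L2" by (intro L2_diff f)
    have "(L2_norm ?e)\<^sup>2 \<le> ((1 / 4) ^ k)\<^sup>2"
      using N[OF r(2) r(1)] by (intro power_mono) (auto intro: less_imp_le)
    then have "4 ^ k * (L2_norm ?e)\<^sup>2 \<le> 4 ^ k * ((1 / 4) ^ k)\<^sup>2"
      by (intro mult_left_mono) auto
    also have "\<dots> = (1 / 4) ^ k"
      by (simp add: power2_eq_square power_divide)
    finally show "(\<integral>\<^sup>+ t. ennreal (d k t) \<partial>halfline) \<le> ennreal ((1 / 4) ^ k)"
      using L2_integrable_sq[OF e] unfolding d_def
      by (subst nn_integral_eq_integral) (auto simp: L2_norm_sq)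
  qed auto
  also have "\<dots> < \<infinity>"
    by (subst suminf_ennreal2) (auto simp: summable_geometric)
  finally have "AE t in halfline. (\<Sum>k. ennreal (d k t)) \<noteq> \<infinity>"
    by (intro nn_integral_noteq_infinite) auto
  then have conv: "AE t in halfline. convergent (\<lambda>k. f (r k) t)"
  proof eventually_elim
    fix t assume fin: "(\<Sum>k. ennreal (d k t)) \<noteq> \<infinity>"
    define S where "S = enn2real (\<Sum>k. ennreal (d k t))"
    have "d k t \<le> S" for k
    proof -
      have "ennreal (d k t) \<le> (\<Sum>k. ennreal (d k t))"
        using sum_le_suminf[of "\<lambda>k. ennreal (d k t)" "{k}"] by auto
      also have "\<dots> = ennreal S"
        using fin by (simp add: S_def top.not_eq_extremum)
      finally show ?thesis by (subst (asm) ennreal_le_iff) (auto simp: S_def)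
    qed
    have "norm (f (r (Suc k)) t - f (r k) t) \<le> sqrt S * (1 / 2) ^ k" for k
    proof (rule power2_le_imp_le)
      have "0 \<le> S" by (simp add: S_def)
      moreover have "((1 / 2 :: real) ^ k)\<^sup>2 = (1 / 4) ^ k"
        by (simp add: power2_eq_square flip: power_mult_distrib)
      ultimately have "(sqrt S * (1 / 2) ^ k)\<^sup>2 = S / 4 ^ k"
        by (simp add: power_mult_distrib power_divide)
      moreover have "(norm (f (r (Suc k)) t - f (r k) t))\<^sup>2 \<le> S / 4 ^ k"
        using \<open>d k t \<le> S\<close> by (simp add: d_def field_simps)
      ultimately show "(norm (f (r (Suc k)) t - f (r k) t))\<^sup>2 \<le> (sqrt S * (1 / 2) ^ k)\<^sup>2"
        by simp
    qed (simp add: S_def)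
    note bound = this
    have "summable (\<lambda>k. sqrt S * (1 / 2) ^ k)"
      by (intro summable_mult summable_geometric) simp
    then have "summable (\<lambda>k. f (r (Suc k)) t - f (r k) t)"
      by (rule summable_comparison_test'[where N=0]) (rule bound)
    then have "convergent (\<lambda>n. f (r 0) t + (\<Sum>k<n. f (r (Suc k)) t - f (r k) t))"
      by (intro convergent_add convergent_const) (simp add: summable_iff_convergent)
    moreover have "f (r 0) t + (\<Sum>k<n. f (r (Suc k)) t - f (r k) t) = f (r n) t" for n
      by (subst sum_lessThan_telescope) simp
    ultimately show "convergent (\<lambda>k. f (r k) t)" by simp
  qed
  define g where "g t = lim (\<lambda>k. f (r k) t)" for t
  have [measurable]: "g \<in> borel_measurable halfline"
    unfolding g_def[abs_def] by (rule borel_measurable_lim_metric) measurable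
  have lim: "AE t in halfline. (\<lambda>k. f (r k) t) \<longlonglongrightarrow> g t"
    using conv by eventually_elim (simp add: g_def convergent_LIMSEQ_iff)
  have close: "(\<lambda>t. f n t - g t) \<in> L2 \<and> L2_norm (\<lambda>t. f n t - g t) \<le> \<epsilon>"
    if "\<epsilon> > 0" "\<forall>m\<ge>M. \<forall>n\<ge>M. L2_norm (\<lambda>t. f m t - f n t) < \<epsilon>" "n \<ge> M" for \<epsilon> M n
  proof -
    have b: "\<forall>\<^sub>F k in sequentially. L2_norm (\<lambda>t. f n t - f (r k) t) \<le> \<epsilon>"
      using eventually_ge_at_top[of M]
      by eventually_elim (use that r(3) in \<open>meson less_imp_le order_trans\<close>)
    have l: "AE t in halfline. (\<lambda>k. f n t - f (r k) t) \<longlonglongrightarrow> f n t - g t"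
      using lim by eventually_elim (intro tendsto_intros)
    show ?thesis
      using L2_Fatou[OF L2_diff[OF f f] _ l b] by simp
  qed
  show thesis
  proof
    obtain M where M: "\<forall>m\<ge>M. \<forall>n\<ge>M. L2_norm (\<lambda>t. f m t - f n t) < 1"
      using Cauchy[of 1] by auto
    have "(\<lambda>t. f M t - g t) \<in> L2" using close[OF _ M] by simp
    from L2_diff[OF f[of M] this] show "g \<in> L2" by simp
    show "(\<lambda>n. L2_norm (\<lambda>t. f n t - g t)) \<longlonglongrightarrow> 0"
    proof (rule LIMSEQ_I)
      fix \<epsilon> :: real assume "\<epsilon> > 0"
      then obtain M where M: "\<forall>m\<ge>M. \<forall>n\<ge>M. L2_norm (\<lambda>t. f m t - f n t) < \<epsilon> / 2"
        using Cauchy[of "\<epsilon> / 2"] by auto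
      have "L2_norm (\<lambda>t. f n t - g t) < \<epsilon>" if "n \<ge> M" for n
        using close[OF _ M that] \<open>\<epsilon> > 0\<close> by simp
      then show "\<exists>M. \<forall>n\<ge>M. norm (L2_norm (\<lambda>t. f n t - g t) - 0) < \<epsilon>"
        by auto
    qed
  qed
qed


lemma graph_norm_sq: "(graph_norm f w)\<^sup>2 = (L2_norm f)\<^sup>2 + (L2_norm w)\<^sup>2"
  by (simp add: graph_norm_def)

lemma L2_norm_le_graph_norm: "L2_norm f \<le> graph_norm f w" "L2_norm w \<le> graph_norm f w"
  by (auto simp: graph_norm_def intro: real_le_rsqrt)

lemma graph_norm_diff_scale_sq:
  assumes "f \<in> L2" "w \<in> L2" "\<phi> \<in> L2" "u \<in> L2"
  shows "(graph_norm (\<lambda>t. f t - c * \<phi> t) (\<lambda>t. w t - c * u t))\<^sup>2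
    = (graph_norm f w)\<^sup>2 - 2 * Re (cnj c * (L2_inner f \<phi> + L2_inner w u)) + (norm c)\<^sup>2 * (graph_norm \<phi> u)\<^sup>2"
  unfolding graph_norm_sq using assms by (simp add: L2_norm_diff_scale_sq algebra_simps)

text \<open>
  The projection theorem for a linear subspace \<open>V\<close> of the Hilbert space of pairs: a minimizing
  sequence is Cauchy by the parallelogram law, and its limit \<open>(p, q)\<close> leaves a remainder that is
  orthogonal to \<open>V\<close>. It is used below both for density of a set of functions (with second component
  zero) and for the closure of an operator.
\<close>

lemma graph_projection:
  assumes V: "V \<subseteq> L2 \<times> L2" "V \<noteq> {}"
    and lin: "\<And>f w f' w' c. (f, w) \<in> V \<Longrightarrow> (f', w') \<in> V \<Longrightarrow> (\<lambda>t. f t + c * f' t, \<lambda>t. w t + c * w' t) \<in> V"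
    and fw: "f \<in> L2" "w \<in> L2"
  obtains p q where "(p, q) \<in> closure_op V"
    "\<And>\<phi> u. (\<phi>, u) \<in> V \<Longrightarrow> L2_inner (\<lambda>t. f t - p t) \<phi> + L2_inner (\<lambda>t. w t - q t) u = 0"
proof -
  define D where "D = (\<lambda>(\<phi>, u). (graph_norm (\<lambda>t. f t - \<phi> t) (\<lambda>t. w t - u t))\<^sup>2)"
  define d where "d = Inf (D ` V)"
  have bdd: "bdd_below (D ` V)"
    by (intro bdd_belowI[of _ 0]) (auto simp: D_def)
  have d_le: "d \<le> D v" if "v \<in> V" for v
    unfolding d_def using bdd that by (intro cInf_lower) auto
  have "\<exists>v\<in>V. D v < d + inverse (Suc n)" for n
    using cInf_lessD[of "D ` V" "d + inverse (Suc n)"] V(2) by (auto simp: d_def)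
  then obtain v where v: "\<And>n. v n \<in> V" "\<And>n. D (v n) < d + inverse (Suc n)"
    by metis
  define \<phi> where "\<phi> n = fst (v n)" for n
  define u where "u n = snd (v n)" for n
  have v_eq: "v n = (\<phi> n, u n)" for n by (simp add: \<phi>_def u_def)
  have L2: "\<phi> n \<in> L2" "u n \<in> L2" for n using v(1)[of n] V(1) by (auto simp: v_eq)
  have Cauchy_bound: "(graph_norm (\<lambda>t. \<phi> m t - \<phi> n t) (\<lambda>t. u m t - u n t))\<^sup>2
      \<le> 2 * inverse (Suc m) + 2 * inverse (Suc n)" for m n
  proof -
    \<comment> \<open>The midpoint of \<open>v m\<close> and \<open>v n\<close>, written as a combination to which \<open>lin\<close> applies.\<close>
    let ?h = "\<lambda>t. \<phi> m t + (1/2) * ((\<phi> n t + (-1) * \<phi> m t))" and ?k = "\<lambda>t. u m t + (1/2) * (u n t + (-1) * u m t)"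
    have "(?h, ?k) \<in> V"
      using v(1) unfolding v_eq by (intro lin)
    then have "4 * d \<le> 4 * D (?h, ?k)" using d_le by simp
    also have "\<dots> = (2 * L2_norm (\<lambda>t. f t - ?h t))\<^sup>2 + (2 * L2_norm (\<lambda>t. w t - ?k t))\<^sup>2"
      by (simp add: D_def graph_norm_sq power_mult_distrib)
    also have "2 * L2_norm (\<lambda>t. f t - ?h t) = L2_norm (\<lambda>t. (f t - \<phi> n t) + (f t - \<phi> m t))"
    proof -
      have "L2_norm (\<lambda>t. (f t - \<phi> n t) + (f t - \<phi> m t)) = L2_norm (\<lambda>t. 2 * (f t - ?h t))"
        by (rule arg_cong[of _ _ L2_norm]) (auto simp: fun_eq_iff algebra_simps)
      then show ?thesis by (simp only: L2_norm_scale) simp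
    qed
    also have "2 * L2_norm (\<lambda>t. w t - ?k t) = L2_norm (\<lambda>t. (w t - u n t) + (w t - u m t))"
    proof -
      have "L2_norm (\<lambda>t. (w t - u n t) + (w t - u m t)) = L2_norm (\<lambda>t. 2 * (w t - ?k t))"
        by (rule arg_cong[of _ _ L2_norm]) (auto simp: fun_eq_iff algebra_simps)
      then show ?thesis by (simp only: L2_norm_scale) simp
    qed
    finally have "4 * d \<le> (L2_norm (\<lambda>t. (f t - \<phi> n t) + (f t - \<phi> m t)))\<^sup>2 +
      (L2_norm (\<lambda>t. (w t - u n t) + (w t - u m t)))\<^sup>2" .
    moreover have "(L2_norm (\<lambda>t. (f t - \<phi> n t) + (f t - \<phi> m t)))\<^sup>2 + (L2_norm (\<lambda>t. \<phi> m t - \<phi> n t))\<^sup>2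
        = 2 * (L2_norm (\<lambda>t. f t - \<phi> n t))\<^sup>2 + 2 * (L2_norm (\<lambda>t. f t - \<phi> m t))\<^sup>2"
      using L2_parallelogram[OF L2_diff[OF fw(1) L2(1)[of n]] L2_diff[OF fw(1) L2(1)[of m]]] by simp
    moreover have "(L2_norm (\<lambda>t. (w t - u n t) + (w t - u m t)))\<^sup>2 + (L2_norm (\<lambda>t. u m t - u n t))\<^sup>2
        = 2 * (L2_norm (\<lambda>t. w t - u n t))\<^sup>2 + 2 * (L2_norm (\<lambda>t. w t - u m t))\<^sup>2"
      using L2_parallelogram[OF L2_diff[OF fw(2) L2(2)[of n]] L2_diff[OF fw(2) L2(2)[of m]]] by simp
    ultimately show ?thesis
      using v(2)[of m] v(2)[of n] by (simp add: D_def v_eq graph_norm_sq)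
  qed
  have Cauchy: "\<exists>N. \<forall>m\<ge>N. \<forall>n\<ge>N. graph_norm (\<lambda>t. \<phi> m t - \<phi> n t) (\<lambda>t. u m t - u n t) < \<epsilon>"
    if "\<epsilon> > 0" for \<epsilon>
  proof -
    have "\<epsilon>\<^sup>2 / 4 > 0" using that by simp
    from reals_Archimedean[OF this] obtain N where N: "inverse (Suc N) < \<epsilon>\<^sup>2 / 4" by blast
    have "graph_norm (\<lambda>t. \<phi> m t - \<phi> n t) (\<lambda>t. u m t - u n t) < \<epsilon>" if "N \<le> m" "N \<le> n" for m n
    proof (rule power2_less_imp_less)
      have "inverse (real (Suc m)) \<le> inverse (real (Suc N))" "inverse (real (Suc n)) \<le> inverse (real (Suc N))"
        using that by (auto intro!: le_imp_inverse_le)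
      then show "(graph_norm (\<lambda>t. \<phi> m t - \<phi> n t) (\<lambda>t. u m t - u n t))\<^sup>2 < \<epsilon>\<^sup>2"
        using Cauchy_bound[of m n] N by linarith
    qed (use \<open>\<epsilon> > 0\<close> in auto)
    then show ?thesis by blast
  qed
  have Cauchy': "\<exists>N. \<forall>m\<ge>N. \<forall>n\<ge>N. L2_norm (\<lambda>t. \<phi> m t - \<phi> n t) < \<epsilon>"
    "\<exists>N. \<forall>m\<ge>N. \<forall>n\<ge>N. L2_norm (\<lambda>t. u m t - u n t) < \<epsilon>" if \<epsilon>: "\<epsilon> > 0" for \<epsilon>
  proof -
    obtain N where N: "\<And>m n. m \<ge> N \<Longrightarrow> n \<ge> N \<Longrightarrow> graph_norm (\<lambda>t. \<phi> m t - \<phi> n t) (\<lambda>t. u m t - u n t) < \<epsilon>"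
      using Cauchy[OF \<epsilon>] by blast
    show "\<exists>N. \<forall>m\<ge>N. \<forall>n\<ge>N. L2_norm (\<lambda>t. \<phi> m t - \<phi> n t) < \<epsilon>"
      by (intro exI[of _ N] allI impI le_less_trans[OF L2_norm_le_graph_norm(1) N])
    show "\<exists>N. \<forall>m\<ge>N. \<forall>n\<ge>N. L2_norm (\<lambda>t. u m t - u n t) < \<epsilon>"
      by (intro exI[of _ N] allI impI le_less_trans[OF L2_norm_le_graph_norm(2) N])
  qed
  obtain p where p: "p \<in> L2" "(\<lambda>n. L2_norm (\<lambda>t. \<phi> n t - p t)) \<longlonglongrightarrow> 0"
    by (rule L2_complete[OF L2(1) Cauchy'(1)])
  obtain q where q: "q \<in> L2" "(\<lambda>n. L2_norm (\<lambda>t. u n t - q t)) \<longlonglongrightarrow> 0"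
    by (rule L2_complete[OF L2(2) Cauchy'(2)])
  let ?r = "\<lambda>t. f t - p t" and ?s = "\<lambda>t. w t - q t"
  have rs: "?r \<in> L2" "?s \<in> L2" using fw p q by (auto intro: L2_diff)
  have closest: "d \<le> (graph_norm (\<lambda>t. ?r t - c * \<psi> t) (\<lambda>t. ?s t - c * z t))\<^sup>2" if "(\<psi>, z) \<in> V" for c \<psi> z
  proof -
    have \<psi>z: "\<psi> \<in> L2" "z \<in> L2" using that V(1) by auto
    have "(\<lambda>n. L2_norm (\<lambda>t. f t - \<phi> n t - c * \<psi> t)) \<longlonglongrightarrow> L2_norm (\<lambda>t. ?r t - c * \<psi> t)"
      using p(2) by (intro L2_norm_tendsto L2_diff L2_scale fw L2 \<psi>z p(1)) (simp add: L2_norm_minus_commute[of p])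
    moreover have "(\<lambda>n. L2_norm (\<lambda>t. w t - u n t - c * z t)) \<longlonglongrightarrow> L2_norm (\<lambda>t. ?s t - c * z t)"
      using q(2) by (intro L2_norm_tendsto L2_diff L2_scale fw L2 \<psi>z q(1)) (simp add: L2_norm_minus_commute[of q])
    ultimately have "(\<lambda>n. (graph_norm (\<lambda>t. f t - \<phi> n t - c * \<psi> t) (\<lambda>t. w t - u n t - c * z t))\<^sup>2)
        \<longlonglongrightarrow> (graph_norm (\<lambda>t. ?r t - c * \<psi> t) (\<lambda>t. ?s t - c * z t))\<^sup>2"
      unfolding graph_norm_sq by (intro tendsto_intros)
    moreover have "d \<le> (graph_norm (\<lambda>t. f t - \<phi> n t - c * \<psi> t) (\<lambda>t. w t - u n t - c * z t))\<^sup>2" for n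
      using d_le[OF lin[OF v(1)[of n, unfolded v_eq] that, of c]]
      by (simp add: D_def diff_diff_eq)
    ultimately show ?thesis by (intro LIMSEQ_le_const) auto
  qed
  have attained: "(graph_norm ?r ?s)\<^sup>2 \<le> d"
  proof -
    have "(\<lambda>n. L2_norm (\<lambda>t. f t - \<phi> n t)) \<longlonglongrightarrow> L2_norm ?r"
      using p(2) by (intro L2_norm_tendsto L2_diff fw L2 p(1)) (simp add: L2_norm_minus_commute[of p])
    moreover have "(\<lambda>n. L2_norm (\<lambda>t. w t - u n t)) \<longlonglongrightarrow> L2_norm ?s"
      using q(2) by (intro L2_norm_tendsto L2_diff fw L2 q(1)) (simp add: L2_norm_minus_commute[of q])
    ultimately have "(\<lambda>n. D (v n)) \<longlonglongrightarrow> (graph_norm ?r ?s)\<^sup>2"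
      unfolding D_def v_eq graph_norm_sq prod.case by (intro tendsto_intros)
    moreover have "(\<lambda>n. d + inverse (real (Suc n))) \<longlonglongrightarrow> d + 0"
      by (intro tendsto_intros LIMSEQ_inverse_real_of_nat)
    ultimately have "(graph_norm ?r ?s)\<^sup>2 \<le> d + 0"
      by (rule LIMSEQ_le) (auto intro!: less_imp_le v(2) simp del: of_nat_Suc)
    then show ?thesis by simp
  qed
  show thesis
  proof
    show "(p, q) \<in> closure_op V"
      unfolding closure_op_def
    proof (clarsimp simp: p q, goal_cases)
      case (1 \<epsilon>)
      have "(\<lambda>n. graph_norm (\<lambda>t. p t - \<phi> n t) (\<lambda>t. q t - u n t)) \<longlonglongrightarrow> sqrt (0\<^sup>2 + 0\<^sup>2)"
        unfolding graph_norm_def using p(2) q(2)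
        by (intro tendsto_intros) (simp_all add: L2_norm_minus_commute[of p] L2_norm_minus_commute[of q])
      then have "\<forall>\<^sub>F n in sequentially. graph_norm (\<lambda>t. p t - \<phi> n t) (\<lambda>t. q t - u n t) < \<epsilon>"
        using 1 by (intro order_tendstoD) auto
      then obtain n where "graph_norm (\<lambda>t. p t - \<phi> n t) (\<lambda>t. q t - u n t) < \<epsilon>"
        using eventually_happens by fastforce
      then show ?case using v(1)[of n] unfolding v_eq by blast
    qed
    fix \<psi> z assume V': "(\<psi>, z) \<in> V"
    then have \<psi>z: "\<psi> \<in> L2" "z \<in> L2" using V(1) by auto
    define i where "i = L2_inner ?r \<psi> + L2_inner ?s z"
    define N where "N = (graph_norm \<psi> z)\<^sup>2"
    have le: "2 * Re (cnj c * i) \<le> (norm c)\<^sup>2 * N" for c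
      using attained closest[OF V', of c] graph_norm_diff_scale_sq[OF rs \<psi>z, of c]
      unfolding i_def N_def by linarith
    \<comment> \<open>Moving \<open>(p, q)\<close> by the small multiple \<open>s * i\<close> would come closer unless \<open>i = 0\<close>.\<close>
    define s where "s = inverse (N + 1)"
    have "N \<ge> 0" by (simp add: N_def)
    then have s: "s > 0" "s * N < 1"
      by (auto simp: s_def divide_simps)
    have "Re (cnj (of_real s * i) * i) = s * (norm i)\<^sup>2"
      by (simp add: cmod_power2 algebra_simps flip: power2_eq_square)
    then have "2 * (s * (norm i)\<^sup>2) \<le> s\<^sup>2 * (norm i)\<^sup>2 * N"
      using le[of "of_real s * i"] by (simp add: norm_mult power_mult_distrib)
    then have "s * (norm i)\<^sup>2 * 2 \<le> s * (norm i)\<^sup>2 * (s * N)"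
      by (simp add: power2_eq_square mult_ac)
    moreover have "s * (norm i)\<^sup>2 * (s * N) \<le> s * (norm i)\<^sup>2 * 1"
      using s by (intro mult_left_mono) auto
    ultimately have "s * (norm i)\<^sup>2 \<le> 0" by linarith
    then have "i = 0" using s by (simp add: mult_le_0_iff)
    then show "L2_inner ?r \<psi> + L2_inner ?s z = 0" by (simp add: i_def)
  qed
qed

section \<open>Translations of the half-line\<close>

lemma shift_measurable:
  assumes "f \<in> borel_measurable halfline" "0 \<le> \<delta>"
  shows "(\<lambda>t. f (t + \<delta>)) \<in> borel_measurable halfline"
proof (rule measurable_compose[OF _ assms(1)])
  show "(\<lambda>t. t + \<delta>) \<in> halfline \<rightarrow>\<^sub>M halfline"
    using assms(2) by (intro measurable_restrict_space3) auto
qed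

lemma greaterThan_sets_halfline: "0 \<le> \<delta> \<Longrightarrow> {\<delta><..} \<in> sets halfline"
  by (subst sets_restrict_space_iff) auto

lemma shift_integral:
  fixes k :: "real \<Rightarrow> 'a :: {banach, second_countable_topology}"
  assumes "0 \<le> \<delta>"
  shows "(LINT t|halfline. k (t + \<delta>)) = (LINT t|halfline. indicator {\<delta><..} t *\<^sub>R k t)"
proof -
  have "(LINT t|halfline. k (t + \<delta>)) = (LINT t|lborel. indicator {\<delta><..} (\<delta> + 1 * t) *\<^sub>R k (\<delta> + 1 * t))"
    by (subst integral_restrict_space)
       (auto intro!: Bochner_Integration.integral_cong simp: add.commute split: split_indicator)
  also have "\<dots> = (LINT t|lborel. indicator {\<delta><..} t *\<^sub>R k t)"
    using lborel_integral_real_affine[of 1 "\<lambda>t. indicator {\<delta><..} t *\<^sub>R k t" \<delta>] by simp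
  also have "\<dots> = (LINT t|halfline. indicator {\<delta><..} t *\<^sub>R k t)"
    using assms by (intro halfline_integral_eq_lborel[symmetric]) auto
  finally show ?thesis .
qed

lemma shift_integrable:
  fixes k :: "real \<Rightarrow> 'a :: {banach, second_countable_topology}"
  assumes "0 \<le> \<delta>" "integrable halfline k"
  shows "integrable halfline (\<lambda>t. k (t + \<delta>))"
proof -
  have "integrable halfline (\<lambda>t. indicator {\<delta><..} t *\<^sub>R k t)"
    using assms by (intro integrable_mult_indicator greaterThan_sets_halfline)
  then have "integrable lborel (\<lambda>t. indicator {0<..} t *\<^sub>R (indicator {\<delta><..} t *\<^sub>R k t))"
    by (subst (asm) integrable_restrict_space) auto
  also have "(\<lambda>t. indicator {0<..} t *\<^sub>R (indicator {\<delta><..} t *\<^sub>R k t)) = (\<lambda>t. indicator {\<delta><..} t *\<^sub>R k t)"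
    using assms(1) by (auto simp: fun_eq_iff split: split_indicator)
  finally have "integrable lborel (\<lambda>t. indicator {\<delta><..} (\<delta> + 1 * t) *\<^sub>R k (\<delta> + 1 * t))"
    by (subst lborel_integrable_real_affine_iff) auto
  also have "(\<lambda>t. indicator {\<delta><..} (\<delta> + 1 * t) *\<^sub>R k (\<delta> + 1 * t)) = (\<lambda>t. indicator {0<..} t *\<^sub>R k (t + \<delta>))"
    by (auto simp: fun_eq_iff add.commute split: split_indicator)
  finally show ?thesis
    by (subst integrable_restrict_space) auto
qed

lemma shift_L2:
  assumes f: "f \<in> L2" and "0 \<le> \<delta>"
  shows "(\<lambda>t. f (t + \<delta>)) \<in> L2"
    and "(L2_norm (\<lambda>t. f (t + \<delta>)))\<^sup>2 = (LINT t|halfline. indicator {\<delta><..} t *\<^sub>R (norm (f t))\<^sup>2)"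
    and "L2_norm (\<lambda>t. f (t + \<delta>)) \<le> L2_norm f"
proof -
  show "(\<lambda>t. f (t + \<delta>)) \<in> L2"
    using shift_measurable[OF L2_measurable[OF f] assms(2)]
      shift_integrable[OF assms(2) L2_integrable_sq[OF f]] by (simp add: L2_def)
  show eq: "(L2_norm (\<lambda>t. f (t + \<delta>)))\<^sup>2 = (LINT t|halfline. indicator {\<delta><..} t *\<^sub>R (norm (f t))\<^sup>2)"
    unfolding L2_norm_sq using shift_integral[OF assms(2), of "\<lambda>t. (norm (f t))\<^sup>2"] .
  have "(L2_norm (\<lambda>t. f (t + \<delta>)))\<^sup>2 \<le> (L2_norm f)\<^sup>2"
    unfolding eq unfolding L2_norm_sq
  proof (rule integral_mono)
    show "integrable halfline (\<lambda>t. indicator {\<delta><..} t *\<^sub>R (norm (f t))\<^sup>2)"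
      using L2_integrable_sq[OF f] assms(2) by (intro integrable_mult_indicator greaterThan_sets_halfline)
  qed (use L2_integrable_sq[OF f] in \<open>auto simp: indicator_def\<close>)
  then show "L2_norm (\<lambda>t. f (t + \<delta>)) \<le> L2_norm f"
    by (rule power2_le_imp_le) simp
qed

lemma shift_tendsto_0:
  assumes f: "f \<in> L2"
  shows "(\<lambda>n. L2_norm (\<lambda>t. f (t + real n))) \<longlonglongrightarrow> 0"
proof -
  note [measurable] = L2_measurable[OF f]
  have "(\<lambda>n. LINT t|halfline. indicator {real n<..} t *\<^sub>R (norm (f t))\<^sup>2) \<longlonglongrightarrow> (LINT t|halfline. 0)"
  proof (rule integral_dominated_convergence[where w="\<lambda>t. (norm (f t))\<^sup>2"])
    show "AE t in halfline. (\<lambda>n. indicator {real n<..} t *\<^sub>R (norm (f t))\<^sup>2) \<longlonglongrightarrow> 0"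
    proof (rule AE_I2, rule tendsto_eventually)
      fix t
      show "\<forall>\<^sub>F n in sequentially. indicator {real n<..} t *\<^sub>R (norm (f t))\<^sup>2 = 0"
        using eventually_ge_at_top[of "nat \<lceil>t\<rceil>"] by eventually_elim (simp add: indicator_def; linarith)
    qed
    show "(\<lambda>t. indicator {real n<..} t *\<^sub>R (norm (f t))\<^sup>2) \<in> borel_measurable halfline" for n
      by (intro borel_measurable_scaleR borel_measurable_indicator greaterThan_sets_halfline) auto
  qed (use L2_integrable_sq[OF f] in \<open>auto simp: indicator_def\<close>)
  then have "(\<lambda>n. sqrt ((L2_norm (\<lambda>t. f (t + real n)))\<^sup>2)) \<longlonglongrightarrow> sqrt 0"
    using shift_L2(2)[OF f] by (intro tendsto_intros) simp
  then show ?thesis by simp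
qed

section \<open>The Laplace transform on the half-line\<close>

lemma exp_halfline:
  assumes "0 < x"
  shows "integrable halfline (\<lambda>t. exp (- (t * x)))" "(LINT t|halfline. exp (- (t * x))) = 1 / x"
proof -
  let ?F = "\<lambda>t. - exp (- (t * x)) / x"
  have d: "(?F has_real_derivative exp (- (t * x))) (at t)" for t
    using assms by (auto intro!: derivative_eq_intros)
  have "((\<lambda>t. exp (- (t * x))) \<longlongrightarrow> 0) at_top"
    using assms by (intro filterlim_compose[OF exp_at_bot] filterlim_compose[OF filterlim_uminus_at_bot_at_top]
        filterlim_at_top_mult_tendsto_pos[OF tendsto_const]) (auto intro: filterlim_ident)
  then have lim: "(?F \<longlongrightarrow> - 0 / x) at_top"
    using assms by (intro tendsto_intros) auto
  have "(\<integral>\<^sup>+ t. ennreal (exp (- (t * x))) \<partial>halfline) = (\<integral>\<^sup>+ t. ennreal (exp (- (t * x))) * indicator {0<..} t \<partial>lborel)"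
    by (subst nn_integral_restrict_space) auto
  also have "\<dots> = (\<integral>\<^sup>+ t. ennreal (exp (- (t * x))) * indicator {0..} t \<partial>lborel)"
    by (intro nn_integral_cong_AE, use AE_lborel_singleton[of 0] in eventually_elim)
       (auto simp: indicator_def)
  also have "\<dots> = ennreal (- 0 / x - ?F 0)"
    using d lim by (intro nn_integral_FTC_atLeast) auto
  finally have nn: "(\<integral>\<^sup>+ t. ennreal (exp (- (t * x))) \<partial>halfline) = ennreal (1 / x)" by simp
  have m: "(\<lambda>t. exp (- (t * x))) \<in> borel_measurable halfline"
    by (intro measurable_restrict_space1) measurable
  show "integrable halfline (\<lambda>t. exp (- (t * x)))"
    using nn m by (intro integrableI_bounded) auto
  show "(LINT t|halfline. exp (- (t * x))) = 1 / x"
    using nn m assms by (subst integral_eq_nn_integral) auto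
qed

lemma exp_L2:
  assumes "0 < x"
  shows "(\<lambda>t. of_real (exp (- (t * x) / 2))) \<in> L2" "L2_norm (\<lambda>t. of_real (exp (- (t * x) / 2))) = 1 / sqrt x"
proof -
  have sq: "(norm (of_real (exp (- (t * x) / 2)) :: complex))\<^sup>2 = exp (- (t * x))" for t
    by (simp add: power2_eq_square exp_add[symmetric])
  show "(\<lambda>t. of_real (exp (- (t * x) / 2))) \<in> L2"
    unfolding L2_def mem_Collect_eq sq
    by (intro conjI exp_halfline(1)[OF assms] measurable_restrict_space1) measurable
  show "L2_norm (\<lambda>t. of_real (exp (- (t * x) / 2))) = 1 / sqrt x"
    unfolding L2_norm_def sq exp_halfline(2)[OF assms] by (simp add: real_sqrt_divide)
qed

lemma laplace_integrable:
  assumes "f \<in> L2" "0 < x"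
  shows "integrable halfline (\<lambda>t. exp (- (t * x)) *\<^sub>R f t)"
  using L2_product_integrable[OF exp_L2(1)[of "2 * x"] assms(1)] assms(2)
  by (simp add: scaleR_conv_of_real field_simps)

text \<open>
  Splitting \<open>e\<^sup>-\<^sup>t\<^sup>x = e\<^sup>-\<^sup>t\<^sup>x\<^sup>/\<^sup>2 e\<^sup>-\<^sup>t\<^sup>x\<^sup>/\<^sup>2\<close>, one factor is at most \<open>e\<^sup>-\<^sup>a\<^sup>x\<^sup>/\<^sup>2\<close> on the support of \<open>g\<close>, and the other
  one has norm \<open>1 / \<surd>x\<close> in \<open>L\<^sup>2\<close>. For \<open>a = 0\<close> this is the bound valid for all of \<open>L\<^sup>2\<close>; the
  exponential gain for \<open>a > 0\<close> takes care of the growth of the measure at infinity.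
\<close>

lemma laplace_abs_bound:
  assumes g: "g \<in> L2" and a: "0 \<le> a" "\<And>t. 0 < t \<Longrightarrow> t < a \<Longrightarrow> g t = 0" and x: "0 < x"
  shows "(LINT t|halfline. norm (exp (- (t * x)) *\<^sub>R g t)) \<le> exp (- (a * x) / 2) * (L2_norm g / sqrt x)"
proof -
  have i: "integrable halfline (\<lambda>t. norm (of_real (exp (- (t * x) / 2)) :: complex) * norm (g t))"
    using integrable_norm[OF L2_product_integrable[OF exp_L2(1)[OF x] g]] by (simp add: norm_mult)
  have "(LINT t|halfline. norm (exp (- (t * x)) *\<^sub>R g t))
      \<le> (LINT t|halfline. exp (- (a * x) / 2) * (norm (of_real (exp (- (t * x) / 2)) :: complex) * norm (g t)))"
  proof (rule integral_mono)
    show "integrable halfline (\<lambda>t. norm (exp (- (t * x)) *\<^sub>R g t))"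
      by (intro integrable_norm laplace_integrable g x)
    show "integrable halfline (\<lambda>t. exp (- (a * x) / 2) * (norm (of_real (exp (- (t * x) / 2)) :: complex) * norm (g t)))"
      using i by (rule integrable_mult_right)
    fix t assume "t \<in> space halfline"
    then have t: "0 < t" by simp
    show "norm (exp (- (t * x)) *\<^sub>R g t)
      \<le> exp (- (a * x) / 2) * (norm (of_real (exp (- (t * x) / 2)) :: complex) * norm (g t))"
    proof (cases "t < a")
      case False
      have "exp (- (t * x)) = exp (- (t * x) / 2) * exp (- (t * x) / 2)"
        by (simp add: exp_add[symmetric])
      also have "\<dots> \<le> exp (- (a * x) / 2) * exp (- (t * x) / 2)"
        using False x by (intro mult_right_mono) auto
      finally show ?thesis
        by (simp add: mult.assoc[symmetric] mult_right_mono)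
    qed (use a t in simp)
  qed
  also have "\<dots> \<le> exp (- (a * x) / 2) * (1 / sqrt x * L2_norm g)"
    using L2_Cauchy_Schwarz[OF exp_L2(1)[OF x] g] exp_L2(2)[OF x]
    by (subst integral_mult_right_zero) (intro mult_left_mono; simp)
  finally show ?thesis by simp
qed

lemma laplace_bound_support:
  assumes "g \<in> L2" "0 \<le> a" "\<And>t. 0 < t \<Longrightarrow> t < a \<Longrightarrow> g t = 0" "0 < x"
  shows "norm (laplace g x) \<le> exp (- (a * x) / 2) * (L2_norm g / sqrt x)"
  unfolding laplace_def by (rule order_trans[OF integral_norm_bound laplace_abs_bound[OF assms]])

lemma laplace_bound: "g \<in> L2 \<Longrightarrow> 0 < x \<Longrightarrow> norm (laplace g x) \<le> L2_norm g / sqrt x"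
  using laplace_bound_support[of g 0 x] by simp

lemma laplace_bound_mult:
  assumes "g \<in> L2" "0 < x"
  shows "x * norm (laplace g x) \<le> L2_norm g * sqrt x"
proof -
  have "x * norm (laplace g x) \<le> x * (L2_norm g / sqrt x)"
    using assms by (intro mult_left_mono laplace_bound) auto
  also have "\<dots> = L2_norm g * (x / sqrt x)" by simp
  also have "x / sqrt x = sqrt x" using assms by (simp add: real_div_sqrt)
  finally show ?thesis .
qed

lemma laplace_diff:
  "f \<in> L2 \<Longrightarrow> g \<in> L2 \<Longrightarrow> 0 < x \<Longrightarrow> laplace (\<lambda>t. f t - g t) x = laplace f x - laplace g x"
  unfolding laplace_def scaleR_diff_right by (intro Bochner_Integration.integral_diff laplace_integrable)

lemma laplace_cnj: "laplace (\<lambda>t. cnj (f t)) x = cnj (laplace f x)"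
  unfolding laplace_def by (subst Bochner_Integration.integral_cnj[symmetric]) (simp add: complex_cnj_scaleR)

lemma laplace_shift:
  assumes "0 \<le> \<delta>" "\<And>t. t \<le> 0 \<Longrightarrow> \<phi> t = 0"
  shows "laplace (\<lambda>t. \<phi> (t - \<delta>)) x = exp (- (\<delta> * x)) *\<^sub>R laplace \<phi> x"
proof -
  let ?k = "\<lambda>t. exp (- (t * x)) *\<^sub>R \<phi> (t - \<delta>)"
  have "laplace (\<lambda>t. \<phi> (t - \<delta>)) x = (LINT t|halfline. indicator {\<delta><..} t *\<^sub>R ?k t)"
    unfolding laplace_def
  proof (intro Bochner_Integration.integral_cong refl)
    fix t show "?k t = indicator {\<delta><..} t *\<^sub>R ?k t"
      using assms(2)[of "t - \<delta>"] by (cases "\<delta> < t") auto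
  qed
  also have "\<dots> = (LINT t|halfline. ?k (t + \<delta>))"
    by (rule shift_integral[symmetric]) fact
  also have "\<dots> = (LINT t|halfline. exp (- (\<delta> * x)) *\<^sub>R (exp (- (t * x)) *\<^sub>R \<phi> t))"
    by (intro Bochner_Integration.integral_cong) (auto simp: exp_add[symmetric] algebra_simps)
  finally show ?thesis unfolding laplace_def by (simp only: integral_scaleR_right)
qed

lemma C_comp_L2:
  assumes "\<phi> \<in> C_comp"
  shows "\<phi> \<in> L2"
proof -
  obtain a b where ab: "0 < a" "a < b" "\<And>t. t < a \<or> b < t \<Longrightarrow> \<phi> t = 0" "smooth \<phi>"
    using assms unfolding C_comp_iff by blast
  have c: "continuous_on UNIV \<phi>" by (rule smooth_continuous) fact
  have "integrable lborel (\<lambda>t. complex_of_real ((norm (\<phi> t))\<^sup>2))"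
    using ab(3) by (intro continuous_compact_support_integrable[of _ a b] continuous_intros c) auto
  then have "integrable lborel (\<lambda>t. (norm (\<phi> t))\<^sup>2)"
    by (simp only: complex_of_real_integrable_eq)
  then have "integrable lborel (\<lambda>t. indicator {0<..} t *\<^sub>R (norm (\<phi> t))\<^sup>2)"
    by (intro integrable_mult_indicator) auto
  then have "integrable halfline (\<lambda>t. (norm (\<phi> t))\<^sup>2)"
    by (subst integrable_restrict_space) auto
  moreover have "\<phi> \<in> borel_measurable halfline"
    using borel_measurable_continuous_onI[OF c] by (intro measurable_restrict_space1) simp
  ultimately show ?thesis by (simp add: L2_def)
qed

lemma laplace_derivative:
  assumes \<psi>: "\<psi> \<in> C_comp" and d: "\<And>t. (\<psi> has_vector_derivative \<phi> t) (at t)" and x: "0 < x"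
  shows "laplace \<phi> x = x *\<^sub>R laplace \<psi> x"
proof -
  obtain a b where ab: "0 < a" "a < b" "\<And>t. t < a \<or> b < t \<Longrightarrow> \<psi> t = 0" "smooth \<psi>"
    using \<psi> unfolding C_comp_iff by blast
  have eq: "\<phi> = (\<lambda>t. vector_derivative \<psi> (at t))"
    using vector_derivative_at[OF d] by simp
  have \<phi>: "\<phi> \<in> C_comp" unfolding eq by (rule C_comp_derivative(1)[OF \<psi>])
  have c: "continuous_on UNIV \<phi>" "continuous_on UNIV \<psi>"
    using \<phi> \<psi> by (auto simp: C_comp_iff intro: smooth_continuous)
  let ?k = "\<lambda>t. exp (- (t * x)) *\<^sub>R \<psi> t"
  let ?k' = "\<lambda>t. exp (- (t * x)) *\<^sub>R \<phi> t - x *\<^sub>R (exp (- (t * x)) *\<^sub>R \<psi> t)"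
  have dk: "(?k has_vector_derivative ?k' t) (at t)" for t
  proof -
    have "((\<lambda>t. exp (- (t * x))) has_vector_derivative - x * exp (- (t * x))) (at t)"
      unfolding has_real_derivative_iff_has_vector_derivative[symmetric]
      by (auto intro!: derivative_eq_intros)
    from has_vector_derivative_scaleR[OF this[folded has_real_derivative_iff_has_vector_derivative] d]
    show ?thesis by (simp add: mult.commute)
  qed
  have "(LINT t|halfline. ?k' t) = 0"
  proof (rule integral_derivative_compact_support[OF dk _ ab(1,2)])
    show "continuous_on UNIV ?k'" using c by (intro continuous_intros)
  qed (use ab(3) in auto)
  moreover have "(LINT t|halfline. ?k' t) = laplace \<phi> x - x *\<^sub>R laplace \<psi> x"
    unfolding laplace_def using laplace_integrable[OF C_comp_L2[OF \<phi>] x] laplace_integrable[OF C_comp_L2[OF \<psi>] x]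
    by (subst Bochner_Integration.integral_diff) (auto simp del: scaleR_scaleR)
  ultimately show ?thesis by simp
qed

lemma sigma_finite_halfline: "sigma_finite_measure halfline"
  by (rule sigma_finite_measure_restrict_space) (auto intro: lborel.sigma_finite_measure_axioms)

lemma mult_exp_le: "x * exp (- (d * x)) \<le> 1 / d" if "0 < d" for d x :: real
proof -
  have "d * x \<le> exp (d * x)" using exp_ge_add_one_self[of "d * x"] by linarith
  then show ?thesis using that by (simp add: exp_minus field_simps)
qed

lemma sqrt_exp_le: "sqrt x * exp (- (d * x)) \<le> 1 + 1 / d" if "0 < d" "0 < x" for d x :: real
proof -
  have "sqrt x \<le> 1 + x"
    using that by (intro real_le_lsqrt) (auto simp: power2_sum)
  then have "sqrt x * exp (- (d * x)) \<le> (1 + x) * exp (- (d * x))"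
    by (intro mult_right_mono) auto
  also have "\<dots> \<le> 1 + 1 / d"
    using mult_exp_le[OF that(1), of x] that by (simp add: distrib_right add_mono)
  finally show ?thesis .
qed

text \<open>
  The measures on the open half-line whose Laplace transform is finite. Working with a measure whose
  space is the open half-line makes positivity of the spectral variable \<open>x\<close> available everywhere.
\<close>

locale laplace_measure =
  fixes \<kappa> :: "real measure"
  assumes sets_\<kappa>: "sets \<kappa> = sets (restrict_space borel {0<..})"
    and exp_integrable: "0 < t \<Longrightarrow> integrable \<kappa> (\<lambda>x. exp (- (t * x)))"
begin

lemma space_\<kappa> [simp]: "space \<kappa> = {0<..}"
  using sets_eq_imp_space_eq[OF sets_\<kappa>] by (simp add: space_restrict_space)

lemma measurable_\<kappa>: "f \<in> borel \<rightarrow>\<^sub>M N \<Longrightarrow> f \<in> \<kappa> \<rightarrow>\<^sub>M N"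
  by (simp add: measurable_cong_sets[OF sets_\<kappa> refl] measurable_restrict_space1)

lemma sigma_finite_\<kappa>: "sigma_finite_measure \<kappa>"
proof
  have "emeasure \<kappa> {0<..real n} \<noteq> \<infinity>" for n
  proof -
    have s: "{0<..real n} \<in> sets \<kappa>"
      by (auto simp: sets_\<kappa> sets_restrict_space intro!: image_eqI[of _ _ "{0<..real n}"])
    have "emeasure \<kappa> {0<..real n} = (\<integral>\<^sup>+ x. indicator {0<..real n} x \<partial>\<kappa>)"
      using s by simp
    also have "\<dots> \<le> (\<integral>\<^sup>+ x. ennreal (exp (real n)) * ennreal (norm (exp (- (1 * x)))) \<partial>\<kappa>)"
      by (intro nn_integral_mono) (auto simp: indicator_def ennreal_mult[symmetric] exp_add[symmetric])
    also have "\<dots> = ennreal (exp (real n)) * (\<integral>\<^sup>+ x. ennreal (norm (exp (- (1 * x)))) \<partial>\<kappa>)"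
      by (intro nn_integral_cmult measurable_\<kappa>) measurable
    also have "\<dots> < \<infinity>"
      using exp_integrable[of 1] by (auto simp: integrable_iff_bounded ennreal_mult_less_top)
    finally show ?thesis by simp
  qed
  then show "\<exists>A. countable A \<and> A \<subseteq> sets \<kappa> \<and> \<Union> A = space \<kappa> \<and> (\<forall>a\<in>A. emeasure \<kappa> a \<noteq> \<infinity>)"
    by (intro exI[of _ "range (\<lambda>n. {0<..real n})"])
       (auto simp: sets_\<kappa> sets_restrict_space real_arch_simple intro!: image_eqI)
qed

sublocale P: pair_sigma_finite \<kappa> halfline
  by (intro pair_sigma_finite.intro sigma_finite_\<kappa> sigma_finite_halfline)

lemma kernel_measurable:
  "(\<lambda>p. exp (- (snd p * fst p))) \<in> borel_measurable (\<kappa> \<Otimes>\<^sub>M halfline)"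
proof -
  have [measurable]: "fst \<in> borel_measurable (\<kappa> \<Otimes>\<^sub>M halfline)"
    by (rule measurable_compose[OF measurable_fst measurable_\<kappa>]) simp
  have [measurable]: "snd \<in> borel_measurable (\<kappa> \<Otimes>\<^sub>M halfline)"
    by (rule measurable_compose[OF measurable_snd]) (rule measurable_restrict_space1, simp)
  show ?thesis by measurable
qed

lemma laplace_measurable:
  assumes "f \<in> borel_measurable halfline"
  shows "laplace f \<in> borel_measurable \<kappa>"
proof -
  have "(\<lambda>p. exp (- (snd p * fst p)) *\<^sub>R f (snd p)) \<in> borel_measurable (\<kappa> \<Otimes>\<^sub>M halfline)"
    by (intro borel_measurable_scaleR kernel_measurable measurable_compose[OF measurable_snd] assms)
  then have "(\<lambda>x. LINT t|halfline. exp (- (t * x)) *\<^sub>R f t) \<in> borel_measurable \<kappa>"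
    by (intro P.M2.borel_measurable_lebesgue_integral) (simp add: case_prod_beta')
  then show ?thesis by (simp add: laplace_def[abs_def])
qed

text \<open>
  The Laplace transform is formally symmetric: superpositions of exponentials in \<open>t\<close> are paired with
  \<open>g\<close> by pairing the amplitude \<open>u\<close> with \<open>Lg\<close>. The hypothesis on \<open>u\<close> is exactly what makes the
  double integral converge absolutely in view of \<open>laplace_abs_bound\<close>, which contributes
  \<open>e\<^sup>-\<^sup>a\<^sup>x\<^sup>/\<^sup>2 / \<surd>x\<close> if \<open>g\<close> vanishes on \<open>(0, a)\<close>.
\<close>

lemma laplace_Fubini:
  assumes u: "u \<in> borel_measurable \<kappa>" and g: "g \<in> L2"
    and a: "0 \<le> a" "\<And>t. 0 < t \<Longrightarrow> t < a \<Longrightarrow> g t = 0" and c: "0 < c"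
    and bound: "\<And>x. 0 < x \<Longrightarrow> norm (u x) * exp (- (a * x) / 2) \<le> C * (sqrt x * exp (- (c * x)))"
  shows "(LINT t|halfline. (LINT x|\<kappa>. exp (- (t * x)) *\<^sub>R u x) * g t) = (LINT x|\<kappa>. u x * laplace g x)"
    and "integrable halfline (\<lambda>t. (LINT x|\<kappa>. exp (- (t * x)) *\<^sub>R u x) * g t)"
proof -
  let ?f = "\<lambda>x t. (exp (- (t * x)) *\<^sub>R u x) * g t"
  have m: "(\<lambda>(x, t). ?f x t) \<in> borel_measurable (\<kappa> \<Otimes>\<^sub>M halfline)"
    unfolding case_prod_beta'
    by (intro borel_measurable_scaleR borel_measurable_times kernel_measurable
        measurable_compose[OF measurable_snd L2_measurable[OF g]] measurable_compose[OF measurable_fst u])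
  have f_eq: "?f x t = u x * (exp (- (t * x)) *\<^sub>R g t)" for x t by simp
  have inner: "(LINT t|halfline. norm (?f x t)) \<le> C * L2_norm g * exp (- (c * x))" if x: "0 < x" for x
  proof -
    have "(LINT t|halfline. norm (?f x t)) = norm (u x) * (LINT t|halfline. norm (exp (- (t * x)) *\<^sub>R g t))"
      unfolding f_eq norm_mult[of "u x"] by (rule integral_mult_right_zero)
    also have "\<dots> \<le> norm (u x) * (exp (- (a * x) / 2) * (L2_norm g / sqrt x))"
      using laplace_abs_bound[OF g a x] by (intro mult_left_mono) auto
    also have "\<dots> = (norm (u x) * exp (- (a * x) / 2)) * (L2_norm g / sqrt x)" by simp
    also have "\<dots> \<le> (C * (sqrt x * exp (- (c * x)))) * (L2_norm g / sqrt x)"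
      using bound[OF x] x by (intro mult_right_mono) auto
    also have "\<dots> = C * L2_norm g * exp (- (c * x))" using x by simp
    finally show ?thesis .
  qed
  have i: "integrable (\<kappa> \<Otimes>\<^sub>M halfline) (\<lambda>(x, t). ?f x t)"
  proof (rule P.Fubini_integrable[OF m])
    have "(\<lambda>x. LINT t|halfline. norm (case (x, t) of (x, t) \<Rightarrow> ?f x t)) \<in> borel_measurable \<kappa>"
    proof -
      show ?thesis
        using measurable_compose[OF m borel_measurable_norm]
        by (intro P.M2.borel_measurable_lebesgue_integral) (simp only: case_prod_beta' fst_conv snd_conv)
    qed
    then show "integrable \<kappa> (\<lambda>x. LINT t|halfline. norm (case (x, t) of (x, t) \<Rightarrow> ?f x t))"
    proof (rule Bochner_Integration.integrable_bound[rotated])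
      show "integrable \<kappa> (\<lambda>x. C * L2_norm g * exp (- (c * x)))"
        using exp_integrable[OF c] by (rule integrable_mult_right)
      show "AE x in \<kappa>. norm (LINT t|halfline. norm (case (x, t) of (x, t) \<Rightarrow> ?f x t))
          \<le> norm (C * L2_norm g * exp (- (c * x)))"
      proof (rule AE_I2)
        fix x assume "x \<in> space \<kappa>"
        then have "(LINT t|halfline. norm (?f x t)) \<le> C * L2_norm g * exp (- (c * x))"
          using inner by simp
        moreover have "0 \<le> (LINT t|halfline. norm (?f x t))" by (rule integral_nonneg_AE) simp
        ultimately show "norm (LINT t|halfline. norm (case (x, t) of (x, t) \<Rightarrow> ?f x t))
          \<le> norm (C * L2_norm g * exp (- (c * x)))" unfolding prod.case real_norm_def by linarith
      qed
    qed
    show "AE x in \<kappa>. integrable halfline (\<lambda>t. case (x, t) of (x, t) \<Rightarrow> ?f x t)"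
    proof (rule AE_I2)
      fix x assume "x \<in> space \<kappa>"
      then have "integrable halfline (\<lambda>t. u x * (exp (- (t * x)) *\<^sub>R g t))"
        using laplace_integrable[OF g] by (intro integrable_mult_right) simp
      then show "integrable halfline (\<lambda>t. case (x, t) of (x, t) \<Rightarrow> ?f x t)"
        unfolding prod.case f_eq .
    qed
  qed
  show "integrable halfline (\<lambda>t. (LINT x|\<kappa>. exp (- (t * x)) *\<^sub>R u x) * g t)"
    using P.integrable_snd[OF i] by (simp only: integral_mult_left_zero)
  from P.Fubini_integral[OF i]
  have "(LINT t|halfline. (LINT x|\<kappa>. ?f x t)) = (LINT x|\<kappa>. (LINT t|halfline. ?f x t))" .
  also have "(LINT t|halfline. (LINT x|\<kappa>. ?f x t)) = (LINT t|halfline. (LINT x|\<kappa>. exp (- (t * x)) *\<^sub>R u x) * g t)"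
    by (simp only: integral_mult_left_zero)
  also have "(LINT x|\<kappa>. (LINT t|halfline. ?f x t)) = (LINT x|\<kappa>. u x * laplace g x)"
    unfolding f_eq laplace_def by (simp only: integral_mult_right_zero)
  finally show "(LINT t|halfline. (LINT x|\<kappa>. exp (- (t * x)) *\<^sub>R u x) * g t) = (LINT x|\<kappa>. u x * laplace g x)" .
qed

lemma sqrt_exp_integrable:
  assumes "0 < t"
  shows "integrable \<kappa> (\<lambda>x. sqrt x * exp (- (t * x)))"
proof (rule Bochner_Integration.integrable_bound)
  show "integrable \<kappa> (\<lambda>x. (1 + 2 / t) * exp (- (t / 2 * x)))"
    using exp_integrable[of "t / 2"] assms by simp
  show "(\<lambda>x. sqrt x * exp (- (t * x))) \<in> borel_measurable \<kappa>"
    by (rule measurable_\<kappa>) measurable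
  show "AE x in \<kappa>. norm (sqrt x * exp (- (t * x))) \<le> norm ((1 + 2 / t) * exp (- (t / 2 * x)))"
  proof (rule AE_I2)
    fix x assume "x \<in> space \<kappa>"
    then have x: "0 < x" by simp
    have "sqrt x * exp (- (t * x)) = sqrt x * exp (- (t / 2 * x)) * exp (- (t / 2 * x))"
      by (simp add: exp_add[symmetric])
    also have "\<dots> \<le> (1 + 1 / (t / 2)) * exp (- (t / 2 * x))"
      using assms x by (intro mult_right_mono sqrt_exp_le) auto
    finally show "norm (sqrt x * exp (- (t * x))) \<le> norm ((1 + 2 / t) * exp (- (t / 2 * x)))"
      using assms x by (simp add: abs_mult)
  qed
qed

text \<open>
  Amplitudes of size \<open>O(\<surd>x)\<close> are the ones that occur below, as \<open>|x Lf(x)| \<le> \<parallel>f\<parallel> \<surd>x\<close>. The following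
  function of \<open>t\<close> dominates the corresponding superpositions of exponentials; it decreases in \<open>t\<close>,
  which yields bounds that are uniform away from \<open>0\<close>.
\<close>

definition root_moment :: "real \<Rightarrow> real" where
  "root_moment t = (LINT x|\<kappa>. sqrt x * exp (- (t * x)))"

lemma root_moment_antimono:
  assumes "0 < s" "s \<le> t"
  shows "root_moment t \<le> root_moment s"
  unfolding root_moment_def
  using assms by (intro integral_mono sqrt_exp_integrable) (auto intro!: mult_left_mono mult_right_mono)

context
  fixes u :: "real \<Rightarrow> complex" and C :: real
  assumes u: "u \<in> borel_measurable \<kappa>" and bound: "\<And>x. 0 < x \<Longrightarrow> norm (u x) \<le> C * sqrt x"
begin

lemma superposition_integrable:
  assumes "0 < t"
  shows "integrable \<kappa> (\<lambda>x. exp (- (t * x)) *\<^sub>R u x)"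
    and "norm (LINT x|\<kappa>. exp (- (t * x)) *\<^sub>R u x) \<le> C * root_moment t"
proof -
  have le: "norm (exp (- (t * x)) *\<^sub>R u x) \<le> C * (sqrt x * exp (- (t * x)))" if "0 < x" for x
    using mult_right_mono[OF bound[OF that], of "exp (- (t * x))"] by (simp add: mult_ac)
  have i: "integrable \<kappa> (\<lambda>x. C * (sqrt x * exp (- (t * x))))"
    using sqrt_exp_integrable[OF assms] by (rule integrable_mult_right)
  show "integrable \<kappa> (\<lambda>x. exp (- (t * x)) *\<^sub>R u x)"
  proof (rule Bochner_Integration.integrable_bound[OF i])
    show "(\<lambda>x. exp (- (t * x)) *\<^sub>R u x) \<in> borel_measurable \<kappa>"
      by (intro borel_measurable_scaleR u measurable_\<kappa>) measurable
    show "AE x in \<kappa>. norm (exp (- (t * x)) *\<^sub>R u x) \<le> norm (C * (sqrt x * exp (- (t * x))))"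
      using le by (intro AE_I2) (auto intro: order_trans[OF _ abs_ge_self])
  qed
  then have "norm (LINT x|\<kappa>. exp (- (t * x)) *\<^sub>R u x) \<le> (LINT x|\<kappa>. C * (sqrt x * exp (- (t * x))))"
    using i le by (intro order_trans[OF integral_norm_bound] integral_mono integrable_norm) auto
  also have "\<dots> = C * root_moment t"
    unfolding root_moment_def by (rule integral_mult_right_zero)
  finally show "norm (LINT x|\<kappa>. exp (- (t * x)) *\<^sub>R u x) \<le> C * root_moment t" .
qed

lemma superposition_measurable:
  "(\<lambda>t. LINT x|\<kappa>. exp (- (t * x)) *\<^sub>R u x) \<in> borel_measurable halfline"
proof -
  have "(\<lambda>p. exp (- (snd p * fst p)) *\<^sub>R u (fst p)) \<in> borel_measurable (\<kappa> \<Otimes>\<^sub>M halfline)"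
    by (intro borel_measurable_scaleR kernel_measurable measurable_compose[OF measurable_fst] u)
  from measurable_compose[OF measurable_pair_swap' this]
  have "(\<lambda>(t, x). exp (- (t * x)) *\<^sub>R u x) \<in> borel_measurable (halfline \<Otimes>\<^sub>M \<kappa>)"
    by (simp add: case_prod_beta')
  then show ?thesis
    by (rule P.M1.borel_measurable_lebesgue_integral)
qed

lemma superposition_locally_integrable:
  "locally_integrable (\<lambda>t. LINT x|\<kappa>. exp (- (t * x)) *\<^sub>R u x)"
  unfolding locally_integrable_def set_integrable_def
proof (intro allI impI)
  fix a b :: real assume a: "0 < a"
  let ?p = "\<lambda>t. LINT x|\<kappa>. exp (- (t * x)) *\<^sub>R u x"
  have "(\<lambda>t. indicator {0<..} t *\<^sub>R ?p t) \<in> borel_measurable lborel"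
    using superposition_measurable by (subst (asm) borel_measurable_restrict_space_iff) auto
  then have m: "(\<lambda>t. indicator {a..b} t *\<^sub>R (indicator {0<..} t *\<^sub>R ?p t)) \<in> borel_measurable lborel"
    by measurable
  have eq: "indicator {a..b} t *\<^sub>R (indicator {0<..} t *\<^sub>R ?p t) = indicator {a..b} t *\<^sub>R ?p t" for t
    using a by (auto simp: indicator_def)
  have C: "0 \<le> C" using order_trans[OF norm_ge_zero bound[of 1]] by simp
  show "integrable lborel (\<lambda>t. indicator {a..b} t *\<^sub>R ?p t)"
  proof (rule Bochner_Integration.integrable_bound)
    show "integrable lborel (\<lambda>t. indicator {a..b} t *\<^sub>R (C * root_moment a))"
      by (intro borel_integrable_compact) auto
    show "(\<lambda>t. indicator {a..b} t *\<^sub>R ?p t) \<in> borel_measurable lborel"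
      using m unfolding eq .
    show "AE t in lborel. norm (indicator {a..b} t *\<^sub>R ?p t) \<le> norm (indicator {a..b} t *\<^sub>R (C * root_moment a))"
    proof (rule AE_I2)
      fix t
      show "norm (indicator {a..b} t *\<^sub>R ?p t) \<le> norm (indicator {a..b} t *\<^sub>R (C * root_moment a))"
      proof (cases "t \<in> {a..b}")
        case True
        then have "norm (?p t) \<le> C * root_moment t"
          using a superposition_integrable(2) by simp
        also have "\<dots> \<le> C * root_moment a"
          using True a C by (intro mult_left_mono root_moment_antimono) auto
        finally show ?thesis using True by simp
      qed simp
    qed
  qed
qed

end

end

section \<open>The weak form of the Hankel equation\<close>

lemma AE_halfline_shift:
  assumes "AE t in halfline. P t" "0 \<le> \<delta>"
  shows "AE t in halfline. P (t + \<delta>)"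
proof -
  have "AE t in distr lborel borel ((+) \<delta>). t > 0 \<longrightarrow> P t"
    using assms(1) by (simp only: AE_halfline_iff lborel_distr_plus)
  then have "AE t in lborel. \<delta> + t > 0 \<longrightarrow> P (\<delta> + t)"
    by (rule AE_distrD[rotated]) simp
  then show ?thesis
    unfolding AE_halfline_iff by eventually_elim (use assms(2) in \<open>auto simp: add.commute\<close>)
qed

lemma L2_locally_integrable:
  assumes "G \<in> L2"
  shows "locally_integrable G"
  unfolding locally_integrable_def set_integrable_def
proof (intro allI impI)
  fix a b :: real assume a: "0 < a"
  have "integrable lborel (\<lambda>t. indicator {0<..} t *\<^sub>R (indicator {a..b} t * G t))"
    using L2_product_integrable[OF indicator_L2 assms] by (subst (asm) integrable_restrict_space) auto
  also have "(\<lambda>t. indicator {0<..} t *\<^sub>R (indicator {a..b} t * G t)) = (\<lambda>t. indicator {a..b} t *\<^sub>R G t)"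
    using a by (auto simp: fun_eq_iff indicator_def)
  finally show "integrable lborel (\<lambda>t. indicator {a..b} t *\<^sub>R G t)" .
qed

lemma locally_integrable_diff:
  "locally_integrable f \<Longrightarrow> locally_integrable g \<Longrightarrow> locally_integrable (\<lambda>t. f t - g t)"
  unfolding locally_integrable_def by (auto intro: set_integral_diff(1))

context laplace_measure
begin

text \<open>
  The equation \<open>\<Gamma>f = G\<close>, tested only against derivatives of test functions. The pairing is bilinear
  rather than sesquilinear, as in the definition of distributional derivatives.
\<close>

definition weak_image :: "(real \<Rightarrow> complex) \<Rightarrow> (real \<Rightarrow> complex) \<Rightarrow> bool" where
  "weak_image f G \<longleftrightarrow> f \<in> L2 \<and> G \<in> L2 \<and>
     (\<forall>\<psi>\<in>C_comp. (LINT t|halfline. G t * vector_derivative \<psi> (at t))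
        = (LINT x|\<kappa>. laplace f x * laplace (\<lambda>t. vector_derivative \<psi> (at t)) x))"

text \<open>
  The left-hand side is the pairing of \<open>-F\<close> with a test function. This is where distributional
  derivatives become a statement about Laplace transforms.
\<close>

lemma moment_pairing:
  assumes f: "f \<in> L2" and \<psi>: "\<psi> \<in> C_comp"
  shows "(LINT t|halfline. (LINT x|\<kappa>. exp (- (t * x)) *\<^sub>R (x *\<^sub>R laplace f x)) * \<psi> t)
    = (LINT x|\<kappa>. laplace f x * laplace (\<lambda>t. vector_derivative \<psi> (at t)) x)"
proof -
  obtain a b where ab: "0 < a" "a < b" "\<And>t. t < a \<Longrightarrow> \<psi> t = 0" "\<And>t. b < t \<Longrightarrow> \<psi> t = 0" "smooth \<psi>"
    using \<psi> by (rule C_compE) blast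
  have "(LINT t|halfline. (LINT x|\<kappa>. exp (- (t * x)) *\<^sub>R (x *\<^sub>R laplace f x)) * \<psi> t)
      = (LINT x|\<kappa>. (x *\<^sub>R laplace f x) * laplace \<psi> x)"
  proof (rule laplace_Fubini(1)[where a=a and c="a/2" and C="L2_norm f"])
    show "(\<lambda>x. x *\<^sub>R laplace f x) \<in> borel_measurable \<kappa>"
      by (intro borel_measurable_scaleR laplace_measurable L2_measurable f measurable_\<kappa>) simp
    fix x :: real assume x: "0 < x"
    then show "norm (x *\<^sub>R laplace f x) * exp (- (a * x) / 2) \<le> L2_norm f * (sqrt x * exp (- (a / 2 * x)))"
      using mult_right_mono[OF laplace_bound_mult[OF f x], of "exp (- (a * x) / 2)"] by (simp add: mult_ac)
  qed (use ab C_comp_L2[OF \<psi>] in auto)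
  also have "\<dots> = (LINT x|\<kappa>. laplace f x * laplace (\<lambda>t. vector_derivative \<psi> (at t)) x)"
    by (intro Bochner_Integration.integral_cong)
       (auto simp: laplace_derivative[OF \<psi> C_comp_derivative(2)[OF \<psi>]])
  finally show ?thesis .
qed

lemma difference_multiplier_bound:
  assumes f: "f \<in> L2" and "0 \<le> \<delta>" "0 < x"
  shows "norm ((1 - exp (- (\<delta> * x))) *\<^sub>R laplace f x) \<le> \<delta> * L2_norm f * sqrt x"
proof -
  have "1 - exp (- (\<delta> * x)) \<le> \<delta> * x" using exp_ge_add_one_self[of "- (\<delta> * x)"] by linarith
  moreover have "0 \<le> 1 - exp (- (\<delta> * x))" using assms by simp
  ultimately have "norm ((1 - exp (- (\<delta> * x))) *\<^sub>R laplace f x) \<le> \<delta> * x * norm (laplace f x)"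
    by (simp add: mult_right_mono)
  also have "\<dots> \<le> \<delta> * (L2_norm f * sqrt x)"
    unfolding mult.assoc using assms by (intro mult_left_mono laplace_bound_mult) auto
  finally show ?thesis by simp
qed

lemma difference_multiplier_measurable:
  "f \<in> L2 \<Longrightarrow> (\<lambda>x. (1 - exp (- (\<delta> * x))) *\<^sub>R laplace f x) \<in> borel_measurable \<kappa>"
  by (intro borel_measurable_scaleR laplace_measurable L2_measurable measurable_\<kappa>) measurable

text \<open>
  With \<open>\<Phi>' = \<phi>\<close>, the function \<open>\<psi>(t) = \<Phi>(t) - \<Phi>(t - \<delta>)\<close> is a test function for every test function
  \<open>\<phi>\<close>, whatever its mean, and \<open>L(\<psi>') = (1 - e\<^sup>-\<^sup>\<delta>\<^sup>x) L\<phi>\<close>. Carrying the translation over to \<open>G\<close> leaves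
  an identity tested against arbitrary \<open>\<phi>\<close>, to which the fundamental lemma applies.
\<close>

lemma weak_image_difference:
  assumes W: "weak_image f G" and \<delta>: "0 < \<delta>"
  shows "AE t in halfline. G t - G (t + \<delta>)
    = (LINT x|\<kappa>. exp (- (t * x)) *\<^sub>R ((1 - exp (- (\<delta> * x))) *\<^sub>R laplace f x))"
proof -
  have f: "f \<in> L2" and G: "G \<in> L2" using W by (auto simp: weak_image_def)
  have G': "(\<lambda>t. G (t + \<delta>)) \<in> L2" using \<delta> by (intro shift_L2(1) G) simp
  define u where "u = (\<lambda>x. (1 - exp (- (\<delta> * x))) *\<^sub>R laplace f x)"
  define p where "p t = (LINT x|\<kappa>. exp (- (t * x)) *\<^sub>R u x)" for t
  have um: "u \<in> borel_measurable \<kappa>" unfolding u_def by (rule difference_multiplier_measurable[OF f])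
  have ub: "norm (u x) \<le> \<delta> * L2_norm f * sqrt x" if "0 < x" for x
    unfolding u_def using \<delta> that by (intro difference_multiplier_bound f) auto
  have "AE t in halfline. (G t - G (t + \<delta>)) - p t = 0"
  proof (rule fundamental_lemma)
    show "locally_integrable (\<lambda>t. G t - G (t + \<delta>) - p t)"
      unfolding p_def
      by (intro locally_integrable_diff L2_locally_integrable G G' superposition_locally_integrable[OF um ub])
    fix \<phi> assume \<phi>: "\<phi> \<in> C_comp"
    then obtain a b where ab: "0 < a" "a < b" "\<And>t. t < a \<or> b < t \<Longrightarrow> \<phi> t = 0" and s: "smooth \<phi>"
      unfolding C_comp_iff by blast
    obtain \<Phi> where \<Phi>: "smooth \<Phi>" "\<And>t. (\<Phi> has_vector_derivative \<phi> t) (at t)"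
      "\<And>t. t < a \<Longrightarrow> \<Phi> t = 0" "\<And>t. b < t \<Longrightarrow> \<Phi> t = (LINT s|halfline. \<phi> s)"
      using antiderivative_of_test_function[OF s ab] by metis
    let ?\<phi>\<delta> = "\<lambda>t. \<phi> (t - \<delta>)"
    define \<psi> where "\<psi> t = \<Phi> t - \<Phi> (t - \<delta>)" for t
    have "smooth (\<lambda>t. \<Phi> t + (-1) * \<Phi> (1 * t + - \<delta>))"
      by (intro smooth_add smooth_mult smooth_const smooth_affine \<Phi>(1))
    then have "smooth \<psi>" by (simp add: \<psi>_def[abs_def])
    then have \<psi>: "\<psi> \<in> C_comp"
      using \<Phi>(3,4) \<delta> ab by (intro C_compI[of \<psi> a "b + \<delta>"]) (auto simp: \<psi>_def)
    have "smooth (\<lambda>t. \<phi> (1 * t + - \<delta>))" by (intro smooth_affine s)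
    then have \<phi>\<delta>: "?\<phi>\<delta> \<in> C_comp"
      using ab \<delta> by (intro C_compI[of _ "a + \<delta>" "b + \<delta>"]) auto
    have d: "(\<psi> has_vector_derivative \<phi> t - ?\<phi>\<delta> t) (at t)" for t
    proof -
      have "((\<lambda>t. t - \<delta>) has_vector_derivative 1) (at t)"
        by (auto intro!: derivative_eq_intros)
      from vector_diff_chain_at[OF this \<Phi>(2)[of "t - \<delta>"]]
      have "((\<lambda>t. \<Phi> (t - \<delta>)) has_vector_derivative \<phi> (t - \<delta>)) (at t)" by (simp add: o_def)
      with \<Phi>(2) show ?thesis
        unfolding \<psi>_def[abs_def] by (intro has_vector_derivative_diff)
    qed
    have \<psi>': "vector_derivative \<psi> (at t) = \<phi> t - ?\<phi>\<delta> t" for t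
      using vector_derivative_at[OF d] .
    note L2\<phi> = C_comp_L2[OF \<phi>] C_comp_L2[OF \<phi>\<delta>]
    have "(LINT t|halfline. (G t - G (t + \<delta>)) * \<phi> t)
        = (LINT t|halfline. G t * \<phi> t) - (LINT t|halfline. G (t + \<delta>) * \<phi> (t + \<delta> - \<delta>))"
      unfolding left_diff_distrib
      by (subst Bochner_Integration.integral_diff) (auto intro: L2_product_integrable G G' L2\<phi>)
    also have "(LINT t|halfline. G (t + \<delta>) * \<phi> (t + \<delta> - \<delta>))
        = (LINT t|halfline. indicator {\<delta><..} t *\<^sub>R (G t * ?\<phi>\<delta> t))"
      using \<delta> by (intro shift_integral) simp
    also have "\<dots> = (LINT t|halfline. G t * ?\<phi>\<delta> t)"
      using ab by (intro Bochner_Integration.integral_cong) (auto simp: indicator_def)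
    also have "(LINT t|halfline. G t * \<phi> t) - \<dots> = (LINT t|halfline. G t * (\<phi> t - ?\<phi>\<delta> t))"
      unfolding right_diff_distrib
      by (subst Bochner_Integration.integral_diff) (auto intro: L2_product_integrable G L2\<phi>)
    also have "\<dots> = (LINT x|\<kappa>. laplace f x * laplace (\<lambda>t. \<phi> t - ?\<phi>\<delta> t) x)"
      using W \<psi> unfolding weak_image_def by (simp only: \<psi>'[symmetric])
    also have "\<dots> = (LINT x|\<kappa>. u x * laplace \<phi> x)"
    proof (intro Bochner_Integration.integral_cong refl)
      fix x assume "x \<in> space \<kappa>"
      then have x: "0 < x" by simp
      have "laplace ?\<phi>\<delta> x = exp (- (\<delta> * x)) *\<^sub>R laplace \<phi> x"
        using \<delta> ab by (intro laplace_shift) auto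
      then have "laplace (\<lambda>t. \<phi> t - ?\<phi>\<delta> t) x = (1 - exp (- (\<delta> * x))) *\<^sub>R laplace \<phi> x"
        by (simp only: laplace_diff[OF L2\<phi> x] scaleR_diff_left scaleR_one)
      then show "laplace f x * laplace (\<lambda>t. \<phi> t - ?\<phi>\<delta> t) x = u x * laplace \<phi> x"
        by (simp add: u_def)
    qed
    also have "\<dots> = (LINT t|halfline. p t * \<phi> t)"
      unfolding p_def
    proof (rule laplace_Fubini(1)[symmetric, where a=a and c="a/2" and C="\<delta> * L2_norm f"])
      show "norm (u x) * exp (- (a * x) / 2) \<le> \<delta> * L2_norm f * (sqrt x * exp (- (a / 2 * x)))" if "0 < x" for x
        using mult_right_mono[OF ub[OF that], of "exp (- (a * x) / 2)"] by (simp add: mult_ac)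
    qed (use um L2\<phi> ab in auto)
    finally have eq: "(LINT t|halfline. (G t - G (t + \<delta>)) * \<phi> t) = (LINT t|halfline. p t * \<phi> t)" .
    have ip: "integrable halfline (\<lambda>t. p t * \<phi> t)"
      unfolding p_def
    proof (rule laplace_Fubini(2)[where a=a and c="a/2" and C="\<delta> * L2_norm f"])
      show "norm (u x) * exp (- (a * x) / 2) \<le> \<delta> * L2_norm f * (sqrt x * exp (- (a / 2 * x)))" if "0 < x" for x
        using mult_right_mono[OF ub[OF that], of "exp (- (a * x) / 2)"] by (simp add: mult_ac)
    qed (use um L2\<phi> ab in auto)
    have "(LINT t|halfline. (G t - G (t + \<delta>) - p t) * \<phi> t)
        = (LINT t|halfline. (G t - G (t + \<delta>)) * \<phi> t) - (LINT t|halfline. p t * \<phi> t)"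
      unfolding left_diff_distrib[of "G t - G (t + \<delta>)" for t]
      by (intro Bochner_Integration.integral_diff L2_product_integrable L2_diff G G' L2\<phi> ip)
    with eq show "(LINT t|halfline. (G t - G (t + \<delta>) - p t) * \<phi> t) = 0" by simp
  qed
  then show ?thesis by (simp add: p_def u_def)
qed

text \<open>
  The right-hand side of \<open>weak_image_difference\<close> depends on \<open>f\<close> only. Hence the difference of two weak
  images is invariant under translations, while translations to the left by \<open>n\<close> send the norm of any
  \<open>L\<^sup>2\<close> function to zero.
\<close>

lemma weak_image_unique:
  assumes "weak_image f w" "weak_image f w'"
  shows "AE t in halfline. w t = w' t"
proof -
  have w: "w \<in> L2" "w' \<in> L2" using assms by (auto simp: weak_image_def)
  let ?v = "\<lambda>t. w t - w' t"
  have v: "?v \<in> L2" by (intro L2_diff w)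
  have eq: "L2_norm (\<lambda>t. ?v (t + real n)) = L2_norm ?v" for n
  proof (cases n)
    case (Suc m)
    have "AE t in halfline. norm (?v (t + real n)) = norm (?v t)"
      using weak_image_difference[OF assms(1), of "real n"] weak_image_difference[OF assms(2), of "real n"] Suc
      by (auto elim!: eventually_elim2 simp: algebra_simps) 
    then show ?thesis
      unfolding L2_norm_def using L2_measurable[OF v] L2_measurable[OF shift_L2(1)[OF v, of "real n"]]
      by (intro arg_cong[of _ _ sqrt] integral_cong_AE) auto
  qed simp
  have "L2_norm ?v = 0"
    using shift_tendsto_0[OF v] unfolding eq by (simp add: LIMSEQ_const_iff)
  then show ?thesis
    using L2_norm_eq_0_iff[OF v] by auto
qed

text \<open>
  The shift by \<open>\<epsilon>\<close> is there for convergence at large \<open>x\<close>, the difference in \<open>\<delta>\<close> for convergence at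
  small \<open>x\<close>, where \<open>Lf Lg\<close> may be as large as \<open>1 / x\<close>.
\<close>

lemma weak_image_shifted_pairing:
  assumes W: "weak_image f G" and g: "g \<in> L2" and \<epsilon>: "0 < \<epsilon>" and \<delta>: "0 < \<delta>"
  shows "(LINT t|halfline. (G (t + \<epsilon>) - G (t + \<epsilon> + \<delta>)) * g t)
    = (LINT x|\<kappa>. (exp (- (\<epsilon> * x)) * (1 - exp (- (\<delta> * x)))) *\<^sub>R (laplace f x * laplace g x))"
proof -
  have f: "f \<in> L2" and G: "G \<in> L2" using W by (auto simp: weak_image_def)
  let ?u = "\<lambda>x. exp (- (\<epsilon> * x)) *\<^sub>R ((1 - exp (- (\<delta> * x))) *\<^sub>R laplace f x)"
  have m: "?u \<in> borel_measurable \<kappa>"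
    by (intro borel_measurable_scaleR[of "\<lambda>x. exp (- (\<epsilon> * x))"] difference_multiplier_measurable f measurable_\<kappa>) measurable
  have b: "norm (?u x) \<le> \<delta> * L2_norm f * (sqrt x * exp (- (\<epsilon> * x)))" if "0 < x" for x
  proof -
    have "norm (?u x) = norm ((1 - exp (- (\<delta> * x))) *\<^sub>R laplace f x) * exp (- (\<epsilon> * x))"
      by (simp add: abs_mult)
    also have "\<dots> \<le> \<delta> * L2_norm f * sqrt x * exp (- (\<epsilon> * x))"
      by (intro mult_right_mono difference_multiplier_bound f less_imp_le[OF \<delta>] that) auto
    finally show ?thesis by simp
  qed
  have b': "norm (?u x) \<le> \<delta> * L2_norm f * sqrt x" if "0 < x" for x
  proof (rule order_trans[OF b[OF that]])
    show "\<delta> * L2_norm f * (sqrt x * exp (- (\<epsilon> * x))) \<le> \<delta> * L2_norm f * sqrt x"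
      using \<epsilon> \<delta> that by (intro mult_left_mono) (auto simp: mult_left_le)
  qed
  have "(LINT t|halfline. (G (t + \<epsilon>) - G (t + \<epsilon> + \<delta>)) * g t)
      = (LINT t|halfline. (LINT x|\<kappa>. exp (- (t * x)) *\<^sub>R ?u x) * g t)"
  proof (rule integral_cong_AE)
    show "(\<lambda>t. (G (t + \<epsilon>) - G (t + \<epsilon> + \<delta>)) * g t) \<in> borel_measurable halfline"
      using \<epsilon> \<delta> unfolding add.assoc
      by (intro borel_measurable_times borel_measurable_diff L2_measurable g shift_L2(1) G) auto
    show "(\<lambda>t. (LINT x|\<kappa>. exp (- (t * x)) *\<^sub>R ?u x) * g t) \<in> borel_measurable halfline"
      by (intro borel_measurable_times superposition_measurable[OF m b'] L2_measurable g)
    show "AE t in halfline. (G (t + \<epsilon>) - G (t + \<epsilon> + \<delta>)) * g t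
        = (LINT x|\<kappa>. exp (- (t * x)) *\<^sub>R ?u x) * g t"
      using AE_halfline_shift[OF weak_image_difference[OF W \<delta>] less_imp_le[OF \<epsilon>]]
      by eventually_elim (simp add: exp_add[symmetric] algebra_simps)
  qed
  also have "\<dots> = (LINT x|\<kappa>. ?u x * laplace g x)"
    using m b by (intro laplace_Fubini(1)[where a=0 and c=\<epsilon> and C="\<delta> * L2_norm f"] g) (auto simp: \<epsilon>)
  finally show ?thesis by simp
qed

lemma regularizer_tendsto:
  "0 < x \<Longrightarrow> (\<lambda>n. exp (- (inverse (real (Suc n)) * x)) * (1 - exp (- (real (Suc n) * x)))) \<longlonglongrightarrow> 1"
proof -
  assume x: "0 < x"
  have "(\<lambda>n. exp (- (inverse (real (Suc n)) * x))) \<longlonglongrightarrow> exp (- (0 * x))"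
    by (intro tendsto_intros LIMSEQ_inverse_real_of_nat)
  moreover have "(\<lambda>n. exp (- (real (Suc n) * x))) \<longlonglongrightarrow> 0"
  proof -
    have "(\<lambda>n. exp (- x) ^ Suc n) \<longlonglongrightarrow> 0"
      using x by (intro LIMSEQ_Suc LIMSEQ_realpow_zero) auto
    then show ?thesis by (simp add: exp_of_nat_mult[symmetric] del: of_nat_Suc power_Suc)
  qed
  ultimately have "(\<lambda>n. exp (- (inverse (real (Suc n)) * x)) * (1 - exp (- (real (Suc n) * x)))) \<longlonglongrightarrow> exp (- (0 * x)) * (1 - 0)"
    by (rule tendsto_mult[OF _ tendsto_diff[OF tendsto_const]])
  then show ?thesis by simp
qed

text \<open>
  Choose \<open>g\<close> as the complex conjugate of \<open>f\<close> in \<open>weak_image_shifted_pairing\<close>, so that \<open>Lf Lg\<close> becomes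
  \<open>|Lf|\<^sup>2\<close>. Translations do not increase norms, so the left-hand side is bounded independently of
  \<open>\<epsilon> = 1 / (n + 1)\<close> and \<open>\<delta> = n + 1\<close>, and positivity of the multiplier allows Fatou's lemma.
\<close>

lemma weak_image_in_form_domain:
  assumes W: "weak_image f G"
  shows "integrable \<kappa> (\<lambda>x. (norm (laplace f x))\<^sup>2)"
proof -
  have f: "f \<in> L2" and G: "G \<in> L2" using W by (auto simp: weak_image_def)
  have fm: "laplace f \<in> borel_measurable \<kappa>" by (intro laplace_measurable L2_measurable f)
  define m where "m n x = exp (- (inverse (real (Suc n)) * x)) * (1 - exp (- (real (Suc n) * x)))" for n x
  have m0: "0 \<le> m n x" if "0 < x" for n x using that by (simp add: m_def)
  have mm: "m n \<in> borel_measurable \<kappa>" for n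
    unfolding m_def[abs_def] by (rule measurable_\<kappa>) measurable
  define I where "I n = (LINT x|\<kappa>. m n x * (norm (laplace f x))\<^sup>2)" for n
  have mi: "integrable \<kappa> (\<lambda>x. m n x * (norm (laplace f x))\<^sup>2)" for n
  proof (rule Bochner_Integration.integrable_bound)
    show "integrable \<kappa> (\<lambda>x. real (Suc n) * (L2_norm f)\<^sup>2 * exp (- (inverse (real (Suc n)) * x)))"
      using exp_integrable[of "inverse (real (Suc n))"] by (intro integrable_mult_right) simp
    show "(\<lambda>x. m n x * (norm (laplace f x))\<^sup>2) \<in> borel_measurable \<kappa>"
      using mm fm by measurable
    show "AE x in \<kappa>. norm (m n x * (norm (laplace f x))\<^sup>2)
        \<le> norm (real (Suc n) * (L2_norm f)\<^sup>2 * exp (- (inverse (real (Suc n)) * x)))"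
    proof (rule AE_I2)
      fix x assume "x \<in> space \<kappa>"
      then have x: "0 < x" by simp
      have "m n x \<le> exp (- (inverse (real (Suc n)) * x)) * (real (Suc n) * x)"
        unfolding m_def using exp_ge_add_one_self[of "- (real (Suc n) * x)"]
        by (intro mult_left_mono) (auto simp del: of_nat_Suc)
      moreover have "(norm (laplace f x))\<^sup>2 \<le> (L2_norm f / sqrt x)\<^sup>2"
        by (intro power_mono laplace_bound f x) simp
      ultimately have "m n x * (norm (laplace f x))\<^sup>2
          \<le> (exp (- (inverse (real (Suc n)) * x)) * (real (Suc n) * x)) * (L2_norm f / sqrt x)\<^sup>2"
        using m0 x by (intro mult_mono) auto
      also have "\<dots> = real (Suc n) * (L2_norm f)\<^sup>2 * exp (- (inverse (real (Suc n)) * x))"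
        using x by (simp add: power_divide del: of_nat_Suc)
      finally show "norm (m n x * (norm (laplace f x))\<^sup>2)
        \<le> norm (real (Suc n) * (L2_norm f)\<^sup>2 * exp (- (inverse (real (Suc n)) * x)))"
        using m0[OF x] by (simp add: abs_mult del: of_nat_Suc)
    qed
  qed
  have I_le: "I n \<le> 2 * L2_norm G * L2_norm f" for n
  proof -
    let ?\<epsilon> = "inverse (real (Suc n))" and ?\<delta> = "real (Suc n)"
    have G1: "(\<lambda>t. G (t + ?\<epsilon>)) \<in> L2" "L2_norm (\<lambda>t. G (t + ?\<epsilon>)) \<le> L2_norm G"
      by (intro shift_L2 G; simp)+
    have G2: "(\<lambda>t. G (t + ?\<epsilon> + ?\<delta>)) \<in> L2" "L2_norm (\<lambda>t. G (t + ?\<epsilon> + ?\<delta>)) \<le> L2_norm G"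
      unfolding add.assoc by (intro shift_L2 G; simp)+
    have "of_real (I n) = (LINT x|\<kappa>. of_real (m n x * (norm (laplace f x))\<^sup>2) :: complex)"
      unfolding I_def by (rule integral_complex_of_real[symmetric])
    also have "\<dots> = (LINT x|\<kappa>. m n x *\<^sub>R (laplace f x * laplace (\<lambda>t. cnj (f t)) x))"
      unfolding laplace_cnj complex_norm_square[symmetric] by (simp add: scaleR_conv_of_real)
    also have "\<dots> = (LINT t|halfline. (G (t + ?\<epsilon>) - G (t + ?\<epsilon> + ?\<delta>)) * cnj (f t))"
      unfolding m_def by (intro weak_image_shifted_pairing[symmetric] W L2_cnj f) auto
    finally have "\<bar>I n\<bar> = norm (LINT t|halfline. (G (t + ?\<epsilon>) - G (t + ?\<epsilon> + ?\<delta>)) * cnj (f t))"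
      by (metis norm_of_real)
    also have "\<dots> \<le> L2_norm (\<lambda>t. G (t + ?\<epsilon>) - G (t + ?\<epsilon> + ?\<delta>)) * L2_norm f"
      using L2_product_bound[OF L2_diff[OF G1(1) G2(1)] L2_cnj[OF f]] by (simp add: L2_norm_cnj)
    also have "\<dots> \<le> (2 * L2_norm G) * L2_norm f"
    proof (rule mult_right_mono)
      show "L2_norm (\<lambda>t. G (t + ?\<epsilon>) - G (t + ?\<epsilon> + ?\<delta>)) \<le> 2 * L2_norm G"
        using L2_triangle[OF G1(1) L2_uminus[OF G2(1)]] G1(2) G2(2) by (simp add: L2_norm_uminus)
    qed simp
    finally show ?thesis by simp
  qed
  have "(\<integral>\<^sup>+ x. ennreal ((norm (laplace f x))\<^sup>2) \<partial>\<kappa>)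
      \<le> (\<integral>\<^sup>+ x. liminf (\<lambda>n. ennreal (m n x * (norm (laplace f x))\<^sup>2)) \<partial>\<kappa>)"
  proof (rule nn_integral_mono)
    fix x assume "x \<in> space \<kappa>"
    then have "(\<lambda>n. m n x) \<longlonglongrightarrow> 1" unfolding m_def by (intro regularizer_tendsto) simp
    then have "(\<lambda>n. ennreal (m n x * (norm (laplace f x))\<^sup>2)) \<longlonglongrightarrow> ennreal (1 * (norm (laplace f x))\<^sup>2)"
      by (intro tendsto_ennrealI tendsto_intros)
    then show "ennreal ((norm (laplace f x))\<^sup>2) \<le> liminf (\<lambda>n. ennreal (m n x * (norm (laplace f x))\<^sup>2))"
      by (subst lim_imp_Liminf[OF sequentially_bot]) auto
  qed
  also have "\<dots> \<le> liminf (\<lambda>n. \<integral>\<^sup>+ x. ennreal (m n x * (norm (laplace f x))\<^sup>2) \<partial>\<kappa>)"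
    by (intro nn_integral_liminf measurable_compose[OF borel_measurable_integrable[OF mi] measurable_ennreal])
  also have "\<dots> \<le> ennreal (2 * L2_norm G * L2_norm f)"
  proof (rule Liminf_le[OF sequentially_bot], rule always_eventually, rule allI)
    fix n
    have "(\<integral>\<^sup>+ x. ennreal (m n x * (norm (laplace f x))\<^sup>2) \<partial>\<kappa>) = ennreal (I n)"
      unfolding I_def using m0 by (intro nn_integral_eq_integral mi AE_I2) auto
    then show "(\<integral>\<^sup>+ x. ennreal (m n x * (norm (laplace f x))\<^sup>2) \<partial>\<kappa>) \<le> ennreal (2 * L2_norm G * L2_norm f)"
      using I_le by (simp add: ennreal_leI)
  qed
  also have "\<dots> < \<infinity>" by simp
  finally show ?thesis
    using fm by (intro integrableI_bounded) auto
qed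

text \<open>
  Strong continuity of translations can be bypassed: by \<open>weak_image_difference\<close> the function
  \<open>G(t + \<epsilon>) - G(t)\<close> is \<open>O(\<epsilon>)\<close> uniformly for \<open>t\<close> away from \<open>0\<close>. Therefore \<open>g\<close> is truncated to a
  compact interval \<open>A k\<close>, at the cost of a small error in norm.
\<close>

lemma small_translation_weakly:
  assumes W: "weak_image f G" and g: "g \<in> L2"
  shows "(\<lambda>n. LINT t|halfline. (G (t + inverse (real (Suc n))) - G t) * g t) \<longlonglongrightarrow> 0"
proof (rule LIMSEQ_I)
  fix \<eta> :: real assume \<eta>: "0 < \<eta>"
  have f: "f \<in> L2" and G: "G \<in> L2" using W by (auto simp: weak_image_def)
  define A where "A k = {inverse (real (Suc k))..real (Suc k)}" for k
  define gk where "gk k = (\<lambda>t. indicator (A k) t *\<^sub>R g t)" for k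
  have gkm: "gk k \<in> borel_measurable halfline" for k
    unfolding gk_def A_def by (intro borel_measurable_scaleR L2_measurable g measurable_restrict_space1) simp
  have gk: "gk k \<in> L2" for k
    using L2_bounded[OF gkm L2_integrable_sq[OF g]] by (simp add: gk_def indicator_def)
  have "(\<lambda>k. LINT t|halfline. (norm (g t - gk k t))\<^sup>2) \<longlonglongrightarrow> (LINT t|halfline. 0)"
  proof (rule integral_dominated_convergence[where w="\<lambda>t. (norm (g t))\<^sup>2"])
    show "AE t in halfline. (\<lambda>k. (norm (g t - gk k t))\<^sup>2) \<longlonglongrightarrow> 0"
    proof (rule AE_I2, rule tendsto_eventually)
      fix t assume "t \<in> space halfline"
      then have t: "0 < t" by simp
      have "\<forall>\<^sub>F k in sequentially. inverse (real (Suc k)) < t"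
        using LIMSEQ_inverse_real_of_nat t by (rule order_tendstoD)
      then show "\<forall>\<^sub>F k in sequentially. (norm (g t - gk k t))\<^sup>2 = 0"
        using eventually_ge_at_top[of "nat \<lceil>t\<rceil>"]
        by eventually_elim (simp add: gk_def A_def indicator_def; linarith)
    qed
    show "(\<lambda>t. (norm (g t - gk k t))\<^sup>2) \<in> borel_measurable halfline" for k
      using L2_integrable_sq[OF L2_diff[OF g gk]] by blast
  qed (use L2_integrable_sq[OF g] in \<open>auto simp: gk_def indicator_def\<close>)
  then have "(\<lambda>k. sqrt ((L2_norm (\<lambda>t. g t - gk k t))\<^sup>2)) \<longlonglongrightarrow> sqrt 0"
    unfolding L2_norm_sq by (intro tendsto_intros) simp
  then have "(\<lambda>k. 2 * L2_norm G * L2_norm (\<lambda>t. g t - gk k t)) \<longlonglongrightarrow> 2 * L2_norm G * 0"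
    by (intro tendsto_intros) simp
  then have "\<forall>\<^sub>F k in sequentially. 2 * L2_norm G * L2_norm (\<lambda>t. g t - gk k t) < \<eta> / 2"
    using \<eta> by (intro order_tendstoD) auto
  then obtain k where k: "2 * L2_norm G * L2_norm (\<lambda>t. g t - gk k t) < \<eta> / 2"
    using eventually_happens by fastforce
  let ?a = "inverse (real (Suc k))"
  have gk_int: "integrable halfline (\<lambda>t. norm (gk k t))"
  proof -
    have "norm (gk k t) = norm (indicator (A k) t * g t)" for t
      by (simp add: gk_def indicator_def)
    then show ?thesis
      unfolding A_def using integrable_norm[OF L2_product_integrable[OF indicator_L2 g, of "inverse (real (Suc k))" "real (Suc k)"]] by simp
  qed
  define B where "B = L2_norm f * root_moment ?a * (LINT t|halfline. norm (gk k t))"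
  have "(\<lambda>n. inverse (real (Suc n)) * B) \<longlonglongrightarrow> 0 * B"
    by (intro tendsto_intros LIMSEQ_inverse_real_of_nat)
  then have "\<forall>\<^sub>F n in sequentially. inverse (real (Suc n)) * B < \<eta> / 2"
    using \<eta> by (intro order_tendstoD) auto
  then obtain N where N: "\<And>n. N \<le> n \<Longrightarrow> inverse (real (Suc n)) * B < \<eta> / 2"
    by (auto simp: eventually_sequentially)
  have "norm (LINT t|halfline. (G (t + inverse (real (Suc n))) - G t) * g t) < \<eta>" if "N \<le> n" for n
  proof -
    let ?\<epsilon> = "inverse (real (Suc n))"
    have \<epsilon>: "0 < ?\<epsilon>" by simp
    let ?d = "\<lambda>t. G (t + ?\<epsilon>) - G t"
    have G1: "(\<lambda>t. G (t + ?\<epsilon>)) \<in> L2" "L2_norm (\<lambda>t. G (t + ?\<epsilon>)) \<le> L2_norm G"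
      by (intro shift_L2 G less_imp_le[OF \<epsilon>])+
    have d: "?d \<in> L2" by (intro L2_diff G G1)
    have "L2_norm ?d \<le> 2 * L2_norm G"
      using L2_triangle[OF G1(1) L2_uminus[OF G]] G1(2) by (simp add: L2_norm_uminus)
    then have "norm (LINT t|halfline. ?d t * (g t - gk k t)) \<le> 2 * L2_norm G * L2_norm (\<lambda>t. g t - gk k t)"
      using L2_product_bound[OF d L2_diff[OF g gk]] by (meson L2_norm_nonneg mult_right_mono order_trans)
    moreover have "norm (LINT t|halfline. ?d t * gk k t) \<le> ?\<epsilon> * B"
    proof -
      have "norm (LINT t|halfline. ?d t * gk k t)
          \<le> (LINT t|halfline. ?\<epsilon> * L2_norm f * root_moment ?a * norm (gk k t))"
      proof (rule order_trans[OF integral_norm_bound], rule integral_mono_AE)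
        show "integrable halfline (\<lambda>t. norm (?d t * gk k t))"
          by (intro integrable_norm L2_product_integrable d gk)
        show "integrable halfline (\<lambda>t. ?\<epsilon> * L2_norm f * root_moment ?a * norm (gk k t))"
          using gk_int by (rule integrable_mult_right)
        show "AE t in halfline. norm (?d t * gk k t) \<le> ?\<epsilon> * L2_norm f * root_moment ?a * norm (gk k t)"
          using weak_image_difference[OF W \<epsilon>] AE_space
        proof eventually_elim
          fix t
          assume eq: "G t - G (t + ?\<epsilon>)
              = (LINT x|\<kappa>. exp (- (t * x)) *\<^sub>R ((1 - exp (- (?\<epsilon> * x))) *\<^sub>R laplace f x))"
            and "t \<in> space halfline"
          then have t: "0 < t" by simp
          show "norm (?d t * gk k t) \<le> ?\<epsilon> * L2_norm f * root_moment ?a * norm (gk k t)"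
          proof (cases "t \<in> A k")
            case True
            have "norm (?d t) = norm (G t - G (t + ?\<epsilon>))" by (rule norm_minus_commute)
            also have "\<dots> \<le> ?\<epsilon> * L2_norm f * root_moment t"
              unfolding eq
              by (rule superposition_integrable(2)[OF difference_multiplier_measurable[OF f]
                    difference_multiplier_bound[OF f less_imp_le[OF \<epsilon>]] t])
            also have "\<dots> \<le> ?\<epsilon> * L2_norm f * root_moment ?a"
              using True by (intro mult_left_mono root_moment_antimono) (auto simp: A_def simp del: of_nat_Suc)
            finally show ?thesis by (simp add: norm_mult mult_right_mono del: of_nat_Suc)
          qed (simp add: gk_def)
        qed
      qed
      also have "\<dots> = ?\<epsilon> * B"
        unfolding B_def by (subst integral_mult_right_zero) (simp add: mult_ac)
      finally show ?thesis .
    qed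
    moreover have "(LINT t|halfline. ?d t * g t)
        = (LINT t|halfline. ?d t * (g t - gk k t)) + (LINT t|halfline. ?d t * gk k t)"
    proof -
      have "(LINT t|halfline. ?d t * (g t - gk k t)) = (LINT t|halfline. ?d t * g t) - (LINT t|halfline. ?d t * gk k t)"
        unfolding right_diff_distrib[of "?d t" for t]
        by (intro Bochner_Integration.integral_diff L2_product_integrable d g gk)
      then show ?thesis by simp
    qed
    ultimately show ?thesis
      using k N[OF that] norm_triangle_ineq[of "LINT t|halfline. ?d t * (g t - gk k t)" "LINT t|halfline. ?d t * gk k t"]
      by (simp del: of_nat_Suc)
  qed
  then show "\<exists>N. \<forall>n\<ge>N. norm ((LINT t|halfline. (G (t + inverse (real (Suc n))) - G t) * g t) - 0) < \<eta>"
    by auto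
qed

text \<open>
  The limit \<open>\<epsilon> \<rightarrow> 0\<close>, \<open>\<delta> \<rightarrow> \<infinity>\<close> in \<open>weak_image_shifted_pairing\<close>. On the right the convergence is dominated
  because both Laplace transforms are square integrable; on the left the two translates of \<open>G\<close> tend
  weakly to \<open>G\<close> and in norm to \<open>0\<close>.
\<close>

lemma weak_image_represents_form:
  assumes W: "weak_image f G" and g: "g \<in> L2" and gQ: "integrable \<kappa> (\<lambda>x. (norm (laplace g x))\<^sup>2)"
  shows "(LINT x|\<kappa>. laplace f x * laplace g x) = (LINT t|halfline. G t * g t)"
proof -
  have f: "f \<in> L2" and G: "G \<in> L2" using W by (auto simp: weak_image_def)
  have fm: "laplace f \<in> borel_measurable \<kappa>" "laplace g \<in> borel_measurable \<kappa>"
    by (intro laplace_measurable L2_measurable f g)+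
  let ?\<epsilon> = "\<lambda>n. inverse (real (Suc n))" and ?\<delta> = "\<lambda>n. real (Suc n)"
  define m where "m n x = exp (- (?\<epsilon> n * x)) * (1 - exp (- (?\<delta> n * x)))" for n x
  have mm: "m n \<in> borel_measurable \<kappa>" for n
    unfolding m_def[abs_def] by (rule measurable_\<kappa>) measurable
  have "(\<lambda>n. LINT x|\<kappa>. m n x *\<^sub>R (laplace f x * laplace g x)) \<longlonglongrightarrow> (LINT x|\<kappa>. laplace f x * laplace g x)"
  proof (rule integral_dominated_convergence[where w="\<lambda>x. (norm (laplace f x))\<^sup>2 + (norm (laplace g x))\<^sup>2"])
    show "integrable \<kappa> (\<lambda>x. (norm (laplace f x))\<^sup>2 + (norm (laplace g x))\<^sup>2)"
      by (intro Bochner_Integration.integrable_add weak_image_in_form_domain[OF W] gQ)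
    show "AE x in \<kappa>. (\<lambda>n. m n x *\<^sub>R (laplace f x * laplace g x)) \<longlonglongrightarrow> laplace f x * laplace g x"
    proof (rule AE_I2)
      fix x assume "x \<in> space \<kappa>"
      then have "(\<lambda>n. m n x) \<longlonglongrightarrow> 1" unfolding m_def by (intro regularizer_tendsto) simp
      then have "(\<lambda>n. m n x *\<^sub>R (laplace f x * laplace g x)) \<longlonglongrightarrow> 1 *\<^sub>R (laplace f x * laplace g x)"
        by (intro tendsto_intros)
      then show "(\<lambda>n. m n x *\<^sub>R (laplace f x * laplace g x)) \<longlonglongrightarrow> laplace f x * laplace g x" by simp
    qed
    show "AE x in \<kappa>. norm (m n x *\<^sub>R (laplace f x * laplace g x)) \<le> (norm (laplace f x))\<^sup>2 + (norm (laplace g x))\<^sup>2" for n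
    proof (rule AE_I2)
      fix x assume "x \<in> space \<kappa>"
      then have x: "0 < x" by simp
      have "0 \<le> m n x" "m n x \<le> 1" using x by (auto simp: m_def intro!: mult_le_one)
      then have "norm (m n x *\<^sub>R (laplace f x * laplace g x)) \<le> norm (laplace f x * laplace g x)"
        by (simp add: mult_left_le_one_le)
      also note norm_mult_le_sum_squares
      finally show "norm (m n x *\<^sub>R (laplace f x * laplace g x)) \<le> (norm (laplace f x))\<^sup>2 + (norm (laplace g x))\<^sup>2" .
    qed
  qed (use fm mm in measurable)
  moreover have "(\<lambda>n. LINT x|\<kappa>. m n x *\<^sub>R (laplace f x * laplace g x)) \<longlonglongrightarrow> 0 - 0 + (LINT t|halfline. G t * g t)"
  proof -
    have G1: "(\<lambda>t. G (t + ?\<epsilon> n)) \<in> L2" for n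
      by (intro shift_L2 G) simp
    have G2: "(\<lambda>t. G (t + ?\<epsilon> n + ?\<delta> n)) \<in> L2" for n
      unfolding add.assoc by (intro shift_L2 G) simp
    have split: "(LINT x|\<kappa>. m n x *\<^sub>R (laplace f x * laplace g x))
        = (LINT t|halfline. (G (t + ?\<epsilon> n) - G t) * g t) - (LINT t|halfline. G (t + ?\<epsilon> n + ?\<delta> n) * g t)
          + (LINT t|halfline. G t * g t)" for n
    proof -
      have "(LINT x|\<kappa>. m n x *\<^sub>R (laplace f x * laplace g x))
          = (LINT t|halfline. (G (t + ?\<epsilon> n) - G (t + ?\<epsilon> n + ?\<delta> n)) * g t)"
        unfolding m_def by (intro weak_image_shifted_pairing[symmetric] W g) auto
      also have "\<dots> = (LINT t|halfline. (G (t + ?\<epsilon> n) - G t) * g t - G (t + ?\<epsilon> n + ?\<delta> n) * g t + G t * g t)"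
        by (intro Bochner_Integration.integral_cong) (auto simp: algebra_simps)
      also have "\<dots> = (LINT t|halfline. (G (t + ?\<epsilon> n) - G t) * g t) - (LINT t|halfline. G (t + ?\<epsilon> n + ?\<delta> n) * g t)
          + (LINT t|halfline. G t * g t)"
        by (subst Bochner_Integration.integral_add Bochner_Integration.integral_diff;
            (intro Bochner_Integration.integrable_diff L2_product_integrable L2_diff G G1 G2 g refl)?)+
      finally show ?thesis .
    qed
    have far: "(\<lambda>n. LINT t|halfline. G (t + ?\<epsilon> n + ?\<delta> n) * g t) \<longlonglongrightarrow> 0"
    proof (rule Lim_null_comparison)
      have "(\<lambda>n. L2_norm (\<lambda>t. G (t + real (Suc n))) * L2_norm g) \<longlonglongrightarrow> 0 * L2_norm g"
        by (intro tendsto_intros LIMSEQ_Suc[OF shift_tendsto_0[OF G]])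
      then show "(\<lambda>n. L2_norm (\<lambda>t. G (t + real (Suc n))) * L2_norm g) \<longlonglongrightarrow> 0" by simp
      show "\<forall>\<^sub>F n in sequentially. norm (LINT t|halfline. G (t + ?\<epsilon> n + ?\<delta> n) * g t)
          \<le> L2_norm (\<lambda>t. G (t + real (Suc n))) * L2_norm g"
      proof (rule always_eventually, rule allI)
        fix n
        have "(\<lambda>t. G (t + ?\<delta> n)) \<in> L2" by (intro shift_L2 G) simp
        from shift_L2(3)[OF this, of "?\<epsilon> n"]
        have "L2_norm (\<lambda>t. G (t + ?\<epsilon> n + ?\<delta> n)) \<le> L2_norm (\<lambda>t. G (t + ?\<delta> n))" by simp
        then show "norm (LINT t|halfline. G (t + ?\<epsilon> n + ?\<delta> n) * g t)
          \<le> L2_norm (\<lambda>t. G (t + real (Suc n))) * L2_norm g"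
          using L2_product_bound[OF G2 g, of n] by (meson L2_norm_nonneg mult_right_mono order_trans)
      qed
    qed
    show ?thesis
      unfolding split by (intro tendsto_intros small_translation_weakly[OF W g] far)
  qed
  ultimately show ?thesis
    using LIMSEQ_unique by fastforce
qed

end

section \<open>Symmetric operators with symmetric adjoint\<close>

lemma adjoint_opD: "(g, v) \<in> adjoint_op A \<Longrightarrow> (f, w) \<in> A \<Longrightarrow> L2_inner w g = L2_inner f v"
  and adjoint_op_L2: "adjoint_op A \<subseteq> L2 \<times> L2"
  by (auto simp: adjoint_op_def)

lemma adjoint_op_antimono: "A \<subseteq> B \<Longrightarrow> adjoint_op B \<subseteq> adjoint_op A"
  by (auto simp: adjoint_op_def)

lemma adjoint_op_linear:
  assumes "A \<subseteq> L2 \<times> L2" "(g, v) \<in> adjoint_op A" "(g', v') \<in> adjoint_op A"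
  shows "(\<lambda>t. g t + c * g' t, \<lambda>t. v t + c * v' t) \<in> adjoint_op A"
proof -
  have L2: "g \<in> L2" "v \<in> L2" "g' \<in> L2" "v' \<in> L2" using assms adjoint_op_L2 by auto
  have "L2_inner w (\<lambda>t. g t + c * g' t) = L2_inner f (\<lambda>t. v t + c * v' t)" if "(f, w) \<in> A" for f w
  proof -
    have "f \<in> L2" "w \<in> L2" using that assms(1) by auto
    then show ?thesis
      using adjoint_opD[OF assms(2) that] adjoint_opD[OF assms(3) that] L2
      by (simp add: L2_inner_add_right L2_inner_scale_right L2_scale)
  qed
  then show ?thesis using L2 by (auto simp: adjoint_op_def L2_add L2_scale)
qed

text \<open>
  Adjoints are closed, so an inclusion into an adjoint extends to the closure.
\<close>

lemma closure_op_subset_adjoint_op: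
  assumes A: "A \<subseteq> adjoint_op B" and B: "B \<subseteq> L2 \<times> L2"
  shows "closure_op A \<subseteq> adjoint_op B"
proof
  fix x assume "x \<in> closure_op A"
  then obtain f w where x: "x = (f, w)" and fw: "f \<in> L2" "w \<in> L2"
    and approx: "\<And>\<epsilon>. 0 < \<epsilon> \<Longrightarrow> \<exists>(f', w')\<in>A. graph_norm (\<lambda>t. f t - f' t) (\<lambda>t. w t - w' t) < \<epsilon>"
    by (auto simp: closure_op_def)
  have "L2_inner u f = L2_inner \<phi> w" if V: "(\<phi>, u) \<in> B" for \<phi> u
  proof -
    have L2: "\<phi> \<in> L2" "u \<in> L2" using V B by auto
    define K where "K = L2_norm u + L2_norm \<phi> + 1"
    have K: "0 < K" by (simp add: K_def add_nonneg_pos)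
    have "norm (L2_inner u f - L2_inner \<phi> w) \<le> \<epsilon>" if "0 < \<epsilon>" for \<epsilon>
    proof -
      obtain f' w' where A': "(f', w') \<in> A" and lt: "graph_norm (\<lambda>t. f t - f' t) (\<lambda>t. w t - w' t) < \<epsilon> / K"
        using approx[of "\<epsilon> / K"] K \<open>0 < \<epsilon>\<close> by auto
      have fw': "f' \<in> L2" "w' \<in> L2" using A' A adjoint_op_L2 by auto
      have "L2_inner u f' = L2_inner \<phi> w'" using A A' V adjoint_opD by blast
      then have "L2_inner u f - L2_inner \<phi> w = L2_inner u (\<lambda>t. f t - f' t) - L2_inner \<phi> (\<lambda>t. w t - w' t)"
        using L2 fw fw' by (simp add: L2_inner_diff_right)
      also have "norm \<dots> \<le> L2_norm u * L2_norm (\<lambda>t. f t - f' t) + L2_norm \<phi> * L2_norm (\<lambda>t. w t - w' t)"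
        using L2 fw fw' by (intro order_trans[OF norm_triangle_ineq4] add_mono L2_inner_bound L2_diff)
      also have "\<dots> \<le> L2_norm u * (\<epsilon> / K) + L2_norm \<phi> * (\<epsilon> / K)"
        by (intro add_mono mult_left_mono order_trans[OF L2_norm_le_graph_norm(1) less_imp_le[OF lt]]
            order_trans[OF L2_norm_le_graph_norm(2) less_imp_le[OF lt]]) auto
      also have "\<dots> = (L2_norm u + L2_norm \<phi>) * \<epsilon> / K" by (simp add: distrib_right add_divide_distrib)
      also have "\<dots> \<le> K * \<epsilon> / K"
        using \<open>0 < \<epsilon>\<close> K by (intro divide_right_mono mult_right_mono) (auto simp: K_def)
      also have "\<dots> = \<epsilon>" using K by simp
      finally show ?thesis .
    qed
    then have "norm (L2_inner u f - L2_inner \<phi> w) \<le> 0" by (rule field_le_epsilon[where y=0, simplified])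
    then show ?thesis by simp
  qed
  then show "x \<in> adjoint_op B" using fw by (auto simp: x adjoint_op_def)
qed

text \<open>
  Von Neumann's argument. Decompose an element of the graph of the adjoint into its projection to the
  closure of \<open>A\<close> and a remainder \<open>(r, s)\<close>. The remainder is again in the adjoint, and orthogonality to
  \<open>A\<close> says that \<open>(s, -r)\<close> is in the adjoint as well. Symmetry of the adjoint then gives
  \<open>\<langle>s, s\<rangle> = \<langle>r, -r\<rangle>\<close>, hence \<open>r = s = 0\<close>.
\<close>

lemma closure_op_eq_adjoint_op:
  assumes A: "A \<subseteq> adjoint_op A" "A \<noteq> {}"
    and lin: "\<And>f w f' w' c. (f, w) \<in> A \<Longrightarrow> (f', w') \<in> A \<Longrightarrow> (\<lambda>t. f t + c * f' t, \<lambda>t. w t + c * w' t) \<in> A"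
    and sym: "adjoint_op A \<subseteq> adjoint_op (adjoint_op A)"
  shows "closure_op A = adjoint_op A"
proof
  have AL2: "A \<subseteq> L2 \<times> L2" using A(1) adjoint_op_L2 by blast
  show cl: "closure_op A \<subseteq> adjoint_op A" by (rule closure_op_subset_adjoint_op[OF A(1) AL2])
  show "adjoint_op A \<subseteq> closure_op A"
  proof
    fix x assume x: "x \<in> adjoint_op A"
    obtain f w where fw: "x = (f, w)" by (cases x)
    have L2: "f \<in> L2" "w \<in> L2" using x adjoint_op_L2 by (auto simp: fw)
    obtain p q where pq: "(p, q) \<in> closure_op A"
      and orth: "\<And>\<phi> u. (\<phi>, u) \<in> A \<Longrightarrow> L2_inner (\<lambda>t. f t - p t) \<phi> + L2_inner (\<lambda>t. w t - q t) u = 0"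
      using graph_projection[OF AL2 A(2) lin L2] by blast
    have pqL2: "p \<in> L2" "q \<in> L2" using pq by (auto simp: closure_op_def)
    let ?r = "\<lambda>t. f t - p t" and ?s = "\<lambda>t. w t - q t"
    have rsL2: "?r \<in> L2" "?s \<in> L2" using L2 pqL2 by (auto intro: L2_diff)
    have rs: "(?r, ?s) \<in> adjoint_op A"
      using adjoint_op_linear[OF AL2 x[unfolded fw] subsetD[OF cl pq], of "-1"] by simp
    have sr: "(?s, \<lambda>t. - ?r t) \<in> adjoint_op A"
    proof -
      have "L2_inner u ?s = L2_inner \<phi> (\<lambda>t. - ?r t)" if "(\<phi>, u) \<in> A" for \<phi> u
      proof -
        have "L2_inner ?s u = - L2_inner ?r \<phi>"
          using orth[OF that] by (simp add: add_eq_0_iff)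
        then have "L2_inner u ?s = - L2_inner \<phi> ?r"
          by (metis L2_inner_cnj complex_cnj_minus)
        also have "\<dots> = L2_inner \<phi> (\<lambda>t. - ?r t)"
          using L2_inner_scale_right[of \<phi> "-1" ?r] by simp
        finally show ?thesis .
      qed
      then show ?thesis using rsL2 L2_uminus[OF rsL2(1)] by (auto simp: adjoint_op_def)
    qed
    have "L2_inner ?s ?s = L2_inner ?r (\<lambda>t. - ?r t)"
      using sym sr rs by (auto intro: adjoint_opD)
    also have "\<dots> = - L2_inner ?r ?r"
      using L2_inner_scale_right[of ?r "-1" ?r] by simp
    finally have "complex_of_real ((L2_norm ?s)\<^sup>2 + (L2_norm ?r)\<^sup>2) = 0"
      unfolding L2_inner_self by (simp only: of_real_add) simp
    then have "(L2_norm ?s)\<^sup>2 + (L2_norm ?r)\<^sup>2 = 0" by (simp only: of_real_eq_0_iff)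
    then have zero: "L2_norm ?r = 0" "L2_norm ?s = 0" by (simp_all add: sum_power2_eq_zero_iff)
    have "\<exists>(\<phi>, u)\<in>A. graph_norm (\<lambda>t. f t - \<phi> t) (\<lambda>t. w t - u t) < \<epsilon>" if \<epsilon>: "0 < \<epsilon>" for \<epsilon>
    proof -
      obtain \<phi> u where \<phi>u: "(\<phi>, u) \<in> A" "graph_norm (\<lambda>t. p t - \<phi> t) (\<lambda>t. q t - u t) < \<epsilon>"
        using pq \<epsilon> unfolding closure_op_def by blast
      then have "\<phi> \<in> L2" "u \<in> L2" using AL2 by auto
      then have "L2_norm (\<lambda>t. f t - \<phi> t) \<le> L2_norm (\<lambda>t. p t - \<phi> t)"
        "L2_norm (\<lambda>t. w t - u t) \<le> L2_norm (\<lambda>t. q t - u t)"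
        using L2_triangle_diff[OF L2(1) pqL2(1), of \<phi>] L2_triangle_diff[OF L2(2) pqL2(2), of u] zero by auto
      then have "graph_norm (\<lambda>t. f t - \<phi> t) (\<lambda>t. w t - u t) \<le> graph_norm (\<lambda>t. p t - \<phi> t) (\<lambda>t. q t - u t)"
        unfolding graph_norm_def by (intro real_sqrt_le_mono add_mono power_mono) auto
      with \<phi>u show ?thesis by (intro bexI[of _ "(\<phi>, u)"]) auto
    qed
    then show "x \<in> closure_op A" using L2 by (auto simp: fw closure_op_def)
  qed
qed

lemma essentially_self_adjointI:
  assumes A: "A \<subseteq> adjoint_op A" and dense: "densely_defined A"
    and lin: "\<And>f w f' w' c. (f, w) \<in> A \<Longrightarrow> (f', w') \<in> A \<Longrightarrow> (\<lambda>t. f t + c * f' t, \<lambda>t. w t + c * w' t) \<in> A"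
    and sym: "adjoint_op A \<subseteq> adjoint_op (adjoint_op A)"
  shows "closure_op A = adjoint_op A" "essentially_self_adjoint A"
proof -
  have "A \<noteq> {}"
    using dense L2_zero unfolding densely_defined_def by (metis Domain_empty empty_iff zero_less_one)
  then show eq: "closure_op A = adjoint_op A" by (rule closure_op_eq_adjoint_op[OF A _ lin sym])
  have "densely_defined (adjoint_op A)"
    using dense A unfolding densely_defined_def by (meson Domain_mono subsetD)
  moreover have "adjoint_op (adjoint_op A) = adjoint_op A"
    using sym adjoint_op_antimono[OF A] by blast
  ultimately show "essentially_self_adjoint A"
    using A dense by (simp add: essentially_self_adjoint_def symmetric_op_def self_adjoint_def eq)
qed

section \<open>Test functions in the domain\<close>

lemma inverse_square_integrable:
  assumes "0 < b"
  shows "integrable halfline (\<lambda>t. 1 / (t + b)\<^sup>2)"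
proof -
  let ?F = "\<lambda>t. - 1 / (t + b)"
  have lim: "(?F \<longlongrightarrow> 0) at_top"
    using filterlim_tendsto_add_at_top[OF tendsto_const[of b] filterlim_ident]
    by (intro real_tendsto_divide_at_top[OF tendsto_const]) (simp add: add.commute)
  have "(\<integral>\<^sup>+ t. ennreal (1 / (t + b)\<^sup>2) \<partial>halfline) = (\<integral>\<^sup>+ t. ennreal (1 / (t + b)\<^sup>2) * indicator {0<..} t \<partial>lborel)"
    by (subst nn_integral_restrict_space) auto
  also have "\<dots> \<le> (\<integral>\<^sup>+ t. ennreal (1 / (t + b)\<^sup>2) * indicator {0..} t \<partial>lborel)"
    by (intro nn_integral_mono) (auto simp: indicator_def)
  also have "\<dots> = ennreal (0 - ?F 0)"
    using assms lim
    by (intro nn_integral_FTC_atLeast) (auto intro!: derivative_eq_intros simp: power2_eq_square)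
  also have "\<dots> < \<infinity>" by simp
  finally have "(\<integral>\<^sup>+ t. ennreal (1 / (t + b)\<^sup>2) \<partial>halfline) < \<infinity>" .
  moreover have "(\<lambda>t. 1 / (t + b)\<^sup>2) \<in> borel_measurable halfline"
    by (intro measurable_restrict_space1) measurable
  ultimately show ?thesis by (intro integrableI_bounded) auto
qed

context laplace_measure
begin

text \<open>
  The function \<open>w\<close> is the pointwise image of \<open>\<phi>\<close> under the Hankel kernel. As \<open>\<phi> = \<psi>'\<close> with \<open>\<psi>\<close>
  vanishing on \<open>(0, a)\<close>, one has \<open>|L\<phi>(x)| \<le> C x e\<^sup>-\<^sup>a\<^sup>x\<close>. The factor \<open>x\<close> turns into decay in \<open>t\<close>, through
  \<open>x e\<^sup>-\<^sup>(\<^sup>t\<^sup>+\<^sup>a\<^sup>/\<^sup>2\<^sup>)\<^sup>x \<le> 1 / (t + a/2)\<close>, and the remaining half of the exponential is integrable.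
\<close>

lemma test_function_image:
  assumes \<psi>: "\<psi> \<in> C_comp" and d: "\<And>t. (\<psi> has_vector_derivative \<phi> t) (at t)"
  defines "w \<equiv> \<lambda>t. LINT x|\<kappa>. exp (- (t * x)) *\<^sub>R laplace \<phi> x"
  shows "weak_image \<phi> w"
    and "g \<in> L2 \<Longrightarrow> (LINT t|halfline. w t * g t) = (LINT x|\<kappa>. laplace \<phi> x * laplace g x)"
proof -
  obtain a b where ab: "0 < a" "a < b" "\<And>t. t < a \<or> b < t \<Longrightarrow> \<psi> t = 0" "smooth \<psi>"
    using \<psi> unfolding C_comp_iff by blast
  have "\<phi> = (\<lambda>t. vector_derivative \<psi> (at t))" using vector_derivative_at[OF d] by simp
  then have "\<phi> \<in> C_comp" using C_comp_derivative(1)[OF \<psi>] by simp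
  then have \<phi>: "\<phi> \<in> L2" by (rule C_comp_L2)
  have L2: "\<psi> \<in> L2" by (rule C_comp_L2[OF \<psi>])
  have lap: "laplace \<phi> x = x *\<^sub>R laplace \<psi> x" if "0 < x" for x
    by (rule laplace_derivative[OF \<psi> d that])
  have um: "laplace \<phi> \<in> borel_measurable \<kappa>" by (intro laplace_measurable L2_measurable \<phi>)
  have ub: "norm (laplace \<phi> x) \<le> L2_norm \<psi> * (sqrt x * exp (- (a / 2 * x)))" if x: "0 < x" for x
  proof -
    have "norm (laplace \<phi> x) = x * norm (laplace \<psi> x)" using x by (simp add: lap)
    also have "\<dots> \<le> x * (exp (- (a * x) / 2) * (L2_norm \<psi> / sqrt x))"
      using ab x by (intro mult_left_mono laplace_bound_support L2) auto
    also have "\<dots> = L2_norm \<psi> * (x / sqrt x * exp (- (a / 2 * x)))" by simp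
    also have "x / sqrt x = sqrt x" using x by (simp add: real_div_sqrt)
    finally show ?thesis .
  qed
  have ub': "norm (laplace \<phi> x) \<le> L2_norm \<psi> * sqrt x" if "0 < x" for x
  proof (rule order_trans[OF ub[OF that]])
    show "L2_norm \<psi> * (sqrt x * exp (- (a / 2 * x))) \<le> L2_norm \<psi> * sqrt x"
      using ab that by (intro mult_left_mono) (auto simp: mult_left_le)
  qed
  show pair: "(LINT t|halfline. w t * g t) = (LINT x|\<kappa>. laplace \<phi> x * laplace g x)" if "g \<in> L2" for g
    unfolding w_def using ub ab(1)
    by (intro laplace_Fubini(1)[where a=0 and c="a/2" and C="L2_norm \<psi>"] um that) auto
  have wm: "w \<in> borel_measurable halfline"
    unfolding w_def by (rule superposition_measurable[OF um ub'])
  define C where "C = (LINT t|halfline. norm (\<psi> t))"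
  define K where "K = (LINT x|\<kappa>. exp (- (a / 2 * x)))"
  have C: "0 \<le> C" unfolding C_def by (intro integral_nonneg_AE) simp
  have \<psi>i: "integrable halfline (\<lambda>t. norm (\<psi> t))"
  proof -
    have "integrable lborel \<psi>"
      using ab by (intro continuous_compact_support_integrable[of _ a b] smooth_continuous) auto
    then have "integrable lborel (\<lambda>t. indicator {0<..} t *\<^sub>R \<psi> t)"
      by (intro integrable_mult_indicator) auto
    then show ?thesis
      by (intro integrable_norm) (subst integrable_restrict_space, auto)
  qed
  have lap_bound: "norm (laplace \<psi> x) \<le> exp (- (a * x)) * C" if x: "0 < x" for x
  proof -
    have "norm (laplace \<psi> x) \<le> (LINT t|halfline. exp (- (a * x)) * norm (\<psi> t))"
      unfolding laplace_def
    proof (rule order_trans[OF integral_norm_bound], rule integral_mono)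
      show "integrable halfline (\<lambda>t. norm (exp (- (t * x)) *\<^sub>R \<psi> t))"
        by (intro integrable_norm laplace_integrable L2 x)
      show "integrable halfline (\<lambda>t. exp (- (a * x)) * norm (\<psi> t))"
        using \<psi>i by (rule integrable_mult_right)
      show "norm (exp (- (t * x)) *\<^sub>R \<psi> t) \<le> exp (- (a * x)) * norm (\<psi> t)" for t
        using ab(3)[of t] x by (cases "t < a") (auto intro!: mult_right_mono)
    qed
    then show ?thesis unfolding C_def by (simp only: integral_mult_right_zero)
  qed
  have "w \<in> L2"
  proof (rule L2_bounded[OF wm])
    show "integrable halfline (\<lambda>t. (C * K)\<^sup>2 * (1 / (t + a / 2)\<^sup>2))"
      using ab(1) by (intro integrable_mult_right inverse_square_integrable) simp
    fix t :: real assume t: "0 < t"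
    have "norm (w t) \<le> (LINT x|\<kappa>. C / (t + a / 2) * exp (- (a / 2 * x)))"
      unfolding w_def
    proof (rule order_trans[OF integral_norm_bound], rule integral_mono)
      show "integrable \<kappa> (\<lambda>x. norm (exp (- (t * x)) *\<^sub>R laplace \<phi> x))"
        by (intro integrable_norm superposition_integrable(1)[OF um ub'] t)
      show "integrable \<kappa> (\<lambda>x. C / (t + a / 2) * exp (- (a / 2 * x)))"
        using ab(1) by (intro integrable_mult_right exp_integrable) simp
      fix x assume "x \<in> space \<kappa>"
      then have x: "0 < x" by simp
      have "norm (exp (- (t * x)) *\<^sub>R laplace \<phi> x) = exp (- (t * x)) * x * norm (laplace \<psi> x)"
        using x by (simp add: lap)
      also have "\<dots> \<le> exp (- (t * x)) * x * (exp (- (a * x)) * C)"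
        using x by (intro mult_left_mono lap_bound) auto
      also have "\<dots> = C * (x * exp (- ((t + a / 2) * x))) * exp (- (a / 2 * x))"
        by (simp add: exp_add[symmetric] algebra_simps)
      also have "\<dots> \<le> C * (1 / (t + a / 2)) * exp (- (a / 2 * x))"
        using t ab(1) C by (intro mult_right_mono mult_left_mono mult_exp_le) auto
      finally show "norm (exp (- (t * x)) *\<^sub>R laplace \<phi> x) \<le> C / (t + a / 2) * exp (- (a / 2 * x))" by simp
    qed
    also have "\<dots> = C * K / (t + a / 2)"
      unfolding K_def by (subst integral_mult_right_zero) simp
    finally have "(norm (w t))\<^sup>2 \<le> (C * K / (t + a / 2))\<^sup>2" by (intro power_mono) auto
    then show "(norm (w t))\<^sup>2 \<le> (C * K)\<^sup>2 * (1 / (t + a / 2)\<^sup>2)" by (simp add: power_divide)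
  qed
  then show "weak_image \<phi> w"
    unfolding weak_image_def using \<phi> pair C_comp_L2[OF C_comp_derivative(1)] by auto
qed

end

section \<open>The Hankel operator\<close>

lemma laplace_measure_restrict:
  assumes "\<mu> \<in> class_M"
  shows "laplace_measure (restrict_space \<mu> {0<..})"
proof
  have s: "sets \<mu> = sets borel" using assms by (simp add: class_M_def)
  then show "sets (restrict_space \<mu> {0<..}) = sets (restrict_space borel {0<..})"
    by (simp add: sets_restrict_space)
  fix t :: real assume "0 < t"
  then have "(\<integral>\<^sup>+ x\<in>{0<..}. ennreal (exp (- (t * x))) \<partial>\<mu>) < \<infinity>"
    using assms by (simp add: class_M_def)
  then have "(\<integral>\<^sup>+ x. ennreal (norm (exp (- (t * x)))) \<partial>restrict_space \<mu> {0<..}) < \<infinity>"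
    using s by (subst nn_integral_restrict_space) auto
  moreover have "(\<lambda>x. exp (- (t * x))) \<in> borel_measurable (restrict_space \<mu> {0<..})"
    by (intro measurable_restrict_space1) (simp add: measurable_cong_sets[OF s refl])
  ultimately show "integrable (restrict_space \<mu> {0<..}) (\<lambda>x. exp (- (t * x)))"
    by (simp add: integrable_iff_bounded)
qed

locale hankel_measure =
  fixes \<mu> :: "real measure"
  assumes \<mu>: "\<mu> \<in> class_M"
begin

abbreviation \<kappa> :: "real measure" where "\<kappa> \<equiv> restrict_space \<mu> {0<..}"

lemma sets_\<mu>: "sets \<mu> = sets borel"
  using \<mu> by (simp add: class_M_def)

sublocale laplace_measure \<kappa>
  by (rule laplace_measure_restrict) (rule \<mu>)

lemma Q_dom_iff: "f \<in> Q_dom \<mu> \<longleftrightarrow> f \<in> L2 \<and> integrable \<kappa> (\<lambda>x. (norm (laplace f x))\<^sup>2)"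
proof -
  have "Q \<mu> f = (\<integral>\<^sup>+ x. ennreal ((norm (laplace f x))\<^sup>2) \<partial>\<kappa>)"
    unfolding Q_def using sets_\<mu> by (subst nn_integral_restrict_space) auto
  moreover have "f \<in> L2 \<Longrightarrow> (\<lambda>x. (norm (laplace f x))\<^sup>2) \<in> borel_measurable \<kappa>"
    using laplace_measurable[OF L2_measurable[of f]] by measurable
  ultimately show ?thesis
    by (auto simp: Q_dom_def integrable_iff_bounded)
qed

lemma Q_form_eq: "Q_form \<mu> f g = (LINT x|\<kappa>. laplace f x * cnj (laplace g x))"
  unfolding Q_form_def set_lebesgue_integral_def using sets_\<mu>
  by (subst integral_restrict_space) auto

text \<open>
  The form domain contains the derivatives of all test functions, so the form equation implies the weak
  equation; the converse combines \<open>weak_image_in_form_domain\<close> and \<open>weak_image_represents_form\<close>.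
\<close>

lemma hankel_iff_weak_image: "(f, G) \<in> hankel \<mu> \<longleftrightarrow> weak_image f G"
proof
  assume "(f, G) \<in> hankel \<mu>"
  then have f: "f \<in> Q_dom \<mu>" and G: "G \<in> L2"
    and q: "\<And>g. g \<in> Q_dom \<mu> \<Longrightarrow> Q_form \<mu> f g = L2_inner G g"
    by (auto simp: hankel_def form_operator_def)
  show "weak_image f G"
    unfolding weak_image_def
  proof (intro conjI ballI)
    show "f \<in> L2" using f by (simp add: Q_dom_def)
    show "G \<in> L2" by fact
    fix \<psi> assume \<psi>: "\<psi> \<in> C_comp"
    let ?d = "\<lambda>t. vector_derivative \<psi> (at t)"
    have "((\<lambda>t. cnj (\<psi> t)) has_vector_derivative cnj (?d t)) (at t)" for t
      by (intro has_vector_derivative_cnj C_comp_derivative(2)[OF \<psi>])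
    from test_function_image(1)[OF C_comp_cnj[OF \<psi>] this]
    have "(\<lambda>t. cnj (?d t)) \<in> Q_dom \<mu>"
      using weak_image_in_form_domain by (auto simp: Q_dom_iff weak_image_def)
    from q[OF this] show "(LINT t|halfline. G t * ?d t) = (LINT x|\<kappa>. laplace f x * laplace ?d x)"
      by (simp add: Q_form_eq laplace_cnj L2_inner_def)
  qed
next
  assume W: "weak_image f G"
  have "Q_form \<mu> f g = L2_inner G g" if "g \<in> Q_dom \<mu>" for g
    using weak_image_represents_form[OF W L2_cnj[of g]] that
    by (simp add: Q_form_eq L2_inner_def laplace_cnj Q_dom_iff)
  then show "(f, G) \<in> hankel \<mu>"
    using W weak_image_in_form_domain[OF W]
    by (auto simp: hankel_def form_operator_def Q_dom_iff weak_image_def)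
qed

text \<open>
  The conversion to extended non-negative reals turns the density \<open>x\<close> into its positive part, which
  is \<open>x\<close> wherever the integrand of \<open>h\<close> lives.
\<close>

lemma h_weighted:
  "h (density \<mu> (\<lambda>x. ennreal x)) t = (LINT x|\<kappa>. x * exp (- (t * x)))"
proof -
  have "density \<mu> (\<lambda>x. ennreal x) = density \<mu> (\<lambda>x. ennreal (max 0 x))"
    by (intro arg_cong[of _ _ "density \<mu>"] ext) (auto simp: max_def ennreal_neg)
  then have "h (density \<mu> (\<lambda>x. ennreal x)) t
      = (LINT x|\<mu>. max 0 x *\<^sub>R (indicator {0<..} x *\<^sub>R exp (- (t * x))))"
    unfolding h_def set_lebesgue_integral_def
    by (simp only:) (intro integral_density; simp add: measurable_cong_sets[OF sets_\<mu> refl])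
  also have "\<dots> = (LINT x|\<mu>. indicator {0<..} x *\<^sub>R (x * exp (- (t * x))))"
    by (intro Bochner_Integration.integral_cong) (auto simp: indicator_def)
  also have "\<dots> = (LINT x|\<kappa>. x * exp (- (t * x)))"
    using sets_\<mu> by (subst integral_restrict_space) auto
  finally show ?thesis .
qed

lemma hankel_derivative_eq:
  assumes f: "f \<in> L2" and t: "0 < t"
  shows "(LINT s|halfline. h (density \<mu> (\<lambda>x. ennreal x)) (t + s) *\<^sub>R f s)
    = (LINT x|\<kappa>. exp (- (t * x)) *\<^sub>R (x *\<^sub>R laplace f x))"
proof -
  let ?u = "\<lambda>x. complex_of_real (x * exp (- (t * x)))"
  have "h (density \<mu> (\<lambda>x. ennreal x)) (t + s) *\<^sub>R f s = (LINT x|\<kappa>. exp (- (s * x)) *\<^sub>R ?u x) * f s" for s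
  proof -
    have "(LINT x|\<kappa>. exp (- (s * x)) *\<^sub>R ?u x) = (LINT x|\<kappa>. complex_of_real (x * exp (- ((t + s) * x))))"
      by (intro Bochner_Integration.integral_cong)
         (auto simp: scaleR_conv_of_real algebra_simps exp_add[symmetric] simp flip: of_real_mult)
    then show ?thesis by (simp only: h_weighted scaleR_conv_of_real integral_complex_of_real)
  qed
  then have "(LINT s|halfline. h (density \<mu> (\<lambda>x. ennreal x)) (t + s) *\<^sub>R f s)
      = (LINT s|halfline. (LINT x|\<kappa>. exp (- (s * x)) *\<^sub>R ?u x) * f s)" by simp
  also have "\<dots> = (LINT x|\<kappa>. ?u x * laplace f x)"
  proof (rule laplace_Fubini(1)[where a=0 and c="t/2" and C="1 + 2 / t"])
    show "?u \<in> borel_measurable \<kappa>" by (rule measurable_\<kappa>) measurable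
    fix x :: real assume x: "0 < x"
    have "norm (?u x) = x * exp (- (t * x))"
      unfolding norm_of_real using x by simp
    also have "\<dots> = (sqrt x * sqrt x) * (exp (- (t / 2 * x)) * exp (- (t / 2 * x)))"
      using x by (simp add: exp_add[symmetric])
    also have "\<dots> = (sqrt x * exp (- (t / 2 * x))) * (sqrt x * exp (- (t / 2 * x)))"
      by (simp only: mult_ac)
    also have "\<dots> \<le> (1 + 1 / (t / 2)) * (sqrt x * exp (- (t / 2 * x)))"
      using x t by (intro mult_right_mono sqrt_exp_le) auto
    finally show "norm (?u x) * exp (- (0 * x) / 2) \<le> (1 + 2 / t) * (sqrt x * exp (- (t / 2 * x)))"
      by simp
  qed (use f t in auto)
  also have "\<dots> = (LINT x|\<kappa>. exp (- (t * x)) *\<^sub>R (x *\<^sub>R laplace f x))"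
    by (intro Bochner_Integration.integral_cong) (auto simp: scaleR_conv_of_real)
  finally show ?thesis .
qed

lemma distributional_derivative_iff_weak_image:
  assumes f: "f \<in> L2" and G: "G \<in> L2"
    and F: "\<And>t. F t = - (LINT s|halfline. h (density \<mu> (\<lambda>x. ennreal x)) (t + s) *\<^sub>R f s)"
  shows "has_distributional_derivative G F \<longleftrightarrow> weak_image f G"
proof -
  let ?p = "\<lambda>t. LINT x|\<kappa>. exp (- (t * x)) *\<^sub>R (x *\<^sub>R laplace f x)"
  have Fp: "F t = - ?p t" if "0 < t" for t
    using hankel_derivative_eq[OF f that] by (simp add: F)
  have "locally_integrable ?p"
  proof (rule superposition_locally_integrable)
    show "(\<lambda>x. x *\<^sub>R laplace f x) \<in> borel_measurable \<kappa>"
      by (intro borel_measurable_scaleR laplace_measurable L2_measurable f measurable_\<kappa>) simp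
    show "norm (x *\<^sub>R laplace f x) \<le> L2_norm f * sqrt x" if "0 < x" for x
      using laplace_bound_mult[OF f that] that by simp
  qed
  then have "locally_integrable F"
    unfolding locally_integrable_def set_integrable_def
  proof (intro allI impI)
    fix a b :: real
    assume *: "\<forall>a b. 0 < a \<longrightarrow> integrable lborel (\<lambda>t. indicator {a..b} t *\<^sub>R ?p t)" and a: "0 < a"
    have "(\<lambda>t. indicator {a..b} t *\<^sub>R F t) = (\<lambda>t. - (indicator {a..b} t *\<^sub>R ?p t))"
      using a Fp by (auto simp: fun_eq_iff indicator_def)
    then show "integrable lborel (\<lambda>t. indicator {a..b} t *\<^sub>R F t)"
      using * a by simp
  qed
  moreover have "- (LINT t|halfline. F t * \<psi> t) = (LINT x|\<kappa>. laplace f x * laplace (\<lambda>t. vector_derivative \<psi> (at t)) x)"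
    if "\<psi> \<in> C_comp" for \<psi>
  proof -
    have "(LINT t|halfline. F t * \<psi> t) = (LINT t|halfline. - (?p t * \<psi> t))"
      using Fp by (intro Bochner_Integration.integral_cong) auto
    then show ?thesis using moment_pairing[OF f that] by simp
  qed
  ultimately show ?thesis
    unfolding has_distributional_derivative_def weak_image_def
    using L2_locally_integrable[OF G] f G by simp
qed

lemma hankel_symmetric: "hankel \<mu> \<subseteq> adjoint_op (hankel \<mu>)"
proof -
  have "L2_inner u f = L2_inner \<phi> w" if "(f, w) \<in> hankel \<mu>" "(\<phi>, u) \<in> hankel \<mu>" for f w \<phi> u
  proof -
    have "L2_inner u f = Q_form \<mu> \<phi> f" "L2_inner w \<phi> = Q_form \<mu> f \<phi>"
      using that by (auto simp: hankel_def form_operator_def)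
    moreover have "Q_form \<mu> \<phi> f = cnj (Q_form \<mu> f \<phi>)"
      unfolding Q_form_eq by (subst Bochner_Integration.integral_cnj[symmetric]) (simp add: mult.commute)
    ultimately show ?thesis by (metis L2_inner_cnj)
  qed
  moreover have "hankel \<mu> \<subseteq> L2 \<times> L2"
    by (auto simp: hankel_iff_weak_image weak_image_def)
  ultimately show ?thesis by (auto simp: adjoint_op_def)
qed

lemma C_comp0_image:
  assumes "\<phi> \<in> C_comp0"
  obtains w where "(\<phi>, w) \<in> hankel \<mu>"
    "\<And>g. g \<in> L2 \<Longrightarrow> L2_inner w g = (LINT x|\<kappa>. laplace \<phi> x * cnj (laplace g x))"
proof -
  obtain \<psi> where \<psi>: "\<psi> \<in> C_comp" "\<And>t. (\<psi> has_vector_derivative \<phi> t) (at t)"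
    using assms by (auto simp: C_comp0_iff_derivative)
  let ?w = "\<lambda>t. LINT x|\<kappa>. exp (- (t * x)) *\<^sub>R laplace \<phi> x"
  have "(\<phi>, ?w) \<in> hankel \<mu>"
    unfolding hankel_iff_weak_image by (rule test_function_image(1)[OF \<psi>])
  moreover have "L2_inner ?w g = (LINT x|\<kappa>. laplace \<phi> x * cnj (laplace g x))" if "g \<in> L2" for g
    using test_function_image(2)[OF \<psi> L2_cnj[OF that]] by (simp add: L2_inner_def laplace_cnj)
  ultimately show thesis by (rule that)
qed

lemma cnj_derivative_C_comp0:
  assumes "\<psi> \<in> C_comp"
  shows "(\<lambda>t. cnj (vector_derivative \<psi> (at t))) \<in> C_comp0"
proof -
  have "((\<lambda>t. cnj (\<psi> t)) has_vector_derivative cnj (vector_derivative \<psi> (at t))) (at t)" for t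
    by (rule has_vector_derivative_cnj[OF C_comp_derivative(2)[OF assms]])
  then show ?thesis
    using C_comp_cnj[OF assms] unfolding C_comp0_iff_derivative by (intro bexI[of _ "\<lambda>t. cnj (\<psi> t)"]) simp_all
qed

text \<open>
  Being in the adjoint of the restriction is the weak equation, tested with complex conjugates of
  derivatives of test functions.
\<close>

lemma adjoint_restricted_hankel: "adjoint_op (restrict_op (hankel \<mu>) C_comp0) = hankel \<mu>"
proof
  let ?A = "restrict_op (hankel \<mu>) C_comp0"
  have "?A \<subseteq> hankel \<mu>" by (auto simp: restrict_op_def)
  then show "hankel \<mu> \<subseteq> adjoint_op ?A"
    using hankel_symmetric adjoint_op_antimono by blast
  show "adjoint_op ?A \<subseteq> hankel \<mu>"
  proof (rule subrelI)
    fix g v assume adj: "(g, v) \<in> adjoint_op ?A"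
    then have L2: "g \<in> L2" "v \<in> L2" using adjoint_op_L2 by auto
    have "(LINT t|halfline. v t * vector_derivative \<psi> (at t))
        = (LINT x|\<kappa>. laplace g x * laplace (\<lambda>t. vector_derivative \<psi> (at t)) x)" if \<psi>: "\<psi> \<in> C_comp" for \<psi>
    proof -
      let ?d = "\<lambda>t. vector_derivative \<psi> (at t)"
      let ?\<chi> = "\<lambda>t. cnj (?d t)"
      have \<chi>: "?\<chi> \<in> C_comp0" by (rule cnj_derivative_C_comp0[OF \<psi>])
      obtain u where u: "(?\<chi>, u) \<in> hankel \<mu>"
        "L2_inner u g = (LINT x|\<kappa>. laplace ?\<chi> x * cnj (laplace g x))"
        using C_comp0_image[OF \<chi>] L2(1) by metis
      have "(LINT t|halfline. v t * ?d t) = L2_inner v ?\<chi>" by (simp add: L2_inner_def)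
      also have "\<dots> = cnj (L2_inner ?\<chi> v)" by (simp add: L2_inner_cnj)
      also have "L2_inner ?\<chi> v = L2_inner u g"
        using adjoint_opD[OF adj, of ?\<chi> u] u(1) \<chi> by (simp add: restrict_op_def)
      also have "cnj \<dots> = (LINT x|\<kappa>. laplace g x * laplace ?d x)"
        unfolding u(2) by (subst Bochner_Integration.integral_cnj[symmetric]) (simp add: laplace_cnj mult.commute)
      finally show ?thesis .
    qed
    then show "(g, v) \<in> hankel \<mu>"
      using L2 by (simp add: hankel_iff_weak_image weak_image_def)
  qed
qed

lemma C_comp0_linear: "\<phi> \<in> C_comp0 \<Longrightarrow> \<phi>' \<in> C_comp0 \<Longrightarrow> (\<lambda>t. \<phi> t + c * \<phi>' t) \<in> C_comp0"
  unfolding C_comp0_iff_derivative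
proof (elim bexE)
  fix \<psi> \<psi>' assume \<psi>: "\<psi> \<in> C_comp" "\<forall>t. (\<psi> has_vector_derivative \<phi> t) (at t)"
    "\<psi>' \<in> C_comp" "\<forall>t. (\<psi>' has_vector_derivative \<phi>' t) (at t)"
  show "\<exists>\<psi>\<in>C_comp. \<forall>t. (\<psi> has_vector_derivative \<phi> t + c * \<phi>' t) (at t)"
    using \<psi> by (intro bexI[of _ "\<lambda>t. \<psi> t + c * \<psi>' t"] allI has_vector_derivative_add
        has_vector_derivative_mult_right C_comp_add C_comp_scale) auto
qed

lemma C_comp0_subset_L2: "C_comp0 \<subseteq> L2"
  using C_comp_L2 by (auto simp: C_comp0_def)

text \<open>
  Whatever is orthogonal to all test functions of mean zero is a weak image of \<open>0\<close>, so it vanishes by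
  uniqueness. The projection theorem converts this into density.
\<close>

lemma restricted_hankel_densely_defined: "densely_defined (restrict_op (hankel \<mu>) C_comp0)"
  unfolding densely_defined_def
proof (intro ballI allI impI)
  fix g and \<epsilon> :: real assume g: "g \<in> L2" and \<epsilon>: "0 < \<epsilon>"
  define V :: L2_operator where "V = {(\<phi>, \<lambda>t. 0) | \<phi>. \<phi> \<in> C_comp0}"
  have "(\<lambda>t. 0) \<in> C_comp0"
    unfolding C_comp0_iff_derivative
    by (intro bexI[of _ "\<lambda>t. 0"] allI has_vector_derivative_const C_compI[of _ 1 2] smooth_const) auto
  then have V1: "V \<noteq> {}" by (auto simp: V_def)
  have V2: "V \<subseteq> L2 \<times> L2" using C_comp0_subset_L2 L2_zero by (auto simp: V_def)
  have V3: "(\<lambda>t. f t + c * f' t, \<lambda>t. w t + c * w' t) \<in> V" if "(f, w) \<in> V" "(f', w') \<in> V" for f w f' w' c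
    using that C_comp0_linear by (auto simp: V_def)
  obtain p q where pq: "(p, q) \<in> closure_op V"
    and orth: "\<And>\<phi> u. (\<phi>, u) \<in> V \<Longrightarrow> L2_inner (\<lambda>t. g t - p t) \<phi> + L2_inner (\<lambda>t. 0 - q t) u = 0"
    using graph_projection[OF V2 V1 V3 g L2_zero] by blast
  have p: "p \<in> L2" using pq by (auto simp: closure_op_def)
  have zero: "laplace (\<lambda>t. 0) x = 0" for x by (simp add: laplace_def)
  have "weak_image (\<lambda>t. 0) (\<lambda>t. g t - p t)"
    unfolding weak_image_def
  proof (intro conjI ballI L2_zero L2_diff g p)
    fix \<psi> assume "\<psi> \<in> C_comp"
    from orth[of "\<lambda>t. cnj (vector_derivative \<psi> (at t))" "\<lambda>t. 0"] cnj_derivative_C_comp0[OF this]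
    show "(LINT t|halfline. (g t - p t) * vector_derivative \<psi> (at t))
        = (LINT x|\<kappa>. laplace (\<lambda>t. 0) x * laplace (\<lambda>t. vector_derivative \<psi> (at t)) x)"
      by (simp add: L2_inner_def zero V_def)
  qed
  moreover have "weak_image (\<lambda>t. 0) (\<lambda>t. 0)"
    by (simp add: weak_image_def L2_zero zero)
  ultimately have "AE t in halfline. g t - p t = 0"
    by (rule weak_image_unique)
  then have gp: "L2_norm (\<lambda>t. g t - p t) = 0"
    using L2_norm_eq_0_iff[OF L2_diff[OF g p]] by simp
  obtain \<phi> u where \<phi>: "\<phi> \<in> C_comp0" "graph_norm (\<lambda>t. p t - \<phi> t) u < \<epsilon>"
    using pq \<epsilon> by (fastforce simp: closure_op_def V_def)
  have "L2_norm (\<lambda>t. g t - \<phi> t) \<le> L2_norm (\<lambda>t. g t - p t) + L2_norm (\<lambda>t. p t - \<phi> t)"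
    using C_comp0_subset_L2 \<phi>(1) by (intro L2_triangle_diff g p) auto
  also have "\<dots> < \<epsilon>" using gp \<phi>(2) L2_norm_le_graph_norm(1)[of "\<lambda>t. p t - \<phi> t" u] by simp
  finally have "L2_norm (\<lambda>t. g t - \<phi> t) < \<epsilon>" .
  moreover obtain w where "(\<phi>, w) \<in> hankel \<mu>" using C_comp0_image[OF \<phi>(1)] by blast
  then have "\<phi> \<in> Domain (restrict_op (hankel \<mu>) C_comp0)" using \<phi>(1) by (auto simp: restrict_op_def)
  ultimately show "\<exists>f\<in>Domain (restrict_op (hankel \<mu>) C_comp0). L2_norm (\<lambda>t. g t - f t) < \<epsilon>" by blast
qed

lemma restricted_hankel_essentially_self_adjoint:
  "closure_op (restrict_op (hankel \<mu>) C_comp0) = hankel \<mu>"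
  "essentially_self_adjoint (restrict_op (hankel \<mu>) C_comp0)"
proof -
  let ?A = "restrict_op (hankel \<mu>) C_comp0"
  have A: "?A \<subseteq> adjoint_op ?A"
    unfolding adjoint_restricted_hankel by (auto simp: restrict_op_def)
  have AL2: "?A \<subseteq> L2 \<times> L2" using A adjoint_op_L2 by blast
  have lin: "(\<lambda>t. f t + c * f' t, \<lambda>t. w t + c * w' t) \<in> ?A" if "(f, w) \<in> ?A" "(f', w') \<in> ?A" for f w f' w' c
  proof -
    have "(\<lambda>t. f t + c * f' t, \<lambda>t. w t + c * w' t) \<in> adjoint_op ?A"
      using that A by (intro adjoint_op_linear[OF AL2]) auto
    then show ?thesis
      using that C_comp0_linear unfolding adjoint_restricted_hankel by (auto simp: restrict_op_def)
  qed
  have sym: "adjoint_op ?A \<subseteq> adjoint_op (adjoint_op ?A)"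
    unfolding adjoint_restricted_hankel by (rule hankel_symmetric)
  note * = essentially_self_adjointI[OF A restricted_hankel_densely_defined lin sym]
  show "closure_op ?A = hankel \<mu>"
    using *(1) unfolding adjoint_restricted_hankel .
  show "essentially_self_adjoint ?A" by (rule *(2))
qed

end

theorem theorem2p4:
  fixes \<mu> \<nu> :: "real measure" and F :: "(real \<Rightarrow> complex) \<Rightarrow> real \<Rightarrow> complex"
  assumes mu: "\<mu> \<in> class_M"
    and nu: "\<nu> = density \<mu> (\<lambda>x. ennreal x)"
    and F: "\<And>f t. F f t = - (LINT s|halfline. h \<nu> (t + s) *\<^sub>R f s)"
  shows
    "(\<forall>f\<in>L2.
        (f \<in> Domain (hankel \<mu>) \<longleftrightarrow> (\<exists>G\<in>L2. has_distributional_derivative G (F f))) \<and>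
        (f \<in> Domain (hankel \<mu>) \<longrightarrow>
           (\<forall>w. (f, w) \<in> hankel \<mu> \<longleftrightarrow> w \<in> L2 \<and> has_distributional_derivative w (F f)) \<and>
           (\<forall>w\<in>L2. \<forall>w'\<in>L2. has_distributional_derivative w (F f) \<and>
              has_distributional_derivative w' (F f) \<longrightarrow> (AE t in halfline. w t = w' t))))
     \<and> C_comp0 \<subseteq> Domain (hankel \<mu>)
     \<and> (\<forall>(f, w)\<in>hankel \<mu>. \<forall>\<epsilon>>0. \<exists>(\<phi>, u)\<in>restrict_op (hankel \<mu>) C_comp0.
          graph_norm (\<lambda>t. f t - \<phi> t) (\<lambda>t. w t - u t) < \<epsilon>)
     \<and> essentially_self_adjoint (restrict_op (hankel \<mu>) C_comp0)"
proof -
  interpret hankel_measure \<mu> by unfold_locales (rule mu)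
  have dd: "has_distributional_derivative G (F f) \<longleftrightarrow> weak_image f G" if "f \<in> L2" "G \<in> L2" for f G
    by (rule distributional_derivative_iff_weak_image[OF that F[unfolded nu]])
  have hankel: "(f, w) \<in> hankel \<mu> \<longleftrightarrow> w \<in> L2 \<and> has_distributional_derivative w (F f)" if "f \<in> L2" for f w
    using dd[OF that] by (auto simp: hankel_iff_weak_image weak_image_def)
  have dom: "f \<in> Domain (hankel \<mu>) \<longleftrightarrow> (\<exists>G\<in>L2. has_distributional_derivative G (F f))" if "f \<in> L2" for f
    using hankel[OF that] by auto
  have unique: "AE t in halfline. w t = w' t"
    if "f \<in> L2" "w \<in> L2" "w' \<in> L2" "has_distributional_derivative w (F f)" "has_distributional_derivative w' (F f)"
    for f w w'
    using that by (intro weak_image_unique[of f]) (simp_all add: dd)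
  have i: "\<forall>f\<in>L2.
        (f \<in> Domain (hankel \<mu>) \<longleftrightarrow> (\<exists>G\<in>L2. has_distributional_derivative G (F f))) \<and>
        (f \<in> Domain (hankel \<mu>) \<longrightarrow>
           (\<forall>w. (f, w) \<in> hankel \<mu> \<longleftrightarrow> w \<in> L2 \<and> has_distributional_derivative w (F f)) \<and>
           (\<forall>w\<in>L2. \<forall>w'\<in>L2. has_distributional_derivative w (F f) \<and>
              has_distributional_derivative w' (F f) \<longrightarrow> (AE t in halfline. w t = w' t)))"
    using dom hankel unique by (intro ballI conjI impI allI) (assumption | elim conjE | simp only:)+
  have test: "C_comp0 \<subseteq> Domain (hankel \<mu>)"
    using C_comp0_image by blast
  have "\<forall>\<epsilon>>0. \<exists>(\<phi>, u)\<in>restrict_op (hankel \<mu>) C_comp0.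
      graph_norm (\<lambda>t. f t - \<phi> t) (\<lambda>t. w t - u t) < \<epsilon>" if "(f, w) \<in> hankel \<mu>" for f w
  proof -
    have "(f, w) \<in> closure_op (restrict_op (hankel \<mu>) C_comp0)"
      using that by (simp only: restricted_hankel_essentially_self_adjoint(1))
    then show ?thesis unfolding closure_op_def by blast
  qed
  then have core: "\<forall>(f, w)\<in>hankel \<mu>. \<forall>\<epsilon>>0. \<exists>(\<phi>, u)\<in>restrict_op (hankel \<mu>) C_comp0.
      graph_norm (\<lambda>t. f t - \<phi> t) (\<lambda>t. w t - u t) < \<epsilon>"
    by (intro ballI) (simp only: split_paired_all prod.case)
  show ?thesis
    by (intro conjI i test core restricted_hankel_essentially_self_adjoint(2))
qed

end
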